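(* Let $\mathsf{k}$ be a field of characteristic zero and let $X=\{P_1,\dots,P_s\}$ be a set of $s$ distinct ($\mathsf{k}$-rational) points in $\mathbb{P}^2_{\mathsf{k}}$ which lie on a conic (smooth or singular). Let $L_i$ be the linear form dual to $P_i$, and let $A$ be an Artinian Gorenstein quotient of $A(X)$ with dual generator $F=\sum_{i=1}^s\alpha_iL_i^d$, where $d\geq 2\tau(X)$ and $\alpha_i\in\mathsf{k}$, $\alpha_i\neq 0$ for every $i$. Then $A$ satisfies the strong Lefschetz property.
   Context: Let $S=\mathsf{k}[x_0,x_1,x_2]$ (standard grading) act on $R=\mathsf{k}[X_0,X_1,X_2]$ by letting $x_i$ act as $\partial/\partial X_i$; the action is denoted $\circ$. For $F\in R$ homogeneous of degree $d$, $F\ne 0$, the algebra with Macaulay dual generator $F$ is $A=S/\mathrm{Ann}_S(F)$, $\mathrm{Ann}_S(F)=\{g\in S: g\circ F=0\}$; it is Artinian Gorenstein of socle degree $d$. For a finite set $X$ of $s$ distinct points in $\mathbb{P}^2_{\mathsf{k}}$, $I(X)\subset S$ is the homogeneous ideal generated by forms vanishing on $X$, $A(X)=S/I(X)$, $h_{A(X)}(i)=\dim_{\mathsf{k}}A(X)_i$, and $\tau(X)=\min\{i: h_{A(X)}(i)=s\}$. For $P=(a_0:a_1:a_2)$ (with a fixed choice of coordinates) the dual linear form is $L=a_0X_0+a_1X_1+a_2X_2\in R$. If $F=\sum_i\alpha_iL_i^d$ with the $L_i$ dual to the points $P_i\in X$, then $I(X)\subseteq\mathrm{Ann}_S(F)$,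 so $S/\mathrm{Ann}_S(F)$ is a quotient of $A(X)$. A conic is the zero locus in $\mathbb{P}^2$ of a nonzero quadratic form. A graded Artinian algebra $A$ satisfies the strong Lefschetz property (SLP) if there is a linear form $\ell\in A_1$ such that $\times\ell^j:A_i\to A_{i+j}$ has maximal rank for all $i,j\geq 0$. *)

theory Defs
  imports
    "HOL-Library.Poly_Mapping"
    "HOL-Library.Numeral_Type"
    "HOL-Algebra.Embedded_Algebras"
    "HOL-Algebra.QuotRing"
    "HOL-Algebra.Algebraic_Closure_Type"
begin

section \<open>Polynomials in three variables\<close>

text \<open>
  The variables are indexed by the three-element type \<open>3\<close>, whose elements are \<open>0\<close>, \<open>1\<close>, \<open>2\<close>.
  The rings \<open>S\<close> and \<open>R\<close> are both modelled by the type \<open>'k mpoly3\<close>; in \<open>diff_act g F\<close> the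
  argument \<open>g\<close> belongs to \<open>S\<close> (and acts as a differential operator) and \<open>F\<close> belongs to \<open>R\<close>.
\<close>

type_synonym 'k mpoly3 = "(3 \<Rightarrow>\<^sub>0 nat) \<Rightarrow>\<^sub>0 'k"

abbreviation const3 :: "'k::field_char_0 \<Rightarrow> 'k mpoly3"
  where "const3 c \<equiv> Poly_Mapping.single 0 c"

abbreviation var3 :: "3 \<Rightarrow> 'k::field_char_0 mpoly3"
  where "var3 i \<equiv> Poly_Mapping.single (Poly_Mapping.single i 1) 1"

definition mdeg :: "(3 \<Rightarrow>\<^sub>0 nat) \<Rightarrow> nat"
  where "mdeg m = (\<Sum>i\<in>UNIV. Poly_Mapping.lookup m i)"

definition forms :: "nat \<Rightarrow> 'k::field_char_0 mpoly3 set"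
  where "forms n = {f. \<forall>m\<in>Poly_Mapping.keys f. mdeg m = n}"

definition eval3 :: "'k::field_char_0 mpoly3 \<Rightarrow> (3 \<Rightarrow> 'k) \<Rightarrow> 'k"
  where "eval3 f a =
    (\<Sum>m\<in>Poly_Mapping.keys f. Poly_Mapping.lookup f m * (\<Prod>i\<in>UNIV. a i ^ Poly_Mapping.lookup m i))"

text \<open>
  In \<open>partial3\<close>, the truncated subtraction of exponents is harmless: if \<open>X\<^sub>i\<close> does not occur
  in the monomial \<open>m\<close>, then the coefficient is \<open>0\<close>.
\<close>

definition partial3 :: "3 \<Rightarrow> 'k::field_char_0 mpoly3 \<Rightarrow> 'k mpoly3"
  where "partial3 i F =
    (\<Sum>m\<in>Poly_Mapping.keys F.
      Poly_Mapping.single (m - Poly_Mapping.single i 1)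
        (of_nat (Poly_Mapping.lookup m i) * Poly_Mapping.lookup F m))"

definition diff_act :: "'k::field_char_0 mpoly3 \<Rightarrow> 'k mpoly3 \<Rightarrow> 'k mpoly3"
  where "diff_act g F =
    (\<Sum>m\<in>Poly_Mapping.keys g.
      const3 (Poly_Mapping.lookup g m) *
        (partial3 0 ^^ Poly_Mapping.lookup m 0)
          ((partial3 1 ^^ Poly_Mapping.lookup m 1)
            ((partial3 2 ^^ Poly_Mapping.lookup m 2) F)))"

definition Ann_form :: "'k::field_char_0 mpoly3 \<Rightarrow> 'k mpoly3 set"
  where "Ann_form F = {g. diff_act g F = 0}"


section \<open>Graded quotients of the polynomial ring\<close>

abbreviation poly3_ring :: "'k::field_char_0 mpoly3 ring"
  where "poly3_ring \<equiv> ring_of_type_algebra"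

definition quot_piece :: "'k::field_char_0 mpoly3 set \<Rightarrow> nat \<Rightarrow> 'k mpoly3 set set"
  where "quot_piece I n = (\<lambda>f. I +>\<^bsub>poly3_ring\<^esub> f) ` forms n"

text \<open>The copy of the field \<open>k\<close> inside \<open>S/I\<close>.\<close>

definition quot_scalars :: "'k::field_char_0 mpoly3 set \<Rightarrow> 'k mpoly3 set set"
  where "quot_scalars I = (\<lambda>c. I +>\<^bsub>poly3_ring\<^esub> const3 c) ` UNIV"

definition hilbert_fun :: "'k::field_char_0 mpoly3 set \<Rightarrow> nat \<Rightarrow> nat"
  where "hilbert_fun I n =
    ring.dim (poly3_ring Quot I) (quot_scalars I) (quot_piece I n)"

text \<open>For a linear map between finite-dimensional spaces, maximal rank means injective or surjective.\<close>

definition maximal_rank :: "('a \<Rightarrow> 'b) \<Rightarrow> 'a set \<Rightarrow> 'b set \<Rightarrow> bool"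
  where "maximal_rank \<phi> U V \<longleftrightarrow> inj_on \<phi> U \<or> \<phi> ` U = V"

text \<open>\<open>G i\<close> is the homogeneous component of degree \<open>i\<close> of the graded algebra \<open>A\<close>.\<close>

definition strong_lefschetz :: "('a, 'b) ring_scheme \<Rightarrow> (nat \<Rightarrow> 'a set) \<Rightarrow> bool"
  where "strong_lefschetz A G \<longleftrightarrow>
    (\<exists>l\<in>G 1. \<forall>i j. maximal_rank (\<lambda>u. l [^]\<^bsub>A\<^esub> (j::nat) \<otimes>\<^bsub>A\<^esub> u) (G i) (G (i + j)))"


section \<open>Points of the projective plane\<close>

text \<open>A point is the set of all its vectors of homogeneous coordinates.\<close>

definition proportional :: "((3 \<Rightarrow> 'k::field_char_0) \<times> (3 \<Rightarrow> 'k)) set"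
  where "proportional =
    {(a, b). a \<noteq> (\<lambda>_. 0) \<and> b \<noteq> (\<lambda>_. 0) \<and> (\<exists>c. c \<noteq> 0 \<and> b = (\<lambda>i. c * a i))}"

definition proj_plane :: "(3 \<Rightarrow> 'k::field_char_0) set set"
  where "proj_plane = {a. a \<noteq> (\<lambda>_. 0)} // proportional"

definition vanishes_at :: "'k::field_char_0 mpoly3 \<Rightarrow> (3 \<Rightarrow> 'k) set \<Rightarrow> bool"
  where "vanishes_at f p \<longleftrightarrow> (\<forall>a\<in>p. eval3 f a = 0)"

definition vanishing_ideal :: "(3 \<Rightarrow> 'k::field_char_0) set set \<Rightarrow> 'k mpoly3 set"
  where "vanishing_ideal Z =
    genideal poly3_ring {f. (\<exists>n. f \<in> forms n) \<and> (\<forall>p\<in>Z. vanishes_at f p)}"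

definition tau :: "(3 \<Rightarrow> 'k::field_char_0) set set \<Rightarrow> nat"
  where "tau Z = (LEAST i. hilbert_fun (vanishing_ideal Z) i = card Z)"

definition conic :: "(3 \<Rightarrow> 'k::field_char_0) set set \<Rightarrow> bool"
  where "conic C \<longleftrightarrow> (\<exists>q. q \<noteq> 0 \<and> q \<in> forms 2 \<and> C = {p \<in> proj_plane. vanishes_at q p})"

definition dual_form :: "(3 \<Rightarrow> 'k::field_char_0) \<Rightarrow> 'k mpoly3"
  where "dual_form a = (\<Sum>i\<in>UNIV. const3 (a i) * var3 i)"

end

theory Submission
  imports Defs
begin

text \<open>
  Since \<open>g \<circ> F\<close> is read off from the functional \<open>\<Lambda>(f) = \<Sum>\<^sub>p \<alpha>\<^sub>p f(a\<^sub>p)\<close> on forms of degree \<open>d\<close>,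
  the Lefschetz property amounts to finding one linear form \<open>l\<close> such that for all \<open>i \<le> d/2\<close> the
  form \<open>(g, h) \<mapsto> \<Lambda>(l\<^bsup>d - 2 i\<^esup> g h)\<close> on forms of degree \<open>i\<close> has only forms vanishing on the points
  in its radical. For \<open>i \<ge> \<tau>\<close> any \<open>l\<close> without zeros among the points will do. For \<open>i < \<tau>\<close> the conic
  is brought into one of the affine shapes \<open>y = x\<^sup>2\<close> or \<open>x y = 0\<close>, none of the points being at infinity.

  On the parabola, forms of degree \<open>i\<close> become polynomials of degree \<open>2 i\<close> in \<open>x\<close>, and the tangent
  line at \<open>u\<close> becomes \<open>(x - u)\<^sup>2\<close>, so that everything follows from a one-variable statement: for
  nonzero weights on few enough points, twisting by \<open>(x - u)\<^bsup>e\<^esup>\<close> leaves the weighted inner product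
  nondegenerate for all but finitely many \<open>u\<close>. A polynomial \<open>f\<close> in the radical yields
  \<open>(x - u)\<^bsup>e\<^esup> f\<close> in a space of polynomials of dimension \<open>e\<close>, and by a Wronskian argument such a space
  contains a nonzero multiple of \<open>(x - u)\<^bsup>e\<^esup>\<close> for only finitely many \<open>u\<close>.

  On the two lines, fix the slope of \<open>l\<close> on the line with fewer points; taking the orthogonal
  complement of the polynomials vanishing at the node replaces that line by a single weight at the
  node, and the one-variable statement applies to the other line.
\<close>

section \<open>Univariate polynomials\<close>

lemma smult_sum_right: "smult a (\<Sum>i\<in>S. f i) = (\<Sum>i\<in>S. smult a (f i))" for f :: "'a \<Rightarrow> 'b::comm_semiring_1 poly"
  by (induction S rule: infinite_finite_induct) (simp_all add: smult_add_right)

lemma pderiv_sum: "pderiv (\<Sum>i\<in>S. f i) = (\<Sum>i\<in>S. pderiv (f i))"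
  by (induction S rule: infinite_finite_induct) (simp_all add: pderiv_add)

text \<open>Wronskian induction on the number of generators: the operator \<open>D\<close> built
  from one generator kills that generator and lowers the order of vanishing at \<open>u\<close> by
  at most one. The \<open>H i\<close> are only a spanning family, since the polynomials
  \<open>D (H i)\<close> may become dependent.\<close>

lemma finite_high_order_in_span:
  fixes H :: "'i \<Rightarrow> 'k::field_char_0 poly"
  assumes "finite I"
  shows "finite {u. \<exists>c. (\<Sum>i\<in>I. smult (c i) (H i)) \<noteq> 0 \<and>
    [:-u, 1:] ^ card I dvd (\<Sum>i\<in>I. smult (c i) (H i))}"
  using assms
proof (induction I arbitrary: H rule: finite_induct)
  case empty
  then show ?case by simp
next
  case (insert j I)
  show ?case
  proof (cases "H j = 0")
    case True
    have "{u. \<exists>c. (\<Sum>i\<in>insert j I. smult (c i) (H i)) \<noteq> 0 \<and>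
        [:-u, 1:] ^ card (insert j I) dvd (\<Sum>i\<in>insert j I. smult (c i) (H i))}
      \<subseteq> {u. \<exists>c. (\<Sum>i\<in>I. smult (c i) (H i)) \<noteq> 0 \<and>
        [:-u, 1:] ^ card I dvd (\<Sum>i\<in>I. smult (c i) (H i))}"
      using insert.hyps True by (auto simp del: mult_pCons_left dest: dvd_mult_right)
    then show ?thesis using insert.IH[of H] finite_subset by blast
  next
    case False
    \<comment> \<open>\<open>D h\<close> is the Wronskian of \<open>H j\<close> and
      \<open>h\<close>, the numerator of the derivative of \<open>h / H j\<close>.\<close>
    define D where "D = (\<lambda>h. H j * pderiv h - pderiv (H j) * h)"
    have D_sum: "D (\<Sum>i\<in>J. smult (c i) (H i)) = (\<Sum>i\<in>J. smult (c i) (D (H i)))" for J c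
      by (simp add: D_def pderiv_sum pderiv_smult smult_sum_right sum_distrib_left sum_subtractf
          smult_diff_right)
    let ?B = "{u. \<exists>c. (\<Sum>i\<in>I. smult (c i) (D (H i))) \<noteq> 0 \<and>
        [:-u, 1:] ^ card I dvd (\<Sum>i\<in>I. smult (c i) (D (H i)))}"
    have "u \<in> ?B \<union> {u. poly (H j) u = 0}"
      if h0: "(\<Sum>i\<in>insert j I. smult (c i) (H i)) \<noteq> 0"
        and dv: "[:-u, 1:] ^ card (insert j I) dvd (\<Sum>i\<in>insert j I. smult (c i) (H i))" for u c
    proof (rule ccontr)
      assume "u \<notin> ?B \<union> {u. poly (H j) u = 0}"
      then have nB: "u \<notin> ?B" and nz: "poly (H j) u \<noteq> 0" by auto
      define h where "h = (\<Sum>i\<in>insert j I. smult (c i) (H i))"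
      have DH: "D (H j) = 0" by (simp add: D_def)
      have Dh: "D h = (\<Sum>i\<in>I. smult (c i) (D (H i)))"
        using insert.hyps unfolding h_def D_sum by (simp add: DH)
      have "[:-u, 1:] ^ Suc (card I) dvd h" using dv insert.hyps by (simp add: h_def)
      then obtain k where k: "h = [:-u, 1:] ^ Suc (card I) * k" by (auto elim: dvdE)
      have "[:-u, 1:] ^ card I dvd pderiv h"
        unfolding k pderiv_mult pderiv_power_Suc unfolding power_Suc
        by (intro dvd_add) (auto simp del: mult_pCons_left intro: dvd_mult dvd_mult2 dvd_smult)
      moreover have "[:-u, 1:] ^ card I dvd h" unfolding k power_Suc by (intro dvd_mult2 dvd_mult dvd_refl)
      ultimately have "[:-u, 1:] ^ card I dvd D h" unfolding D_def by (intro dvd_diff dvd_mult)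
      with nB Dh have "D h = 0" by auto
      \<comment> \<open>Compare orders at \<open>u\<close>: since \<open>H j\<close> does not vanish
        there and the characteristic is zero, the left side has order one less than
        \<open>h\<close>, while the right side has at least the order of \<open>h\<close>.\<close>
      then have eq: "H j * pderiv h = pderiv (H j) * h" by (simp add: D_def)
      have hne: "h \<noteq> 0" using h0 h_def by simp
      have root: "poly h u = 0" unfolding k by simp
      have "pderiv h \<noteq> 0"
      proof
        assume "pderiv h = 0"
        then obtain a where "h = [:a:]" by (metis pderiv_eq_0_iff degree_eq_zeroE)
        with root hne show False by simp
      qed
      have "order u h = Suc (order u (pderiv h))" by (rule order_pderiv[OF hne root])
      moreover have "order u (H j) = 0" using nz by (simp add: order_0I)
      moreover have "H j * pderiv h \<noteq> 0" using False \<open>pderiv h \<noteq> 0\<close> by simp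
      ultimately show False using eq order_mult[of "H j" "pderiv h" u] order_mult[of "pderiv (H j)" h u]
        by simp
    qed
    then have "{u. \<exists>c. (\<Sum>i\<in>insert j I. smult (c i) (H i)) \<noteq> 0 \<and>
        [:-u, 1:] ^ card (insert j I) dvd (\<Sum>i\<in>insert j I. smult (c i) (H i))}
      \<subseteq> ?B \<union> {u. poly (H j) u = 0}" by blast
    moreover have "finite ?B" using insert.IH[of "\<lambda>i. D (H i)"] .
    moreover have "finite {u. poly (H j) u = 0}" using False by (rule poly_roots_finite)
    ultimately show ?thesis using finite_subset by blast
  qed
qed

lemma lagrange_polynomial:
  fixes T :: "'k::field set"
  assumes "finite T" "t \<in> T"
  obtains L where "Polynomial.degree L \<le> card T - 1" "\<And>s. s \<in> T \<Longrightarrow> poly L s = (if s = t then 1 else 0)"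
proof -
  define M where "M = (\<Prod>r\<in>T-{t}. [:-r, 1:])"
  have Mt: "poly M t \<noteq> 0" using assms by (auto simp: M_def poly_prod)
  have Ms: "poly M s = 0" if "s \<in> T" "s \<noteq> t" for s
    using that assms by (auto simp: M_def poly_prod intro!: prod_zero bexI[of _ s])
  have "Polynomial.degree M \<le> (\<Sum>r\<in>T-{t}. Polynomial.degree [:-r, 1:])"
    unfolding M_def using degree_prod_sum_le[of "T-{t}" "\<lambda>r. [:-r,1:]"] assms by (simp add: o_def)
  also have "\<dots> = card T - 1" using assms by simp
  finally have "Polynomial.degree (smult (inverse (poly M t)) M) \<le> card T - 1"
    using degree_smult_le le_trans by blast
  then show thesis using that[of "smult (inverse (poly M t)) M"] Mt Ms by auto
qed

lemma prod_linear_dvd: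
  fixes p :: "'k::field poly"
  assumes "finite T" "\<And>t. t \<in> T \<Longrightarrow> poly p t = 0"
  shows "(\<Prod>t\<in>T. [:-t, 1:]) dvd p"
  using assms
proof (induction T arbitrary: p rule: finite_induct)
  case (insert t T)
  then obtain q where q: "p = [:-t, 1:] * q" by (metis dvdE insertI1 poly_eq_0_iff_dvd)
  have "poly q s = 0" if "s \<in> T" for s
    using insert.prems[of s] insert.hyps that q by auto
  then show ?case using insert.IH[of q] insert.hyps q by (auto simp del: mult_pCons_left intro: mult_dvd_mono)
qed simp

text \<open>For \<open>h = (X - u)^e f\<close> the radical condition becomes \<open>n + 1\<close>
  linear conditions in which \<open>u\<close> no longer occurs. If \<open>T\<close> has more than
  \<open>n + 1\<close> points, these conditions cut the polynomials of degree at most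
  \<open>e + n\<close> down to a fixed space of dimension \<open>e\<close>, and \<open>h\<close> is
  a multiple of \<open>(X - u)^e\<close> in it.\<close>

lemma finite_degenerate_shifts:
  fixes T :: "'k::field_char_0 set"
  assumes T: "finite T" and w: "\<And>t. t \<in> T \<Longrightarrow> w t \<noteq> 0" and card: "card T \<le> e + n + 1"
  shows "finite {u. \<exists>f. Polynomial.degree f \<le> n \<and>
    (\<forall>g. Polynomial.degree g \<le> n \<longrightarrow> (\<Sum>t\<in>T. w t * (t - u) ^ e * poly f t * poly g t) = 0) \<and>
    (\<exists>t\<in>T. poly f t \<noteq> 0)}" (is "finite ?B")
proof (cases "card T \<le> n + 1")
  case True
  have "?B \<subseteq> T"
  proof clarify
    fix u f t
    assume f: "\<forall>g. Polynomial.degree g \<le> n \<longrightarrow> (\<Sum>t\<in>T. w t * (t - u) ^ e * poly f t * poly g t) = 0"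
      and t: "t \<in> T" "poly f t \<noteq> 0"
    \<comment> \<open>With at most \<open>n + 1\<close> points a Lagrange polynomial is an
      admissible test and isolates the term at \<open>t\<close>.\<close>
    obtain L where L: "Polynomial.degree L \<le> card T - 1" "\<And>s. s \<in> T \<Longrightarrow> poly L s = (if s = t then 1 else 0)"
      using lagrange_polynomial[OF T t(1)] by blast
    have "0 = (\<Sum>s\<in>T. w s * (s - u) ^ e * poly f s * poly L s)" using f L(1) True by simp
    also have "\<dots> = w t * (t - u) ^ e * poly f t"
      using T t L(2) by (simp add: if_distrib[of "\<lambda>x. _ * x"] cong: if_cong)
    finally have "t = u" using w t by auto
    then show "u \<in> T" using t by simp
  qed
  then show ?thesis using T finite_subset by blast
next
  case False
  \<comment> \<open>On \<open>n + 1\<close> points the Lagrange polynomials have degree at most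
    \<open>n\<close> and may serve as tests; they will express the values of \<open>h\<close> on
    \<open>T0\<close> through those on \<open>T - T0\<close>.\<close>
  then obtain T0 where T0: "T0 \<subseteq> T" "card T0 = n + 1" by (metis obtain_subset_with_card_n nat_le_linear)
  have fT0: "finite T0" using T T0 finite_subset by blast
  have "\<forall>t\<in>T. \<exists>L. Polynomial.degree L \<le> card T - 1 \<and> (\<forall>s\<in>T. poly L s = (if s = t then 1 else 0))"
    using lagrange_polynomial[OF T] by metis
  then obtain L where L: "\<And>t. t \<in> T \<Longrightarrow> Polynomial.degree (L t) \<le> card T - 1"
    "\<And>t s. t \<in> T \<Longrightarrow> s \<in> T \<Longrightarrow> poly (L t) s = (if s = t then 1 else 0)" by metis
  have "\<forall>t\<in>T0. \<exists>L. Polynomial.degree L \<le> card T0 - 1 \<and> (\<forall>s\<in>T0. poly L s = (if s = t then 1 else 0))"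
    using lagrange_polynomial[OF fT0] by metis
  then obtain G where G: "\<And>t. t \<in> T0 \<Longrightarrow> Polynomial.degree (G t) \<le> n"
    "\<And>t s. t \<in> T0 \<Longrightarrow> s \<in> T0 \<Longrightarrow> poly (G t) s = (if s = t then 1 else 0)" using T0 by (metis add_diff_cancel_right')
  define \<pi> where "\<pi> = (\<Prod>t\<in>T. [:-t, 1:])"
  have \<pi>: "\<pi> \<noteq> 0" "Polynomial.degree \<pi> = card T"
    unfolding \<pi>_def using T by (auto simp: degree_prod_eq_sum_degree)
  define N where "N = e + n + 1 - card T"
  define I where "I = (T - T0) <+> {..<N}"
  \<comment> \<open>A generator of the first kind has value 1 at one point \<open>t\<close> outside
    \<open>T0\<close>, 0 at the other points outside \<open>T0\<close>, and on \<open>T0\<close> the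
    values forced by orthogonality. The second kind spans the multiples of \<open>\<pi>\<close> of
    degree at most \<open>e + n\<close>.\<close>
  define H where "H = (\<lambda>i. case i of Inl t \<Rightarrow> L t - (\<Sum>j\<in>T0. smult (w t / w j * poly (G j) t) (L j))
    | Inr k \<Rightarrow> \<pi> * Polynomial.monom 1 k)"
  have fI: "finite I" using T by (simp add: I_def)
  \<comment> \<open>There are \<open>card T - (n + 1)\<close> generators of the first kind and
    \<open>e + n + 1 - card T\<close> of the second; the bound on \<open>card T\<close> makes the
    last subtraction exact.\<close>
  have cI: "card I = e"
    using T T0 fT0 card False by (simp add: I_def card_Plus card_Diff_subset N_def)
  have "u \<in> {u. \<exists>c. (\<Sum>i\<in>I. smult (c i) (H i)) \<noteq> 0 \<and> [:-u, 1:] ^ card I dvd (\<Sum>i\<in>I. smult (c i) (H i))}"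
    if f: "Polynomial.degree f \<le> n"
      "\<forall>g. Polynomial.degree g \<le> n \<longrightarrow> (\<Sum>t\<in>T. w t * (t - u) ^ e * poly f t * poly g t) = 0"
      "t0 \<in> T" "poly f t0 \<noteq> 0" for u f t0
  proof -
    define h where "h = [:-u, 1:] ^ e * f"
    have ph: "poly h t = (t - u) ^ e * poly f t" for t by (simp add: h_def)
    have h0: "h \<noteq> 0" using f by (auto simp: h_def)
    have dh: "Polynomial.degree h \<le> e + n"
      using f(1) degree_mult_le[of "[:-u, 1:] ^ e" f] unfolding h_def by (simp add: degree_power_eq)
    \<comment> \<open>The difference of \<open>h\<close> and its interpolant vanishes on
      \<open>T\<close>, hence is a multiple of \<open>\<pi>\<close>; the cofactor has degree below
      \<open>N\<close>.\<close>
    define r where "r = h - (\<Sum>t\<in>T. smult (poly h t) (L t))"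
    have "poly r s = 0" if "s \<in> T" for s
      using that L(2) T by (simp add: r_def poly_sum if_distrib[of "\<lambda>x. _ * x"] cong: if_cong)
    then have "\<pi> dvd r" unfolding \<pi>_def using prod_linear_dvd T by blast
    then obtain q where q: "r = \<pi> * q" by (auto elim: dvdE)
    have "Polynomial.degree (\<Sum>t\<in>T. smult (poly h t) (L t)) \<le> e + n"
    proof (rule degree_sum_le[OF T])
      fix t assume "t \<in> T"
      then have "Polynomial.degree (L t) \<le> e + n" using L(1)[of t] card by linarith
      then show "Polynomial.degree (smult (poly h t) (L t)) \<le> e + n"
        using degree_smult_le le_trans by blast
    qed
    then have dr: "Polynomial.degree r \<le> e + n" unfolding r_def using dh by (rule degree_diff_le[rotated])
    have qc: "Polynomial.coeff q k = 0" if "k \<ge> N" for k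
    proof (cases "q = 0")
      case False
      then have "Polynomial.degree r = card T + Polynomial.degree q" using q \<pi> by (simp add: degree_mult_eq)
      then have "Polynomial.degree q < N" using dr by (simp add: N_def)
      then show ?thesis using that by (simp add: coeff_eq_0)
    qed simp
    have qsum: "q = (\<Sum>k<N. Polynomial.monom (Polynomial.coeff q k) k)"
      by (rule poly_eqI) (auto simp: coeff_sum qc not_less)
    \<comment> \<open>Testing against \<open>G j\<close> leaves a single term from \<open>T0\<close>
      and can be solved for \<open>poly h j\<close>.\<close>
    have orth: "poly h j = - (\<Sum>t\<in>T-T0. w t / w j * poly h t * poly (G j) t)" if j: "j \<in> T0" for j
    proof -
      have wj: "w j \<noteq> 0" using w j T0 by auto
      have "0 = (\<Sum>t\<in>T. w t * poly h t * poly (G j) t)"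
        using f(2) G(1)[OF j] by (simp add: ph mult.assoc)
      also have "\<dots> = (\<Sum>t\<in>T-T0. w t * poly h t * poly (G j) t) + (\<Sum>t\<in>T0. w t * poly h t * poly (G j) t)"
        using sum.subset_diff[OF T0(1) T] by auto
      also have "(\<Sum>t\<in>T0. w t * poly h t * poly (G j) t) = w j * poly h j"
        using fT0 j G(2)[OF j] by (simp add: if_distrib[of "\<lambda>x. _ * x"] cong: if_cong)
      finally have "w j * poly h j = - (\<Sum>t\<in>T-T0. w t * poly h t * poly (G j) t)"
        by (simp add: eq_neg_iff_add_eq_0 add.commute)
      then have "poly h j = - (\<Sum>t\<in>T-T0. w t * poly h t * poly (G j) t) / w j" using wj by (simp add: field_simps)
      also have "\<dots> = - (\<Sum>t\<in>T-T0. w t / w j * poly h t * poly (G j) t)"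
        by (simp add: sum_divide_distrib)
      finally show ?thesis .
    qed
    define c where "c = (\<lambda>i. case i of Inl t \<Rightarrow> poly h t | Inr k \<Rightarrow> Polynomial.coeff q k)"
    have "(\<Sum>i\<in>I. smult (c i) (H i)) = (\<Sum>t\<in>T-T0. smult (c (Inl t)) (H (Inl t))) + (\<Sum>k<N. smult (c (Inr k)) (H (Inr k)))"
      unfolding I_def by (subst sum.Plus) (use T in auto)
    also have "(\<Sum>k<N. smult (c (Inr k)) (H (Inr k))) = \<pi> * q"
      unfolding c_def H_def by (subst (2) qsum) (simp add: sum_distrib_left smult_monom flip: mult_smult_right)
    also have "(\<Sum>t\<in>T-T0. smult (c (Inl t)) (H (Inl t))) = (\<Sum>t\<in>T. smult (poly h t) (L t))"
    proof -
      have "(\<Sum>t\<in>T-T0. smult (c (Inl t)) (H (Inl t))) = (\<Sum>t\<in>T-T0. smult (poly h t) (L t))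
          - (\<Sum>t\<in>T-T0. \<Sum>j\<in>T0. smult (w t / w j * poly h t * poly (G j) t) (L j))"
        unfolding c_def H_def by (simp add: smult_diff_right smult_sum_right sum_subtractf mult_ac)
      also have "(\<Sum>t\<in>T-T0. \<Sum>j\<in>T0. smult (w t / w j * poly h t * poly (G j) t) (L j))
          = (\<Sum>j\<in>T0. - smult (poly h j) (L j))"
        by (subst sum.swap) (simp add: orth smult_sum)
      finally show ?thesis using sum.subset_diff[OF T0(1) T, of "\<lambda>t. smult (poly h t) (L t)"]
        by (simp add: sum_negf)
    qed
    finally have "(\<Sum>i\<in>I. smult (c i) (H i)) = h" using q r_def by (simp add: algebra_simps)
    then show ?thesis using h0 unfolding cI by (intro CollectI exI[of _ c]) (simp add: h_def)
  qed
  then have "?B \<subseteq> {u. \<exists>c. (\<Sum>i\<in>I. smult (c i) (H i)) \<noteq> 0 \<and> [:-u, 1:] ^ card I dvd (\<Sum>i\<in>I. smult (c i) (H i))}"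
    by blast
  then show ?thesis using finite_high_order_in_span[OF fI] finite_subset by blast
qed

section \<open>Ternary forms\<close>

lemma UNIV_3: "(UNIV :: 3 set) = {0, 1, 2}"
proof -
  have "card {0, 1, 2 :: 3} = CARD(3)" by simp
  then show ?thesis using card_subset_eq[of UNIV "{0, 1, 2 :: 3}"] by simp
qed

lemma sum_3: "(\<Sum>i\<in>(UNIV::3 set). f i) = f 0 + f 1 + f 2"
  unfolding UNIV_3 by (simp add: add.assoc)

lemma all_3: "(\<forall>i::3. Q i) \<longleftrightarrow> Q 0 \<and> Q 1 \<and> Q 2"
  by (metis UNIV_3 UNIV_I insert_iff singletonD)

lemma mdeg_add [simp]: "mdeg (m + n) = mdeg m + mdeg n"
  by (simp add: mdeg_def lookup_add sum.distrib)

lemma mdeg_0 [simp]: "mdeg 0 = 0"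
  by (simp add: mdeg_def)

lemma mdeg_single [simp]: "mdeg (Poly_Mapping.single i k) = k"
  by (simp add: mdeg_def lookup_single when_def)

section \<open>Evaluation of ternary polynomials\<close>

definition monom_val :: "(3 \<Rightarrow> 'k) \<Rightarrow> (3 \<Rightarrow>\<^sub>0 nat) \<Rightarrow> 'k::comm_semiring_1"
  where "monom_val a m = (\<Prod>i\<in>UNIV. a i ^ Poly_Mapping.lookup m i)"

lemma monom_val_0 [simp]: "monom_val a 0 = 1"
  by (simp add: monom_val_def)

lemma monom_val_add: "monom_val a (m + n) = monom_val a m * monom_val a n"
  by (simp add: monom_val_def lookup_add power_add prod.distrib)

lemma monom_val_single [simp]: "monom_val a (Poly_Mapping.single i k) = a i ^ k"
  by (simp add: monom_val_def lookup_single when_def if_distrib[of "\<lambda>n. _ ^ n"] cong: if_cong)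

text \<open>The linear functional with prescribed values on monomials. Evaluation, the functional
  \<open>\<Lambda>\<close> and the weighted coefficients of \<open>diff_act\<close> are all
  instances.\<close>

definition lin_ext :: "('m \<Rightarrow> 'b) \<Rightarrow> ('m \<Rightarrow>\<^sub>0 'b) \<Rightarrow> 'b::comm_semiring_1"
  where "lin_ext \<phi> f = (\<Sum>m\<in>Poly_Mapping.keys f. Poly_Mapping.lookup f m * \<phi> m)"

lemma lin_ext_0 [simp]: "lin_ext \<phi> 0 = 0"
  by (simp add: lin_ext_def)

lemma lin_ext_single [simp]: "lin_ext \<phi> (Poly_Mapping.single m c) = c * \<phi> m"
  by (simp add: lin_ext_def)

lemma lin_ext_add: "lin_ext \<phi> (f + g) = lin_ext \<phi> f + lin_ext \<phi> g"
  unfolding lin_ext_def by (rule setsum_keys_plus_distrib) (simp_all add: algebra_simps)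

lemma lin_ext_sum: "lin_ext \<phi> (\<Sum>i\<in>S. f i) = (\<Sum>i\<in>S. lin_ext \<phi> (f i))"
  by (induction S rule: infinite_finite_induct) (simp_all add: lin_ext_add)

lemma poly_mapping_sum_single: "f = (\<Sum>m\<in>Poly_Mapping.keys f. Poly_Mapping.single m (Poly_Mapping.lookup f m))"
  by (rule poly_mapping_eqI)
    (auto simp: lookup_sum lookup_single when_def in_keys_iff sum.delta)

lemma lin_ext_single_mult:
  "lin_ext \<phi> (Poly_Mapping.single n c * f) = c * lin_ext (\<lambda>m. \<phi> (n + m)) f"
  by (subst poly_mapping_sum_single[of f])
    (simp add: sum_distrib_left mult_single lin_ext_sum lin_ext_def[of _ f] mult.assoc)

lemma lin_ext_const_mult: "lin_ext \<phi> (Poly_Mapping.single 0 c * f) = c * lin_ext \<phi> (f :: 'm::comm_monoid_add \<Rightarrow>\<^sub>0 _)"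
  by (simp add: lin_ext_single_mult)

lemma lin_ext_fun_sum: "lin_ext (\<lambda>m. \<Sum>i\<in>S. c i * \<phi> i m) f = (\<Sum>i\<in>S. c i * lin_ext (\<phi> i) f)"
  by (simp add: lin_ext_def sum_distrib_left sum.swap[of _ S] mult_ac)

lemma eval3_lin_ext: "eval3 f a = lin_ext (monom_val a) f"
  by (simp add: eval3_def lin_ext_def monom_val_def)

lemma eval3_0 [simp]: "eval3 0 a = 0"
  by (simp add: eval3_lin_ext)

lemma eval3_single [simp]: "eval3 (Poly_Mapping.single m c) a = c * monom_val a m"
  by (simp add: eval3_lin_ext)

lemma eval3_1 [simp]: "eval3 1 a = 1"
  using eval3_single[of 0 1 a] by simp

lemma eval3_add [simp]: "eval3 (f + g) a = eval3 f a + eval3 g a"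
  by (simp add: eval3_lin_ext lin_ext_add)

lemma eval3_sum [simp]: "eval3 (\<Sum>i\<in>S. f i) a = (\<Sum>i\<in>S. eval3 (f i) a)"
  by (simp add: eval3_lin_ext lin_ext_sum)

lemma eval3_mult [simp]: "eval3 (f * g) a = eval3 f a * eval3 g a"
proof -
  have "eval3 (Poly_Mapping.single m c * g) a = eval3 (Poly_Mapping.single m c) a * eval3 g a" for m c
    unfolding eval3_lin_ext lin_ext_single_mult lin_ext_single monom_val_add
    by (simp add: lin_ext_def sum_distrib_left mult_ac)
  then show ?thesis
    by (subst (1 2) poly_mapping_sum_single[of f]) (simp add: sum_distrib_right del: eval3_single)
qed

lemma eval3_uminus [simp]: "eval3 (- f) a = - eval3 f a"
  using eval3_add[of f "- f" a] by (simp add: eq_neg_iff_add_eq_0 add.commute del: eval3_add)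

lemma eval3_diff [simp]: "eval3 (f - g) a = eval3 f a - eval3 g a"
  using eval3_add[of f "- g" a] by simp

lemma eval3_power [simp]: "eval3 (f ^ n) a = eval3 f a ^ n"
  by (induction n) simp_all

lemma eval3_prod [simp]: "eval3 (\<Prod>i\<in>S. f i) a = (\<Prod>i\<in>S. eval3 (f i) a)"
  by (induction S rule: infinite_finite_induct) simp_all

lemma eval3_dual_form: "eval3 (dual_form c) a = (\<Sum>i\<in>UNIV. c i * a i)"
  by (simp add: dual_form_def)

section \<open>Homogeneous forms\<close>

lemma forms_0 [simp]: "0 \<in> forms n" by (simp add: forms_def)

lemma forms_single: "Poly_Mapping.single m c \<in> forms (mdeg m)"
  by (simp add: forms_def)

lemma forms_add: "f \<in> forms n \<Longrightarrow> g \<in> forms n \<Longrightarrow> f + g \<in> forms n"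
  using keys_add[of f g] by (auto simp: forms_def)

lemma forms_sum: "(\<And>i. i \<in> S \<Longrightarrow> f i \<in> forms n) \<Longrightarrow> (\<Sum>i\<in>S. f i) \<in> forms n"
  by (induction S rule: infinite_finite_induct) (simp_all add: forms_add)

lemma forms_mult: "f \<in> forms m \<Longrightarrow> g \<in> forms n \<Longrightarrow> f * g \<in> forms (m + n)"
  using keys_mult[of f g] by (fastforce simp: forms_def)

lemma forms_const: "const3 c \<in> forms 0"
  by (simp add: forms_def)

lemma forms_const_mult: "f \<in> forms n \<Longrightarrow> const3 c * f \<in> forms n"
  using forms_mult[OF forms_const] by fastforce

lemma forms_one: "1 \<in> forms 0"
  using forms_const[of 1] by simp

lemma forms_power: "f \<in> forms m \<Longrightarrow> f ^ k \<in> forms (k * m)"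
  by (induction k) (auto simp: forms_one dest: forms_mult)

lemma forms_uminus: "f \<in> forms n \<Longrightarrow> - f \<in> forms n"
  by (auto simp: forms_def in_keys_iff)

lemma forms_diff: "f \<in> forms n \<Longrightarrow> g \<in> forms n \<Longrightarrow> f - g \<in> forms n"
  using forms_add[of f n "- g"] forms_uminus by fastforce

lemma forms_dual_form: "dual_form c \<in> forms 1"
proof -
  have "var3 i \<in> (forms 1 :: 'a mpoly3 set)" for i
    using forms_single[of "Poly_Mapping.single i 1" 1] by simp
  then show ?thesis unfolding dual_form_def by (intro forms_sum forms_const_mult)
qed

lemma forms_prod_one: "(\<And>i. i \<in> S \<Longrightarrow> f i \<in> forms 1) \<Longrightarrow> finite S \<Longrightarrow> (\<Prod>i\<in>S. f i) \<in> forms (card S)"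
proof (induction S rule: infinite_finite_induct)
  case (insert x F)
  then show ?case using forms_mult[of "f x" 1 "prod f F" "card F"] by simp
qed (simp_all add: forms_one)

lemma monom_val_scale: "monom_val (\<lambda>i. c * a i) m = c ^ mdeg m * monom_val a m"
  by (simp add: monom_val_def mdeg_def power_mult_distrib prod.distrib power_sum)

lemma eval3_scale: "f \<in> forms n \<Longrightarrow> eval3 f (\<lambda>i. c * a i) = c ^ n * eval3 f a"
  by (simp add: eval3_lin_ext lin_ext_def monom_val_scale forms_def sum_distrib_left mult_ac)

section \<open>Coefficients of derivatives and of powers of linear forms\<close>

lemma lookup_const_mult: "Poly_Mapping.lookup (Poly_Mapping.single 0 c * f) m = c * Poly_Mapping.lookup f m"
  by (simp flip: mult_map_scale_conv_mult add: Poly_Mapping.map.rep_eq when_def)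

lemma lookup_var_mult:
  fixes f :: "('i \<Rightarrow>\<^sub>0 nat) \<Rightarrow>\<^sub>0 'b::comm_semiring_1"
  shows
  "Poly_Mapping.lookup (Poly_Mapping.single (Poly_Mapping.single i 1) 1 * f) m =
    (if Poly_Mapping.lookup m i > 0 then Poly_Mapping.lookup f (m - Poly_Mapping.single i 1) else 0)"
proof -
  have eq: "m = Poly_Mapping.single i 1 + n \<longleftrightarrow> Poly_Mapping.lookup m i > 0 \<and> n = m - Poly_Mapping.single i 1" for n
  proof
    assume "Poly_Mapping.lookup m i > 0 \<and> n = m - Poly_Mapping.single i 1"
    then show "m = Poly_Mapping.single i 1 + n"
      by (intro poly_mapping_eqI) (auto simp: lookup_add lookup_minus lookup_single when_def)
  qed (auto simp: lookup_add)
  have "Poly_Mapping.lookup (Poly_Mapping.single (Poly_Mapping.single i 1) 1 * f) m =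
    (\<Sum>n\<in>Poly_Mapping.keys f. if m = Poly_Mapping.single i 1 + n then Poly_Mapping.lookup f n else 0)"
    by (subst poly_mapping_sum_single[of f])
      (simp add: sum_distrib_left mult_single lookup_sum lookup_single when_def eq_commute[of _ m])
  then show ?thesis unfolding eq by (auto simp: in_keys_iff)
qed

text \<open>The multi-factorial \<open>m!\<close>. Weighting coefficients by it turns partial
  derivatives into shifts of exponents and clears the multinomial coefficients from powers of linear
  forms.\<close>

definition mfact :: "(3 \<Rightarrow>\<^sub>0 nat) \<Rightarrow> 'k::field_char_0"
  where "mfact m = (\<Prod>i\<in>UNIV. fact (Poly_Mapping.lookup m i))"

lemma mfact_nonzero [simp]: "mfact m \<noteq> 0"
  by (simp add: mfact_def)

lemma mfact_add_single:
  "mfact (n + Poly_Mapping.single i 1) = of_nat (Suc (Poly_Mapping.lookup n i)) * mfact n"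
proof -
  have "mfact (n + Poly_Mapping.single i 1) = (\<Prod>j\<in>UNIV. (if j = i then of_nat (Suc (Poly_Mapping.lookup n i)) else 1) * fact (Poly_Mapping.lookup n j) :: 'a)"
    unfolding mfact_def by (intro prod.cong) (auto simp: lookup_add lookup_single when_def)
  then show ?thesis by (simp add: prod.distrib mfact_def del: of_nat_Suc)
qed

lemma lookup_partial3:
  "Poly_Mapping.lookup (partial3 i F) n =
    of_nat (Suc (Poly_Mapping.lookup n i)) * Poly_Mapping.lookup F (n + Poly_Mapping.single i 1)"
proof -
  have eq: "(of_nat (Poly_Mapping.lookup m i) * Poly_Mapping.lookup F m when m - Poly_Mapping.single i 1 = n) =
      (if m = n + Poly_Mapping.single i 1 then of_nat (Suc (Poly_Mapping.lookup n i)) * Poly_Mapping.lookup F m else 0)" for m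
  proof (cases "Poly_Mapping.lookup m i = 0")
    case True
    then have "m \<noteq> n + Poly_Mapping.single i 1" by (auto simp: lookup_add)
    then show ?thesis using True by (simp add: when_def)
  next
    case False
    then have "m - Poly_Mapping.single i 1 = n \<longleftrightarrow> m = n + Poly_Mapping.single i 1"
      by (auto simp: poly_mapping_eq_iff fun_eq_iff lookup_add lookup_minus lookup_single when_def)
    then show ?thesis by (auto simp: when_def lookup_add)
  qed
  show ?thesis unfolding partial3_def lookup_sum lookup_single eq
    by (simp add: in_keys_iff del: of_nat_Suc)
qed

lemma mfact_lookup_partial3_funpow:
  "mfact n * Poly_Mapping.lookup ((partial3 i ^^ k) F) n =
    mfact (n + Poly_Mapping.single i k) * Poly_Mapping.lookup F (n + Poly_Mapping.single i k)"
proof (induction k arbitrary: n)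
  case (Suc k)
  have "mfact n * Poly_Mapping.lookup ((partial3 i ^^ Suc k) F) n =
    mfact (n + Poly_Mapping.single i 1) * Poly_Mapping.lookup ((partial3 i ^^ k) F) (n + Poly_Mapping.single i 1)"
    by (simp add: lookup_partial3 mfact_add_single mult_ac del: of_nat_Suc One_nat_def)
  then show ?case unfolding Suc.IH by (simp add: add.assoc flip: single_add)
qed simp

text \<open>In factorially weighted coefficients the operator attached to a monomial
  \<open>m\<close> only shifts the exponent from \<open>n\<close> to \<open>n + m\<close>, so the
  differential action becomes contraction and depends on \<open>g\<close> through a linear
  functional.\<close>

lemma mfact_lookup_diff_act:
  "mfact n * Poly_Mapping.lookup (diff_act g F) n =
    lin_ext (\<lambda>m. mfact (n + m) * Poly_Mapping.lookup F (n + m)) g"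
proof -
  \<comment> \<open>The iterated partial derivatives shift the three exponents one at a time; this
    recombines the shifts.\<close>
  have m: "m = Poly_Mapping.single 0 (Poly_Mapping.lookup m 0) + Poly_Mapping.single 1 (Poly_Mapping.lookup m 1)
      + Poly_Mapping.single 2 (Poly_Mapping.lookup m 2)" for m :: "3 \<Rightarrow>\<^sub>0 nat"
  proof (rule poly_mapping_eqI)
    fix i :: 3
    have "i = 0 \<or> i = 1 \<or> i = 2" using UNIV_3 by blast
    then show "Poly_Mapping.lookup m i = Poly_Mapping.lookup (Poly_Mapping.single 0 (Poly_Mapping.lookup m 0)
      + Poly_Mapping.single 1 (Poly_Mapping.lookup m 1) + Poly_Mapping.single 2 (Poly_Mapping.lookup m 2)) i"
      by (auto simp: lookup_add lookup_single when_def)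
  qed
  have "mfact n * Poly_Mapping.lookup (const3 c * (partial3 0 ^^ Poly_Mapping.lookup m 0)
          ((partial3 1 ^^ Poly_Mapping.lookup m 1)
            ((partial3 2 ^^ Poly_Mapping.lookup m 2) F))) n = c * (mfact (n + m) * Poly_Mapping.lookup F (n + m))" for m c
    unfolding lookup_const_mult mult.left_commute[of _ c] mfact_lookup_partial3_funpow
    by (subst (7 8) m) (simp add: add.assoc)
  then show ?thesis by (simp add: diff_act_def lin_ext_def lookup_sum sum_distrib_left)
qed

text \<open>The multinomial theorem, by induction on \<open>n\<close>: the summand for the variable
  \<open>i\<close> contributes the factor \<open>Poly_Mapping.lookup m i\<close>, and these factors
  add up to the degree of \<open>m\<close>.\<close>

lemma mfact_lookup_dual_form_power:
  "mfact m * Poly_Mapping.lookup (dual_form a ^ n) m = (if mdeg m = n then fact n * monom_val a m else 0)"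
proof (induction n arbitrary: m)
  case 0
  have "mdeg m = 0 \<longleftrightarrow> m = 0"
    by (auto simp: mdeg_def poly_mapping_eq_iff fun_eq_iff)
  then show ?case by (auto simp: lookup_one mfact_def)
next
  case (Suc n)
  have "mfact m * Poly_Mapping.lookup (const3 (a i) * var3 i * dual_form a ^ n) m =
     of_nat (Poly_Mapping.lookup m i) * (if mdeg m = Suc n then fact n * monom_val a m else 0)" for i
  proof (cases "Poly_Mapping.lookup m i = 0")
    case True
    then show ?thesis by (simp add: mult.assoc lookup_const_mult lookup_var_mult del: One_nat_def)
  next
    case False
    define m' where "m' = m - Poly_Mapping.single i 1"
    have m: "m = m' + Poly_Mapping.single i 1"
      unfolding m'_def using False
      by (intro poly_mapping_eqI) (auto simp: lookup_add lookup_minus lookup_single when_def)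
    have "mfact m * Poly_Mapping.lookup (const3 (a i) * var3 i * dual_form a ^ n) m =
      a i * (mfact m * Poly_Mapping.lookup (dual_form a ^ n) m')"
      using False by (simp add: mult.assoc lookup_const_mult lookup_var_mult m'_def del: One_nat_def)
    also have "\<dots> = a i * (of_nat (Poly_Mapping.lookup m i) * mfact m' * Poly_Mapping.lookup (dual_form a ^ n) m')"
      unfolding m mfact_add_single by (simp add: lookup_add)
    also have "\<dots> = a i * (of_nat (Poly_Mapping.lookup m i) * (if mdeg m' = n then fact n * monom_val a m' else 0))"
      by (simp only: mult.assoc Suc.IH)
    also have "\<dots> = of_nat (Poly_Mapping.lookup m i) * (if mdeg m = Suc n then fact n * monom_val a m else 0)"
      unfolding m by (simp add: monom_val_add)
    finally show ?thesis .
  qed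
  then have "mfact m * Poly_Mapping.lookup (dual_form a ^ Suc n) m =
    (\<Sum>i\<in>UNIV. of_nat (Poly_Mapping.lookup m i) * (if mdeg m = Suc n then fact n * monom_val a m else 0))"
    by (simp add: dual_form_def[of a] sum_distrib_right lookup_sum sum_distrib_left)
  also have "\<dots> = of_nat (mdeg m) * (if mdeg m = Suc n then fact n * monom_val a m else 0)"
    by (simp add: mdeg_def sum_distrib_right)
  finally show ?case by simp
qed

text \<open>Scalar multiplication is a parameter because both univariate polynomials
  (\<open>smult\<close>) and ternary forms (multiplication by \<open>const3\<close>) occur as
  vectors.\<close>

definition linear_functional :: "('k::field \<Rightarrow> 'v \<Rightarrow> 'v) \<Rightarrow> ('v::ab_group_add \<Rightarrow> 'k) \<Rightarrow> bool"
  where "linear_functional scale \<phi> \<longleftrightarrow>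
    (\<forall>f g. \<phi> (f + g) = \<phi> f + \<phi> g) \<and> (\<forall>c f. \<phi> (scale c f) = c * \<phi> f)"

lemma functional_in_span:
  assumes "finite J" "\<And>j. j \<in> J \<Longrightarrow> linear_functional scale (\<phi> j)" "linear_functional scale \<psi>"
    and "\<And>x. x \<in> V \<Longrightarrow> (\<And>j. j \<in> J \<Longrightarrow> \<phi> j x = 0) \<Longrightarrow> \<psi> x = 0"
    and V: "\<And>x y. x \<in> V \<Longrightarrow> y \<in> V \<Longrightarrow> x + y \<in> V" "\<And>c x. x \<in> V \<Longrightarrow> scale c x \<in> V"
  shows "\<exists>c. \<forall>x\<in>V. \<psi> x = (\<Sum>j\<in>J. c j * \<phi> j x)"
  using assms(1-4)
proof (induction J arbitrary: \<psi> rule: finite_induct)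
  case empty
  then show ?case by simp
next
  case (insert j J)
  note lin = insert.prems(1)[unfolded linear_functional_def] insert.prems(2)[unfolded linear_functional_def]
  show ?case
  proof (cases "\<forall>x\<in>V. (\<forall>i\<in>J. \<phi> i x = 0) \<longrightarrow> \<phi> j x = 0")
    case True
    then have "\<psi> x = 0" if "x \<in> V" "\<And>i. i \<in> J \<Longrightarrow> \<phi> i x = 0" for x
      using that insert.prems(3) by blast
    then obtain c where "\<forall>x\<in>V. \<psi> x = (\<Sum>i\<in>J. c i * \<phi> i x)"
      using insert.IH[of \<psi>] insert.prems(1,2) by auto
    moreover have "(\<Sum>i\<in>insert j J. (c(j := 0)) i * \<phi> i x) = (\<Sum>i\<in>J. c i * \<phi> i x)" for x
      using insert.hyps by (simp add: sum.insert) (auto intro!: sum.cong)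
    ultimately show ?thesis by (intro exI[of _ "c(j := 0)"]) simp
  next
    case False
    then obtain v where v: "v \<in> V" "\<And>i. i \<in> J \<Longrightarrow> \<phi> i v = 0" "\<phi> j v \<noteq> 0" by blast
    define b where "b = \<psi> v / \<phi> j v"
    define \<psi>' where "\<psi>' = (\<lambda>x. \<psi> x - b * \<phi> j x)"
    have "linear_functional scale \<psi>'"
      using lin by (simp add: linear_functional_def \<psi>'_def algebra_simps)
    moreover have "\<psi>' x = 0" if x: "x \<in> V" "\<And>i. i \<in> J \<Longrightarrow> \<phi> i x = 0" for x
    proof -
      define r where "r = \<phi> j x / \<phi> j v"
      define y where "y = x + scale (- r) v"
      have "y \<in> V" unfolding y_def using x v by (intro V)
      moreover have "\<phi> i y = 0" if "i \<in> insert j J" for i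
        using that lin(1)[of i] x v by (auto simp: y_def r_def)
      ultimately have "\<psi> y = 0" using insert.prems(3) by blast
      then show ?thesis using lin(2) v by (simp add: y_def \<psi>'_def r_def b_def)
    qed
    ultimately obtain c where c: "\<forall>x\<in>V. \<psi>' x = (\<Sum>i\<in>J. c i * \<phi> i x)"
      using insert.IH[of \<psi>'] insert.prems(1) by auto
    have "(\<Sum>i\<in>insert j J. (c(j := b)) i * \<phi> i x) = b * \<phi> j x + (\<Sum>i\<in>J. c i * \<phi> i x)" for x
      using insert.hyps by (simp add: sum.insert) (auto intro!: sum.cong)
    then show ?thesis using c by (intro exI[of _ "c(j := b)"]) (auto simp: \<psi>'_def algebra_simps)
  qed
qed

section \<open>Weighted pairings on indexed points\<close>

lemma finite_degenerate_indexed: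
  fixes x :: "'j \<Rightarrow> 'k::field_char_0"
  assumes J: "finite J" and inj: "inj_on x J" and w: "\<And>j. j \<in> J \<Longrightarrow> w j \<noteq> 0"
    and card: "card J \<le> e + n + 1"
  shows "finite {u. \<exists>f. Polynomial.degree f \<le> n \<and>
    (\<forall>g. Polynomial.degree g \<le> n \<longrightarrow> (\<Sum>j\<in>J. w j * (x j - u) ^ e * poly f (x j) * poly g (x j)) = 0) \<and>
    (\<exists>j\<in>J. poly f (x j) \<noteq> 0)}"
proof -
  define v where "v = (\<lambda>t. w (inv_into J x t))"
  have "(\<Sum>t\<in>x ` J. v t * (t - u) ^ e * poly f t * poly g t) =
      (\<Sum>j\<in>J. w j * (x j - u) ^ e * poly f (x j) * poly g (x j))" for u f g
    unfolding sum.reindex[OF inj] by (intro sum.cong) (auto simp: v_def inj)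
  moreover have "v t \<noteq> 0" if "t \<in> x ` J" for t
    using that w inv_into_into[of t x J] by (auto simp: v_def)
  ultimately show ?thesis
    using finite_degenerate_shifts[of "x ` J" v e n] J card by (simp add: card_image[OF inj])
qed

text \<open>For \<open>c \<noteq> 0\<close> the factor \<open>1 + c * x\<close> is \<open>c\<close>
  times \<open>x - (- 1 / c)\<close>, so slopes correspond to shifts; the slope 0 is simply counted
  as exceptional.\<close>

lemma finite_degenerate_slopes:
  fixes x :: "'j \<Rightarrow> 'k::field_char_0"
  assumes "finite J" "inj_on x J" "\<And>j. j \<in> J \<Longrightarrow> w j \<noteq> 0" "card J \<le> e + n + 1"
  shows "finite {c. \<exists>f. Polynomial.degree f \<le> n \<and>
    (\<forall>g. Polynomial.degree g \<le> n \<longrightarrow> (\<Sum>j\<in>J. w j * (1 + c * x j) ^ e * poly f (x j) * poly g (x j)) = 0) \<and>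
    (\<exists>j\<in>J. poly f (x j) \<noteq> 0)}" (is "finite ?C")
proof -
  let ?B = "{u. \<exists>f. Polynomial.degree f \<le> n \<and>
    (\<forall>g. Polynomial.degree g \<le> n \<longrightarrow> (\<Sum>j\<in>J. w j * (x j - u) ^ e * poly f (x j) * poly g (x j)) = 0) \<and>
    (\<exists>j\<in>J. poly f (x j) \<noteq> 0)}"
  have "c \<in> insert 0 ((\<lambda>u. - 1 / u) ` ?B)"
    if f: "Polynomial.degree f \<le> n"
      "\<forall>g. Polynomial.degree g \<le> n \<longrightarrow> (\<Sum>j\<in>J. w j * (1 + c * x j) ^ e * poly f (x j) * poly g (x j)) = 0"
      "\<exists>j\<in>J. poly f (x j) \<noteq> 0" for c f
  proof (cases "c = 0")
    case False
    have eq: "1 + c * x j = c * (x j - (- 1 / c))" for j using False by (simp add: field_simps)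
    have "(\<Sum>j\<in>J. w j * (x j - (- 1 / c)) ^ e * poly f (x j) * poly g (x j)) = 0"
      if g: "Polynomial.degree g \<le> n" for g
    proof -
      have "c ^ e * (\<Sum>j\<in>J. w j * (x j - (- 1 / c)) ^ e * poly f (x j) * poly g (x j)) =
          (\<Sum>j\<in>J. w j * (1 + c * x j) ^ e * poly f (x j) * poly g (x j))"
        unfolding eq power_mult_distrib sum_distrib_left by (simp add: mult_ac)
      then show ?thesis using f(2) g False by simp
    qed
    then have "- 1 / c \<in> ?B" using f by blast
    then show ?thesis by (intro insertI2 image_eqI[of _ _ "- 1 / c"]) (use False in auto)
  qed simp
  then have "?C \<subseteq> insert 0 ((\<lambda>u. - 1 / u) ` ?B)" by blast
  moreover have "finite (insert 0 ((\<lambda>u. - 1 / u) ` ?B))"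
    by (intro finite.insertI finite_imageI finite_degenerate_indexed assms)
  ultimately show ?thesis by (rule finite_subset)
qed

text \<open>The polynomials of degree at most \<open>n + 1\<close> vanishing at 0 are the
  \<open>X f\<close>, and on them the pairing with weights \<open>v\<close> becomes the one with
  weights \<open>v y^2\<close>, nondegenerate by assumption. Hence their orthogonal complement is,
  as functions on \<open>J\<close>, the line spanned by one \<open>q\<close> with
  \<open>q(0) = 1\<close>.\<close>

lemma orthogonal_section:
  fixes y v :: "'j \<Rightarrow> 'k::field_char_0"
  assumes J: "finite J"
    and nondeg: "\<And>f. Polynomial.degree f \<le> n \<Longrightarrow>
      (\<And>g. Polynomial.degree g \<le> n \<Longrightarrow> (\<Sum>j\<in>J. v j * (y j)\<^sup>2 * poly f (y j) * poly g (y j)) = 0) \<Longrightarrow>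
      \<forall>j\<in>J. poly f (y j) = 0"
  obtains q where "Polynomial.degree q \<le> Suc n" "poly q 0 = 1"
    "\<And>g. Polynomial.degree g \<le> Suc n \<Longrightarrow> poly g 0 = 0 \<Longrightarrow> (\<Sum>j\<in>J. v j * poly q (y j) * poly g (y j)) = 0"
    "\<And>f. Polynomial.degree f \<le> Suc n \<Longrightarrow>
      (\<And>g. Polynomial.degree g \<le> Suc n \<Longrightarrow> poly g 0 = 0 \<Longrightarrow> (\<Sum>j\<in>J. v j * poly f (y j) * poly g (y j)) = 0) \<Longrightarrow>
      \<forall>j\<in>J. poly f (y j) = poly f 0 * poly q (y j)"
proof -
  \<comment> \<open>\<open>\<phi> k g\<close> pairs \<open>X g\<close> with
    \<open>X^(k + 1)\<close>, and \<open>\<psi> g\<close> is minus the pairing of \<open>X g\<close>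
    with 1. Writing \<open>\<psi>\<close> through the \<open>\<phi> k\<close> yields the polynomial
    \<open>X p\<close> that corrects 1 to an orthogonal \<open>q\<close>.\<close>
  define \<phi> where "\<phi> = (\<lambda>k g. \<Sum>j\<in>J. v j * (y j)\<^sup>2 * poly g (y j) * y j ^ k)"
  define \<psi> where "\<psi> = (\<lambda>g. - (\<Sum>j\<in>J. v j * y j * poly g (y j)))"
  have sum_\<phi>: "(\<Sum>k\<le>n. c k * \<phi> k g) = (\<Sum>j\<in>J. v j * (y j)\<^sup>2 * poly g (y j) * (\<Sum>k\<le>n. c k * y j ^ k))" for c g
    unfolding \<phi>_def by (simp add: sum_distrib_left sum.swap[of _ J] mult_ac)
  have "\<exists>c. \<forall>g\<in>{g. Polynomial.degree g \<le> n}. \<psi> g = (\<Sum>k\<in>{..n}. c k * \<phi> k g)"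
  proof (rule functional_in_span[where scale = smult])
    show "linear_functional smult (\<phi> k)" for k
      by (simp add: linear_functional_def \<phi>_def algebra_simps sum.distrib sum_distrib_left)
    show "linear_functional smult \<psi>"
      by (simp add: linear_functional_def \<psi>_def algebra_simps sum.distrib sum_distrib_left)
    fix f assume f: "f \<in> {g. Polynomial.degree g \<le> n}" "\<And>k. k \<in> {..n} \<Longrightarrow> \<phi> k f = 0"
    have "(\<Sum>j\<in>J. v j * (y j)\<^sup>2 * poly f (y j) * poly g (y j)) = 0" if "Polynomial.degree g \<le> n" for g
    proof -
      have "poly g t = (\<Sum>k\<le>n. Polynomial.coeff g k * t ^ k)" for t
        unfolding poly_altdef using that by (intro sum.mono_neutral_left) (auto simp: coeff_eq_0)
      then show ?thesis using sum_\<phi>[of "Polynomial.coeff g" f] f(2) by simp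
    qed
    then have "\<forall>j\<in>J. poly f (y j) = 0" using nondeg f(1) by blast
    then show "\<psi> f = 0" by (simp add: \<psi>_def)
  qed (auto intro: degree_add_le le_trans[OF degree_smult_le])
  then obtain c where c: "\<And>g. Polynomial.degree g \<le> n \<Longrightarrow> \<psi> g = (\<Sum>k\<le>n. c k * \<phi> k g)" by auto
  define p where "p = (\<Sum>k\<le>n. Polynomial.monom (c k) k)"
  have p: "Polynomial.degree p \<le> n" "\<And>t. poly p t = (\<Sum>k\<le>n. c k * t ^ k)"
    unfolding p_def by (auto simp: poly_sum poly_monom intro!: degree_sum_le le_trans[OF degree_monom_le])
  define q where "q = pCons 1 p"
  have dq: "Polynomial.degree q \<le> Suc n" using p(1) by (simp add: q_def degree_pCons_eq_if)
  have q0: "poly q 0 = 1" by (simp add: q_def)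
  have split: "\<exists>g'. g = pCons 0 g' \<and> Polynomial.degree g' \<le> n"
    if "Polynomial.degree g \<le> Suc n" "poly g 0 = 0" for g :: "'k poly"
    using that by (cases g) (auto simp: degree_pCons_eq_if split: if_splits)
  have orth: "(\<Sum>j\<in>J. v j * poly q (y j) * poly g (y j)) = 0"
    if g: "Polynomial.degree g \<le> Suc n" "poly g 0 = 0" for g
  proof -
    obtain g' where g': "g = pCons 0 g'" "Polynomial.degree g' \<le> n" using split[OF g] by blast
    have "(\<Sum>j\<in>J. v j * poly q (y j) * poly g (y j)) = - \<psi> g' + (\<Sum>k\<le>n. c k * \<phi> k g')"
      unfolding sum_\<phi> \<psi>_def g' q_def
      by (simp add: p(2) algebra_simps power2_eq_square sum.distrib)
    then show ?thesis using c[OF g'(2)] by simp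
  qed
  have uniq: "\<forall>j\<in>J. poly f (y j) = poly f 0 * poly q (y j)"
    if f: "Polynomial.degree f \<le> Suc n"
      "\<And>g. Polynomial.degree g \<le> Suc n \<Longrightarrow> poly g 0 = 0 \<Longrightarrow> (\<Sum>j\<in>J. v j * poly f (y j) * poly g (y j)) = 0" for f
  proof -
    have "Polynomial.degree (f - smult (poly f 0) q) \<le> Suc n"
      using f(1) dq by (intro degree_diff_le) (auto intro: le_trans[OF degree_smult_le])
    moreover have "poly (f - smult (poly f 0) q) 0 = 0" by (simp add: q0)
    \<comment> \<open>The part of \<open>f\<close> left after removing its multiple of
      \<open>q\<close> is \<open>X h\<close>; it is still orthogonal to every \<open>X g\<close>, so
      nondegeneracy makes \<open>h\<close> vanish on \<open>J\<close>.\<close>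
    ultimately obtain h where h: "f - smult (poly f 0) q = pCons 0 h" "Polynomial.degree h \<le> n"
      using split by blast
    have hp: "poly f t - poly f 0 * poly q t = t * poly h t" for t
      using arg_cong[OF h(1), of "\<lambda>r. poly r t"] by simp
    have "\<forall>j\<in>J. poly h (y j) = 0"
    proof (rule nondeg[OF h(2)])
      fix g :: "'k poly" assume g: "Polynomial.degree g \<le> n"
      then have g': "Polynomial.degree (pCons 0 g) \<le> Suc n" by (simp add: degree_pCons_eq_if)
      have "(\<Sum>j\<in>J. v j * (y j)\<^sup>2 * poly h (y j) * poly g (y j)) =
          (\<Sum>j\<in>J. v j * (poly f (y j) - poly f 0 * poly q (y j)) * poly (pCons 0 g) (y j))"
        unfolding hp by (simp add: power2_eq_square mult_ac)
      also have "\<dots> = (\<Sum>j\<in>J. v j * poly f (y j) * poly (pCons 0 g) (y j)) -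
          poly f 0 * (\<Sum>j\<in>J. v j * poly q (y j) * poly (pCons 0 g) (y j))"
        by (simp add: algebra_simps sum_subtractf sum_distrib_left)
      also have "\<dots> = 0" using f(2)[OF g'] orth[OF g'] by simp
      finally show "(\<Sum>j\<in>J. v j * (y j)\<^sup>2 * poly h (y j) * poly g (y j)) = 0" .
    qed
    then show ?thesis using hp by (metis eq_iff_diff_eq_0 mult_zero_right)
  qed
  show thesis using that[OF dq q0 orth uniq] by blast
qed

text \<open>For \<open>i = 0\<close> all polynomials are constant and \<open>q = 1\<close> works.
  Otherwise a slope can fail only if the pairing with weights \<open>w y^2\<close> degenerates in
  degree \<open>i - 1\<close>; these weights are nonzero because no point sits at 0.\<close>

lemma finite_no_orthogonal_section:
  fixes y :: "'j \<Rightarrow> 'k::field_char_0"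
  assumes J: "finite J" and inj: "inj_on y J"
    and w: "\<And>j. j \<in> J \<Longrightarrow> w j \<noteq> 0" and y: "\<And>j. j \<in> J \<Longrightarrow> y j \<noteq> 0" and card: "card J \<le> e + i"
  shows "finite {c. \<not> (\<exists>q. Polynomial.degree q \<le> i \<and> poly q 0 = 1 \<and>
    (\<forall>g. Polynomial.degree g \<le> i \<longrightarrow> poly g 0 = 0 \<longrightarrow>
      (\<Sum>j\<in>J. w j * (1 + c * y j) ^ e * poly q (y j) * poly g (y j)) = 0) \<and>
    (\<forall>f. Polynomial.degree f \<le> i \<longrightarrow>
      (\<forall>g. Polynomial.degree g \<le> i \<longrightarrow> poly g 0 = 0 \<longrightarrow>
        (\<Sum>j\<in>J. w j * (1 + c * y j) ^ e * poly f (y j) * poly g (y j)) = 0) \<longrightarrow>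
      (\<forall>j\<in>J. poly f (y j) = poly f 0 * poly q (y j))))}" (is "finite ?B")
proof (cases i)
  case 0
  have "poly f (y j) = poly f 0" if "Polynomial.degree f \<le> 0" for f j
    using that by (auto elim!: degree_eq_zeroE)
  then have "?B = {}" unfolding 0 by (auto intro!: exI[of _ 1])
  then show ?thesis by (metis finite.emptyI)
next
  case (Suc n)
  let ?C = "{c. \<exists>f. Polynomial.degree f \<le> n \<and>
    (\<forall>g. Polynomial.degree g \<le> n \<longrightarrow>
      (\<Sum>j\<in>J. (w j * (y j)\<^sup>2) * (1 + c * y j) ^ e * poly f (y j) * poly g (y j)) = 0) \<and>
    (\<exists>j\<in>J. poly f (y j) \<noteq> 0)}"
  have "finite ?C"
    by (rule finite_degenerate_slopes) (use assms Suc in auto)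
  moreover have "?B \<subseteq> ?C"
  proof
    fix c assume c: "c \<in> ?B"
    show "c \<in> ?C"
    proof (rule ccontr)
      assume nc: "c \<notin> ?C"
      obtain q where "Polynomial.degree q \<le> Suc n" "poly q 0 = 1"
        "\<And>g. Polynomial.degree g \<le> Suc n \<Longrightarrow> poly g 0 = 0 \<Longrightarrow>
          (\<Sum>j\<in>J. w j * (1 + c * y j) ^ e * poly q (y j) * poly g (y j)) = 0"
        "\<And>f. Polynomial.degree f \<le> Suc n \<Longrightarrow>
          (\<And>g. Polynomial.degree g \<le> Suc n \<Longrightarrow> poly g 0 = 0 \<Longrightarrow>
            (\<Sum>j\<in>J. w j * (1 + c * y j) ^ e * poly f (y j) * poly g (y j)) = 0) \<Longrightarrow>
          \<forall>j\<in>J. poly f (y j) = poly f 0 * poly q (y j)"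
      proof (rule orthogonal_section[OF J, of n "\<lambda>j. w j * (1 + c * y j) ^ e" y])
        fix f assume f: "Polynomial.degree f \<le> n"
          "\<And>g. Polynomial.degree g \<le> n \<Longrightarrow>
            (\<Sum>j\<in>J. w j * (1 + c * y j) ^ e * (y j)\<^sup>2 * poly f (y j) * poly g (y j)) = 0"
        have "(\<Sum>j\<in>J. (w j * (y j)\<^sup>2) * (1 + c * y j) ^ e * poly f (y j) * poly g (y j)) = 0"
          if "Polynomial.degree g \<le> n" for g
          using f(2)[OF that] by (simp add: mult_ac)
        then show "\<forall>j\<in>J. poly f (y j) = 0" using nc f(1) by blast
      qed blast
      then show False using c unfolding Suc by blast
    qed
  qed
  ultimately show ?thesis using finite_subset by blast
qed

section \<open>The annihilator of a power sum\<close>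

lemma finite_monomials: "finite {m. mdeg m = n}"
proof (rule finite_imageD)
  let ?f = "\<lambda>m :: 3 \<Rightarrow>\<^sub>0 nat. (Poly_Mapping.lookup m 0, Poly_Mapping.lookup m 1, Poly_Mapping.lookup m 2)"
  have "?f ` {m. mdeg m = n} \<subseteq> {..n} \<times> {..n} \<times> {..n}"
    by (auto simp: mdeg_def sum_3)
  then show "finite (?f ` {m. mdeg m = n})" by (rule finite_subset) simp
  show "inj_on ?f {m. mdeg m = n}"
    by (rule inj_onI) (auto simp: poly_mapping_eq_iff fun_eq_iff all_3)
qed

section \<open>Ideals and cosets in the polynomial ring\<close>

lemma poly3_ring_simps [simp]:
  "carrier poly3_ring = UNIV" "f \<otimes>\<^bsub>poly3_ring\<^esub> g = f * g" "f \<oplus>\<^bsub>poly3_ring\<^esub> g = f + g"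
  "\<one>\<^bsub>poly3_ring\<^esub> = 1" "\<zero>\<^bsub>poly3_ring\<^esub> = 0"
  by (simp_all add: ring_of_type_algebra_def)

lemma cring_poly3_ring: "cring (poly3_ring :: 'k::field_char_0 mpoly3 ring)"
  by (rule cring_from_type_algebra)

lemma a_inv_poly3_ring: "\<ominus>\<^bsub>poly3_ring\<^esub> f = - (f :: 'k::field_char_0 mpoly3)"
proof -
  interpret cring "poly3_ring :: 'k mpoly3 ring" by (rule cring_poly3_ring)
  show ?thesis using minus_equality[of "- f" f] by simp
qed

lemma ideal_poly3_ringI:
  fixes I :: "'k::field_char_0 mpoly3 set"
  assumes "0 \<in> I" "\<And>f g. f \<in> I \<Longrightarrow> g \<in> I \<Longrightarrow> f + g \<in> I" "\<And>f h. f \<in> I \<Longrightarrow> h * f \<in> I"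
  shows "ideal I poly3_ring"
proof -
  interpret cring "poly3_ring :: 'k mpoly3 ring" by (rule cring_poly3_ring)
  have minus: "- f \<in> I" if "f \<in> I" for f using assms(3)[OF that, of "- 1"] by simp
  have inv: "inv\<^bsub>add_monoid poly3_ring\<^esub> f = - (f :: 'k mpoly3)" for f
    using a_inv_poly3_ring[of f] unfolding a_inv_def .
  have "subgroup I (add_monoid (poly3_ring :: 'k mpoly3 ring))"
    by (rule group.subgroupI[OF add.is_group])
      (use assms minus in \<open>auto simp: inv[simplified]\<close>)
  then show ?thesis
    by (intro idealI ring_axioms) (use assms in \<open>auto simp: mult.commute\<close>)
qed

lemma coset_eq_iff:
  assumes "ideal I (poly3_ring :: 'k::field_char_0 mpoly3 ring)"
  shows "I +>\<^bsub>poly3_ring\<^esub> f = I +>\<^bsub>poly3_ring\<^esub> g \<longleftrightarrow> f - g \<in> I"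
proof -
  interpret ideal I "poly3_ring :: 'k mpoly3 ring" by fact
  have "I +>\<^bsub>poly3_ring\<^esub> f = I +>\<^bsub>poly3_ring\<^esub> g \<longleftrightarrow> f \<in> I +>\<^bsub>poly3_ring\<^esub> g"
    using a_repr_independence'[of f g] a_rcos_self[of f] by auto
  also have "\<dots> \<longleftrightarrow> f - g \<in> I"
    by (force simp: a_r_coset_def r_coset_def)
  finally show ?thesis .
qed

lemma quot_mult:
  assumes "ideal I (poly3_ring :: 'k::field_char_0 mpoly3 ring)"
  shows "(I +>\<^bsub>poly3_ring\<^esub> f) \<otimes>\<^bsub>poly3_ring Quot I\<^esub> (I +>\<^bsub>poly3_ring\<^esub> g) = I +>\<^bsub>poly3_ring\<^esub> (f * g)"
  using ideal.rcoset_mult_add[OF assms, of f g] by (simp add: FactRing_def)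

lemma quot_add:
  assumes "ideal I (poly3_ring :: 'k::field_char_0 mpoly3 ring)"
  shows "(I +>\<^bsub>poly3_ring\<^esub> f) \<oplus>\<^bsub>poly3_ring Quot I\<^esub> (I +>\<^bsub>poly3_ring\<^esub> g) = I +>\<^bsub>poly3_ring\<^esub> (f + g)"
proof -
  interpret ideal I "poly3_ring :: 'k mpoly3 ring" by fact
  show ?thesis using a_rcos_sum[of f g] by (simp add: FactRing_def)
qed

lemma quot_power:
  assumes "ideal I (poly3_ring :: 'k::field_char_0 mpoly3 ring)"
  shows "(I +>\<^bsub>poly3_ring\<^esub> f) [^]\<^bsub>poly3_ring Quot I\<^esub> (j::nat) = I +>\<^bsub>poly3_ring\<^esub> (f ^ j)"
proof (induction j)
  case 0
  then show ?case by (simp add: nat_pow_def FactRing_def)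
next
  case (Suc j)
  have "(I +>\<^bsub>poly3_ring\<^esub> f) [^]\<^bsub>poly3_ring Quot I\<^esub> Suc j =
    (I +>\<^bsub>poly3_ring\<^esub> f) [^]\<^bsub>poly3_ring Quot I\<^esub> j \<otimes>\<^bsub>poly3_ring Quot I\<^esub> (I +>\<^bsub>poly3_ring\<^esub> f)"
    by (simp add: nat_pow_def)
  then show ?case unfolding Suc quot_mult[OF assms] by (simp add: mult.commute)
qed

locale power_sum =
  fixes s d :: nat and \<alpha> :: "nat \<Rightarrow> 'k::field_char_0" and a :: "nat \<Rightarrow> 3 \<Rightarrow> 'k"
begin

definition "gen = (\<Sum>p<s. const3 (\<alpha> p) * dual_form (a p) ^ d)"

text \<open>Weighted evaluation at the points, cut off to be 0 outside degree \<open>d\<close>. The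
  cut-off makes the radical of \<open>(h, g) \<mapsto> Lam (h * g)\<close> over all polynomials
  equal to the annihilator of \<open>gen\<close>.\<close>

definition "Lam = lin_ext (\<lambda>m. if mdeg m = d then \<Sum>p<s. \<alpha> p * monom_val (a p) m else 0)"

lemma Lam_0 [simp]: "Lam 0 = 0"
  by (simp add: Lam_def)

lemma Lam_add: "Lam (f + g) = Lam f + Lam g"
  by (simp add: Lam_def lin_ext_add)

lemma Lam_const_mult: "Lam (const3 c * f) = c * Lam f"
  by (simp add: Lam_def lin_ext_const_mult)

lemma Lam_sum: "Lam (\<Sum>i\<in>S. f i) = (\<Sum>i\<in>S. Lam (f i))"
  by (simp add: Lam_def lin_ext_sum)

lemma linear_functional_Lam: "linear_functional (\<lambda>c x. const3 c * x) (\<lambda>x. Lam (h * x))"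
  by (simp add: linear_functional_def Lam_add Lam_const_mult distrib_left mult.left_commute[of h])

lemma Lam_form:
  assumes "f \<in> forms d"
  shows "Lam f = (\<Sum>p<s. \<alpha> p * eval3 f (a p))"
proof -
  have "Lam f = lin_ext (\<lambda>m. \<Sum>p<s. \<alpha> p * monom_val (a p) m) f"
    using assms by (simp add: Lam_def lin_ext_def forms_def)
  then show ?thesis by (simp add: lin_ext_fun_sum eval3_lin_ext)
qed

lemma Lam_other: "f \<in> forms n \<Longrightarrow> n \<noteq> d \<Longrightarrow> Lam f = 0"
  by (auto simp: Lam_def lin_ext_def forms_def)

text \<open>Combines contraction with the multinomial theorem: the weighted coefficient of
  \<open>gen\<close> at \<open>m\<close> is \<open>fact d\<close> times the value of
  \<open>Lam\<close> on the monomial \<open>m\<close>.\<close>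

lemma mfact_lookup_diff_act_gen:
  "mfact n * Poly_Mapping.lookup (diff_act g gen) n = fact d * Lam (Poly_Mapping.single n 1 * g)"
proof -
  have "mfact m * Poly_Mapping.lookup gen m =
      fact d * (if mdeg m = d then \<Sum>p<s. \<alpha> p * monom_val (a p) m else 0)" for m
    by (simp add: gen_def lookup_sum lookup_const_mult sum_distrib_left mult.left_commute[of "mfact m"]
        mfact_lookup_dual_form_power mult.left_commute[of "fact d"])
  then show ?thesis
    unfolding mfact_lookup_diff_act Lam_def lin_ext_single_mult
    by (simp add: lin_ext_def sum_distrib_left mult.left_commute)
qed

lemma Lam_mult_all:
  assumes "\<And>n. n \<in> Poly_Mapping.keys h \<Longrightarrow> Lam (Poly_Mapping.single n 1 * g) = 0"
  shows "Lam (h * g) = 0"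
proof -
  have "Lam (Poly_Mapping.single n (Poly_Mapping.lookup h n) * g) = 0" if "n \<in> Poly_Mapping.keys h" for n
  proof -
    have "Poly_Mapping.single n (Poly_Mapping.lookup h n) * g
        = const3 (Poly_Mapping.lookup h n) * (Poly_Mapping.single n 1 * g)"
      by (simp add: mult_single flip: mult.assoc)
    then show ?thesis using assms[OF that] by (simp only: Lam_const_mult mult_zero_right)
  qed
  then show ?thesis
    by (subst poly_mapping_sum_single[of h]) (simp add: sum_distrib_right Lam_sum)
qed

lemma Ann_form_gen: "Ann_form gen = {g. \<forall>h. Lam (h * g) = 0}"
proof -
  have "g \<in> Ann_form gen \<longleftrightarrow> (\<forall>n. Lam (Poly_Mapping.single n 1 * g) = 0)" for g
  proof -
    have "g \<in> Ann_form gen \<longleftrightarrow> (\<forall>n. mfact n * Poly_Mapping.lookup (diff_act g gen) n = (0 :: 'k))"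
      by (simp add: Ann_form_def poly_mapping_eq_iff fun_eq_iff)
    then show ?thesis by (simp add: mfact_lookup_diff_act_gen)
  qed
  then show ?thesis using Lam_mult_all by blast
qed

lemma ideal_Ann: "ideal (Ann_form gen) poly3_ring"
  by (rule ideal_poly3_ringI)
    (auto simp: Ann_form_gen distrib_left Lam_add simp flip: mult.assoc)

text \<open>Because \<open>Lam\<close> vanishes outside degree \<open>d\<close>, a form need only be
  tested in the complementary degree, and every form of degree above \<open>d\<close> annihilates
  \<open>gen\<close>.\<close>

lemma form_in_Ann_iff:
  assumes "g \<in> forms i"
  shows "g \<in> Ann_form gen \<longleftrightarrow> (i \<le> d \<longrightarrow> (\<forall>h\<in>forms (d - i). Lam (h * g) = 0))"
proof
  assume R: "i \<le> d \<longrightarrow> (\<forall>h\<in>forms (d - i). Lam (h * g) = 0)"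
  have "Lam (Poly_Mapping.single n 1 * g) = 0" for n
  proof (cases "mdeg n + i = d")
    case True
    then have "i \<le> d" "d - i = mdeg n" by auto
    then show ?thesis using R forms_single[of n 1] by auto
  next
    case False
    then show ?thesis using Lam_other[OF forms_mult[OF forms_single assms]] by blast
  qed
  then show "g \<in> Ann_form gen" unfolding Ann_form_gen using Lam_mult_all by blast
qed (simp add: Ann_form_gen)

text \<open>Nondegeneracy says that multiplication from degree \<open>i\<close> to
  \<open>d - i\<close> is injective. Below the middle, \<open>l ^ j\<close> is a factor of such an
  injective map; beyond it, surjectivity follows by duality, since \<open>Lam\<close> identifies a
  graded piece of the quotient with the dual of the complementary piece.\<close>

lemma strong_lefschetz_criterion:
  assumes l: "l \<in> forms 1"
    and nondeg: "\<And>i g. 2 * i \<le> d \<Longrightarrow> g \<in> forms i \<Longrightarrow>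
      (\<And>h. h \<in> forms i \<Longrightarrow> Lam (l ^ (d - 2 * i) * g * h) = 0) \<Longrightarrow> g \<in> Ann_form gen"
  shows "strong_lefschetz (poly3_ring Quot (Ann_form gen)) (quot_piece (Ann_form gen))"
proof -
  let ?A = "Ann_form gen"
  let ?c = "\<lambda>f. ?A +>\<^bsub>poly3_ring\<^esub> f"
  note ideal = ideal_Ann
  have inj: "u - v \<in> ?A"
    if ij: "2 * i + j \<le> d" and uv: "u \<in> forms i" "v \<in> forms i" "l ^ j * u - l ^ j * v \<in> ?A" for i j u v
  proof (rule nondeg[of i])
    show "2 * i \<le> d" using ij by simp
    show "u - v \<in> forms i" using uv by (simp add: forms_diff)
    fix h :: "'k mpoly3"
    have "l ^ (d - 2 * i) = l ^ (d - 2 * i - j) * l ^ j" using ij by (simp flip: power_add)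
    then have "l ^ (d - 2 * i) * (u - v) * h = (l ^ (d - 2 * i - j) * h) * (l ^ j * (u - v))"
      by (simp only: mult_ac)
    then show "Lam (l ^ (d - 2 * i) * (u - v) * h) = 0"
      using uv(3) by (simp only: Ann_form_gen mem_Collect_eq right_diff_distrib)
  qed
  have surj: "\<exists>f\<in>forms i. l ^ j * f - h \<in> ?A" if ij: "2 * i + j \<ge> d" and h: "h \<in> forms (i + j)" for i j h
  proof (cases "i + j \<le> d")
    case False
    \<comment> \<open>Beyond the degree \<open>d\<close> the target is zero, so 0 is a
      preimage.\<close>
    then have "l ^ j * 0 - h \<in> ?A" using form_in_Ann_iff[OF forms_uminus[OF h]] by simp
    then show ?thesis using forms_0 by blast
  next
    case True
    \<comment> \<open>The degree complementary to the target. Here \<open>k \<le> i\<close>, and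
      \<open>l ^ j * l ^ (i - k)\<close> is exactly the symmetric power
      \<open>l ^ (d - 2 * k)\<close>.\<close>
    define k where "k = d - (i + j)"
    define J where "J = {m :: 3 \<Rightarrow>\<^sub>0 nat. mdeg m = k}"
    have k: "2 * k \<le> d" "k \<le> i" "d - 2 * k = j + (i - k)" "d - k = i + j" using ij True by (auto simp: k_def)
    have X: "Poly_Mapping.single m 1 \<in> (forms k :: 'k mpoly3 set)" if "m \<in> J" for m
      using that forms_single[of m 1] by (auto simp: J_def)
    \<comment> \<open>The functional given by \<open>h\<close> kills the radical of the pairing
      twisted by \<open>l ^ (d - 2 * k)\<close>, hence is represented by a form of degree
      \<open>k\<close>; that form is \<open>f0\<close> below.\<close>
    have "\<exists>c. \<forall>x\<in>forms k. Lam (h * x) = (\<Sum>m\<in>J. c m * Lam ((l ^ (d - 2 * k) * Poly_Mapping.single m 1) * x))"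
    proof (rule functional_in_span)
      show "finite J" unfolding J_def by (rule finite_monomials)
      fix x :: "'k mpoly3" assume x: "x \<in> forms k"
        "\<And>m. m \<in> J \<Longrightarrow> Lam ((l ^ (d - 2 * k) * Poly_Mapping.single m 1) * x) = 0"
      have "x \<in> ?A"
      proof (rule nondeg[OF k(1) x(1)])
        fix g :: "'k mpoly3" assume g: "g \<in> forms k"
        have "Lam (g * (l ^ (d - 2 * k) * x)) = 0"
          by (rule Lam_mult_all) (use g x(2) in \<open>auto simp: forms_def J_def mult_ac\<close>)
        then show "Lam (l ^ (d - 2 * k) * x * g) = 0" by (simp add: mult_ac)
      qed
      then show "Lam (h * x) = 0" by (simp add: Ann_form_gen)
    qed (rule linear_functional_Lam forms_add forms_const_mult; assumption?)+
    then obtain c where c: "\<And>x. x \<in> forms k \<Longrightarrow>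
        Lam (h * x) = (\<Sum>m\<in>J. c m * Lam ((l ^ (d - 2 * k) * Poly_Mapping.single m 1) * x))" by blast
    define f0 where "f0 = (\<Sum>m\<in>J. const3 (c m) * Poly_Mapping.single m 1)"
    define f where "f = l ^ (i - k) * f0"
    have f0: "f0 \<in> forms k" unfolding f0_def by (intro forms_sum forms_const_mult X)
    have f: "f \<in> forms i" unfolding f_def using forms_mult[OF forms_power[OF l, of "i - k"] f0] k by simp
    have eq: "Lam (x * (l ^ j * f - h)) = 0" if x: "x \<in> forms k" for x
    proof -
      have "Lam (x * (l ^ j * f)) = Lam (\<Sum>m\<in>J. const3 (c m) * ((l ^ (d - 2 * k) * Poly_Mapping.single m 1) * x))"
        unfolding f_def f0_def k(3) by (simp add: power_add sum_distrib_left mult_ac)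
      also have "\<dots> = Lam (h * x)" unfolding Lam_sum Lam_const_mult c[OF x] ..
      finally have "Lam (x * (l ^ j * f)) = Lam (x * h)" by (simp add: mult.commute)
      moreover have "Lam (x * (l ^ j * f)) = Lam (x * (l ^ j * f - h)) + Lam (x * h)"
        by (simp add: right_diff_distrib flip: Lam_add)
      ultimately show ?thesis by simp
    qed
    have "l ^ j * f - h \<in> forms (i + j)"
      using forms_mult[OF forms_power[OF l, of j] f] h by (simp add: add.commute forms_diff)
    then have "l ^ j * f - h \<in> ?A"
      using eq True by (simp add: form_in_Ann_iff k_def)
    with f show ?thesis by blast
  qed
  have rank: "maximal_rank (\<lambda>u. ?c l [^]\<^bsub>poly3_ring Quot ?A\<^esub> j \<otimes>\<^bsub>poly3_ring Quot ?A\<^esub> u)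
      (quot_piece ?A i) (quot_piece ?A (i + j))" for i j :: nat
  proof (cases "2 * i + j \<le> d")
    case True
    then show ?thesis unfolding maximal_rank_def quot_power[OF ideal]
    proof (intro disjI1 inj_onI)
      fix U V
      assume "U \<in> quot_piece ?A i" "V \<in> quot_piece ?A i"
        and eq: "?c (l ^ j) \<otimes>\<^bsub>poly3_ring Quot ?A\<^esub> U = ?c (l ^ j) \<otimes>\<^bsub>poly3_ring Quot ?A\<^esub> V"
      then obtain u v where uv: "u \<in> forms i" "v \<in> forms i" "U = ?c u" "V = ?c v"
        by (auto simp: quot_piece_def)
      then have "l ^ j * u - l ^ j * v \<in> ?A"
        using eq by (simp only: quot_mult[OF ideal] coset_eq_iff[OF ideal])
      then show "U = V" using inj[OF True uv(1,2)] uv by (simp only: coset_eq_iff[OF ideal])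
    qed
  next
    case False
    have "l ^ j * f \<in> forms (i + j)" if "f \<in> forms i" for f
      using forms_mult[OF forms_power[OF l, of j] that] by (simp add: add.commute)
    moreover have "?c h \<in> (\<lambda>f. ?c (l ^ j * f)) ` forms i" if h: "h \<in> forms (i + j)" for h
    proof -
      obtain f where "f \<in> forms i" "l ^ j * f - h \<in> ?A" using surj[OF _ h] False by auto
      moreover from this have "?c (l ^ j * f) = ?c h" by (simp add: coset_eq_iff[OF ideal])
      ultimately show ?thesis by (intro image_eqI[of _ _ f]) simp_all
    qed
    ultimately have "(\<lambda>f. ?c (l ^ j * f)) ` forms i = ?c ` forms (i + j)" by auto
    then show ?thesis unfolding maximal_rank_def quot_power[OF ideal] quot_piece_def
      by (simp add: image_image quot_mult[OF ideal])
  qed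
  have "?c l \<in> quot_piece ?A 1" unfolding quot_piece_def using l by simp
  then show ?thesis unfolding strong_lefschetz_def using rank by blast
qed

end

section \<open>Points on an affine conic\<close>

text \<open>A monomial of degree \<open>n\<close> becomes a product of \<open>n\<close> of the
  polynomials \<open>\<gamma> i\<close>. Used with \<open>D = 2\<close> on the parabola and with
  \<open>D = 1\<close> on lines.\<close>

lemma restrict_to_curve:
  fixes \<gamma> :: "3 \<Rightarrow> 'k::field_char_0 poly"
  assumes g: "g \<in> forms n" and \<gamma>: "\<And>i. Polynomial.degree (\<gamma> i) \<le> D"
  shows "\<exists>G. Polynomial.degree G \<le> D * n \<and> (\<forall>t. poly G t = eval3 g (\<lambda>i. poly (\<gamma> i) t))"
proof -
  define G where "G = (\<Sum>m\<in>Poly_Mapping.keys g. smult (Poly_Mapping.lookup g m) (\<Prod>i\<in>UNIV. \<gamma> i ^ Poly_Mapping.lookup m i))"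
  have "Polynomial.degree G \<le> D * n"
    unfolding G_def
  proof (rule degree_sum_le, simp)
    fix m assume m: "m \<in> Poly_Mapping.keys g"
    have "Polynomial.degree (\<Prod>i\<in>UNIV. \<gamma> i ^ Poly_Mapping.lookup m i)
        \<le> (\<Sum>i\<in>UNIV. Polynomial.degree (\<gamma> i ^ Poly_Mapping.lookup m i))"
      using degree_prod_sum_le[of UNIV "\<lambda>i. \<gamma> i ^ Poly_Mapping.lookup m i"] by (simp add: o_def)
    also have "\<dots> \<le> (\<Sum>i\<in>UNIV. D * Poly_Mapping.lookup m i)"
      by (intro sum_mono order_trans[OF degree_power_le] mult_right_mono \<gamma>) simp
    also have "\<dots> = D * n"
      using g m by (simp add: forms_def mdeg_def flip: sum_distrib_left)
    finally show "Polynomial.degree (smult (Poly_Mapping.lookup g m) (\<Prod>i\<in>UNIV. \<gamma> i ^ Poly_Mapping.lookup m i)) \<le> D * n"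
      using degree_smult_le le_trans by blast
  qed
  moreover have "poly G t = eval3 g (\<lambda>i. poly (\<gamma> i) t)" for t
    by (simp add: G_def poly_sum poly_prod eval3_def)
  ultimately show ?thesis by blast
qed

text \<open>A Lagrange polynomial for the points together with 0 has degree at most
  \<open>card J\<close>, vanishes at 0 and isolates one point.\<close>

lemma vanishing_from_orthogonality:
  fixes x :: "'j \<Rightarrow> 'k::field"
  assumes J: "finite J" "inj_on x J" and nz: "\<And>j. j \<in> J \<Longrightarrow> x j \<noteq> 0" "\<And>j. j \<in> J \<Longrightarrow> v j \<noteq> 0"
    and card: "card J \<le> n"
    and orth: "\<And>g. Polynomial.degree g \<le> n \<Longrightarrow> poly g 0 = 0 \<Longrightarrow> (\<Sum>j\<in>J. v j * f j * poly g (x j)) = 0"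
  shows "\<forall>j\<in>J. f j = 0"
proof
  fix j assume j: "j \<in> J"
  define T where "T = insert 0 (x ` J)"
  have "finite T" "x j \<in> T" using J j by (auto simp: T_def)
  then obtain L where L: "Polynomial.degree L \<le> card T - 1" "\<And>t. t \<in> T \<Longrightarrow> poly L t = (if t = x j then 1 else 0)"
    using lagrange_polynomial by blast
  have "card T \<le> Suc (card J)" unfolding T_def
    by (metis J(1) card_image_le card_insert_le_m1 card_insert_if finite_imageI le_SucI not_less_eq_eq order_refl)
  then have "Polynomial.degree L \<le> n" using L(1) card by linarith
  moreover have "poly L 0 = 0" using L(2)[of 0] nz(1)[OF j] by (auto simp: T_def)
  ultimately have "0 = (\<Sum>k\<in>J. v k * f k * poly L (x k))" using orth by simp
  also have "\<dots> = (\<Sum>k\<in>J. if k = j then v k * f k else 0)"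
    using J j by (intro sum.cong) (auto simp: L(2) T_def inj_on_eq_iff)
  finally show "f j = 0" using J j nz(2)[OF j] by simp
qed

lemma forms_monomial:
  assumes "x \<in> forms 1" "y \<in> forms 1" "z \<in> forms 1" "i + j + k = n"
  shows "x ^ i * y ^ j * z ^ k \<in> forms n"
  using forms_mult[OF forms_mult[OF forms_power[OF assms(1), of i] forms_power[OF assms(2), of j]]
      forms_power[OF assms(3), of k]] assms(4) by simp

text \<open>The vectors \<open>v0\<close>, \<open>v1\<close>, \<open>v2\<close> form a basis with
  dual coordinate forms given by \<open>\<xi>0\<close>, \<open>\<xi>1\<close>,
  \<open>\<xi>2\<close>, and \<open>\<xi>0\<close> defines the line at infinity, which misses the
  points. The assumption \<open>separate\<close> is what \<open>\<tau>\<close> being the degree in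
  which the Hilbert function reaches \<open>s\<close> provides.\<close>

locale conic_frame = power_sum s d \<alpha> a for s d :: nat and \<alpha> and a :: "nat \<Rightarrow> 3 \<Rightarrow> 'k::field_char_0" +
  fixes v0 v1 v2 \<xi>0 \<xi>1 \<xi>2 :: "3 \<Rightarrow> 'k" and \<tau> :: nat
  assumes recon: "\<And>b i. b i = eval3 (dual_form \<xi>0) b * v0 i + eval3 (dual_form \<xi>1) b * v1 i + eval3 (dual_form \<xi>2) b * v2 i"
    and dual: "\<And>x y. eval3 (dual_form \<xi>0) (\<lambda>i. v0 i + x * v1 i + y * v2 i) = 1"
      "\<And>x y. eval3 (dual_form \<xi>1) (\<lambda>i. v0 i + x * v1 i + y * v2 i) = x"
      "\<And>x y. eval3 (dual_form \<xi>2) (\<lambda>i. v0 i + x * v1 i + y * v2 i) = y"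
    and finite_part: "\<And>p. p < s \<Longrightarrow> eval3 (dual_form \<xi>0) (a p) \<noteq> 0"
    and \<alpha>_nonzero: "\<And>p. p < s \<Longrightarrow> \<alpha> p \<noteq> 0"
    and distinct_points: "\<And>p q c. p < s \<Longrightarrow> q < s \<Longrightarrow> c \<noteq> 0 \<Longrightarrow> a q = (\<lambda>i. c * a p i) \<Longrightarrow> p = q"
    and \<tau>: "2 * \<tau> \<le> d"
    and separate: "\<And>p. p < s \<Longrightarrow> \<exists>h\<in>forms \<tau>. eval3 h (a p) \<noteq> 0 \<and> (\<forall>q<s. q \<noteq> p \<longrightarrow> eval3 h (a q) = 0)"
begin

definition "pt x y = (\<lambda>i. v0 i + x * v1 i + y * v2 i)"
definition "lam p = eval3 (dual_form \<xi>0) (a p)"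
definition "xc p = eval3 (dual_form \<xi>1) (a p) / lam p"
definition "yc p = eval3 (dual_form \<xi>2) (a p) / lam p"
text \<open>The weight at a point after rescaling its vector to the affine chart, where forms of
  degree \<open>d\<close> lose the factor \<open>lam p ^ d\<close>.\<close>

definition "\<beta> p = \<alpha> p * lam p ^ d"

text \<open>Only degrees below \<open>\<tau>\<close> are recorded: from \<open>\<tau>\<close> on,
  separating forms give nondegeneracy for every \<open>l\<close> without zeros among the
  points.\<close>

definition "good l \<longleftrightarrow> l \<in> forms 1 \<and> (\<forall>p<s. eval3 l (a p) \<noteq> 0) \<and>
  (\<forall>i<\<tau>. \<forall>g\<in>forms i. (\<forall>h\<in>forms i. Lam (l ^ (d - 2 * i) * g * h) = 0) \<longrightarrow> (\<forall>p<s. eval3 g (a p) = 0))"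

abbreviation "X0 \<equiv> dual_form \<xi>0"
abbreviation "X1 \<equiv> dual_form \<xi>1"
abbreviation "X2 \<equiv> dual_form \<xi>2"

lemma eval_pt: "eval3 X0 (pt x y) = 1" "eval3 X1 (pt x y) = x" "eval3 X2 (pt x y) = y"
  unfolding pt_def by (rule dual)+

lemma lam_nonzero: "p < s \<Longrightarrow> lam p \<noteq> 0"
  unfolding lam_def by (rule finite_part)

lemma \<beta>_nonzero: "p < s \<Longrightarrow> \<beta> p \<noteq> 0"
  by (simp add: \<beta>_def \<alpha>_nonzero lam_nonzero)

lemma a_eq: "p < s \<Longrightarrow> a p = (\<lambda>i. lam p * pt (xc p) (yc p) i)"
proof
  fix i assume "p < s"
  then show "a p i = lam p * pt (xc p) (yc p) i"
    using recon[of "a p" i] lam_nonzero[of p]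
    by (simp add: pt_def xc_def yc_def algebra_simps flip: lam_def)
qed

lemma coords_inj:
  assumes "p < s" "q < s" "xc p = xc q" "yc p = yc q"
  shows "p = q"
proof (rule distinct_points[of p q "lam q / lam p"])
  show "a q = (\<lambda>i. lam q / lam p * a p i)"
    using assms lam_nonzero[of p] by (subst (1 2) a_eq) auto
qed (use assms lam_nonzero in auto)

lemma eval_a: "f \<in> forms n \<Longrightarrow> p < s \<Longrightarrow> eval3 f (a p) = lam p ^ n * eval3 f (pt (xc p) (yc p))"
  by (subst a_eq) (simp_all add: eval3_scale)

lemma eval_a_0_iff: "f \<in> forms n \<Longrightarrow> p < s \<Longrightarrow> eval3 f (a p) = 0 \<longleftrightarrow> eval3 f (pt (xc p) (yc p)) = 0"
  by (simp add: eval_a lam_nonzero)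

lemma Lam_coords:
  assumes "f \<in> forms d"
  shows "Lam f = (\<Sum>p<s. \<beta> p * eval3 f (pt (xc p) (yc p)))"
  unfolding Lam_form[OF assms] by (intro sum.cong) (auto simp: \<beta>_def eval_a[OF assms])

lemma Lam_lgh:
  assumes "l \<in> forms 1" "g \<in> forms i" "h \<in> forms i" "i < \<tau>"
  shows "Lam (l ^ (d - 2 * i) * g * h) = (\<Sum>p<s. \<beta> p * eval3 l (pt (xc p) (yc p)) ^ (d - 2 * i) *
    eval3 g (pt (xc p) (yc p)) * eval3 h (pt (xc p) (yc p)))"
proof -
  have "l ^ (d - 2 * i) * g * h \<in> forms d"
    using forms_mult[OF forms_mult[OF forms_power[OF assms(1), of "d - 2 * i"] assms(2)] assms(3)] assms(4) \<tau>
    by simp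
  then show ?thesis by (simp add: Lam_coords mult.assoc)
qed

text \<open>A form of degree \<open>\<tau>\<close> that isolates one point of \<open>J\<close>
  restricts to a nonzero polynomial of degree at most \<open>D * \<tau>\<close> having all other
  points of \<open>J\<close> as roots.\<close>

lemma separated_card_le:
  assumes J: "J \<subseteq> {..<s}" and inj: "inj_on x J"
    and \<gamma>: "\<And>i. Polynomial.degree (\<gamma> i) \<le> D" "\<And>p. p \<in> J \<Longrightarrow> pt (xc p) (yc p) = (\<lambda>i. poly (\<gamma> i) (x p))"
  shows "card J \<le> D * \<tau> + 1"
proof (cases "J = {}")
  case False
  then obtain p where p: "p \<in> J" by blast
  then obtain h where h: "h \<in> forms \<tau>" "eval3 h (a p) \<noteq> 0" "\<And>q. q < s \<Longrightarrow> q \<noteq> p \<Longrightarrow> eval3 h (a q) = 0"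
    using separate[of p] J by blast
  obtain G where G: "Polynomial.degree G \<le> D * \<tau>" "\<And>t. poly G t = eval3 h (\<lambda>i. poly (\<gamma> i) t)"
    using restrict_to_curve[OF h(1), of \<gamma> D, OF \<gamma>(1)] by blast
  have ev: "eval3 h (a q) = 0 \<longleftrightarrow> poly G (x q) = 0" if "q \<in> J" for q
    using that J eval_a_0_iff[OF h(1), of q] by (auto simp: G(2) \<gamma>(2))
  have "G \<noteq> 0" using ev[OF p] h(2) by auto
  have fin: "finite J" using J finite_subset by blast
  have "x ` (J - {p}) \<subseteq> {t. poly G t = 0}" using ev h(3) J by auto
  then have "card (x ` (J - {p})) \<le> card {t. poly G t = 0}"
    by (intro card_mono poly_roots_finite \<open>G \<noteq> 0\<close>)
  also have "\<dots> \<le> Polynomial.degree G" using \<open>G \<noteq> 0\<close> by (rule card_poly_roots_bound)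
  finally have "card (J - {p}) \<le> D * \<tau>"
    using G(1) inj by (simp add: card_image inj_on_diff)
  then show ?thesis using p fin by simp
qed simp

text \<open>Forms of degree \<open>i\<close> restrict to the parabola as all polynomials of degree
  at most \<open>2 * i\<close>, and the tangent line at \<open>u\<close> restricts to a square, so
  the one-variable statement applies with exponent \<open>2 * (d - 2 * i)\<close>.\<close>

lemma good_parabola:
  assumes conic: "\<And>p. p < s \<Longrightarrow> yc p = (xc p)\<^sup>2"
  shows "\<exists>l. good l"
proof -
  define \<gamma> where "\<gamma> = (\<lambda>i. [:v0 i, v1 i, v2 i:])"
  have \<gamma>: "Polynomial.degree (\<gamma> i) \<le> 2" for i by (simp add: \<gamma>_def)
  have pt\<gamma>: "pt t (t\<^sup>2) = (\<lambda>i. poly (\<gamma> i) t)" for t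
    by (simp add: pt_def \<gamma>_def fun_eq_iff algebra_simps power2_eq_square)
  have inj: "inj_on xc {..<s}" using coords_inj conic by (auto intro!: inj_onI)
  have cs: "s \<le> 2 * \<tau> + 1"
    using separated_card_le[of "{..<s}" xc \<gamma> 2] inj \<gamma> by (simp add: conic pt\<gamma>)
  define B where "B = (\<lambda>i. {u. \<exists>f. Polynomial.degree f \<le> 2 * i \<and>
    (\<forall>g. Polynomial.degree g \<le> 2 * i \<longrightarrow>
      (\<Sum>p<s. \<beta> p * (xc p - u) ^ (2 * (d - 2 * i)) * poly f (xc p) * poly g (xc p)) = 0) \<and>
    (\<exists>p\<in>{..<s}. poly f (xc p) \<noteq> 0)})"
  \<comment> \<open>There are at most \<open>2 * \<tau> + 1\<close> points, and
    \<open>2 * (d - 2 * i) + 2 * i + 1\<close> is at least that large since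
    \<open>i < \<tau>\<close> and \<open>2 * \<tau> \<le> d\<close>.\<close>
  have "finite (B i)" if "i < \<tau>" for i
    unfolding B_def by (rule finite_degenerate_indexed) (use inj \<beta>_nonzero cs \<tau> that in auto)
  then have "finite ((\<Union>i<\<tau>. B i) \<union> xc ` {..<s})" by blast
  then obtain u where u: "u \<notin> (\<Union>i<\<tau>. B i) \<union> xc ` {..<s}"
    using ex_new_if_finite infinite_UNIV_char_0 by blast
  \<comment> \<open>The tangent line to the parabola at the parameter \<open>u\<close>.\<close>
  define l where "l = const3 (u\<^sup>2) * X0 + const3 (- 2 * u) * X1 + X2"
  have l: "l \<in> forms 1" unfolding l_def by (intro forms_add forms_const_mult forms_dual_form)
  have lpt: "eval3 l (pt t (t\<^sup>2)) = (t - u)\<^sup>2" for t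
    unfolding l_def by (simp only: eval3_add eval3_mult eval3_single eval_pt monom_val_0) (simp add: power2_eq_square algebra_simps)
  have "eval3 l (a p) \<noteq> 0" if "p < s" for p
    using that u eval_a_0_iff[OF l that] by (auto simp: conic lpt)
  moreover have "\<forall>p<s. eval3 g (a p) = 0"
    if i: "i < \<tau>" and g: "g \<in> forms i" and rad: "\<forall>h\<in>forms i. Lam (l ^ (d - 2 * i) * g * h) = 0" for i g
  proof -
    obtain f where f: "Polynomial.degree f \<le> 2 * i" "\<And>t. poly f t = eval3 g (pt t (t\<^sup>2))"
      using restrict_to_curve[OF g, of \<gamma> 2, OF \<gamma>] unfolding pt\<gamma> by blast
    have "(\<Sum>p<s. \<beta> p * (xc p - u) ^ (2 * (d - 2 * i)) * poly f (xc p) * poly h (xc p)) = 0"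
      if h: "Polynomial.degree h \<le> 2 * i" for h
    proof -
      \<comment> \<open>Lifts \<open>h\<close> to a form of degree \<open>i\<close>: on the parabola
        \<open>t^k\<close> is \<open>x^(k mod 2) y^(k div 2)\<close>, and powers of
        \<open>X0\<close> fill up the degree.\<close>
      define H where "H = (\<Sum>k\<le>2 * i. const3 (Polynomial.coeff h k) *
        (X0 ^ (i - (k div 2 + k mod 2)) * X1 ^ (k mod 2) * X2 ^ (k div 2)))"
      have "H \<in> forms i" unfolding H_def
      proof (intro forms_sum forms_const_mult forms_monomial forms_dual_form)
        fix k assume "k \<in> {..2 * i}"
        then have "k div 2 + k mod 2 \<le> i" by simp presburger
        then show "i - (k div 2 + k mod 2) + k mod 2 + k div 2 = i" by simp
      qed
      moreover have "eval3 H (pt t (t\<^sup>2)) = poly h t" for t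
      proof -
        have "t ^ (k mod 2) * (t\<^sup>2) ^ (k div 2) = t ^ k" for k
          by (simp flip: power_mult power_add)
        then have "eval3 H (pt t (t\<^sup>2)) = (\<Sum>k\<le>2 * i. Polynomial.coeff h k * t ^ k)"
          by (simp only: H_def eval3_sum eval3_mult eval3_power eval3_single eval_pt monom_val_0)
            simp
        also have "\<dots> = poly h t"
          unfolding poly_altdef using h by (intro sum.mono_neutral_right) (auto simp: coeff_eq_0)
        finally show ?thesis .
      qed
      ultimately show ?thesis
        using rad Lam_lgh[OF l g _ i, of H] by (simp add: conic lpt f(2) power_mult)
    qed
    then have "\<forall>p\<in>{..<s}. poly f (xc p) = 0" using u i f(1) unfolding B_def by blast
    then show ?thesis using eval_a_0_iff[OF g] by (simp add: conic f(2))
  qed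
  ultimately have "good l" unfolding good_def using l by blast
  then show ?thesis ..
qed


text \<open>\<open>Z1\<close> and \<open>Z2\<close> collect the points on the two lines away from
  the node, \<open>Z0\<close> those at the node. The slope \<open>m2\<close> is chosen first, on the
  line with fewer points; the node weight \<open>\<kappa> i\<close> then depends on
  \<open>m2\<close>, and \<open>m1\<close> is chosen last.\<close>

lemma good_lines_ordered:
  assumes conic: "\<And>p. p < s \<Longrightarrow> xc p * yc p = 0"
    and card_le: "card {p. p < s \<and> yc p \<noteq> 0} \<le> card {p. p < s \<and> xc p \<noteq> 0}"
  shows "\<exists>l. good l"
proof -
  define Z1 where "Z1 = {p. p < s \<and> xc p \<noteq> 0}"
  define Z2 where "Z2 = {p. p < s \<and> yc p \<noteq> 0}"
  define Z0 where "Z0 = {p. p < s \<and> xc p = 0 \<and> yc p = 0}"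
  define \<gamma>1 where "\<gamma>1 = (\<lambda>i. [:v0 i, v1 i:])"
  define \<gamma>2 where "\<gamma>2 = (\<lambda>i. [:v0 i, v2 i:])"
  have \<gamma>: "Polynomial.degree (\<gamma>1 i) \<le> 1" "Polynomial.degree (\<gamma>2 i) \<le> 1" for i
    by (simp_all add: \<gamma>1_def \<gamma>2_def)
  have pt\<gamma>: "pt t 0 = (\<lambda>i. poly (\<gamma>1 i) t)" "pt 0 t = (\<lambda>i. poly (\<gamma>2 i) t)" for t
    by (simp_all add: pt_def \<gamma>1_def \<gamma>2_def fun_eq_iff)
  have Z1: "finite Z1" "\<And>p. p \<in> Z1 \<Longrightarrow> p < s" "\<And>p. p \<in> Z1 \<Longrightarrow> xc p \<noteq> 0" "\<And>p. p \<in> Z1 \<Longrightarrow> yc p = 0"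
    using conic by (auto simp: Z1_def)
  have Z2: "finite Z2" "\<And>p. p \<in> Z2 \<Longrightarrow> p < s" "\<And>p. p \<in> Z2 \<Longrightarrow> yc p \<noteq> 0" "\<And>p. p \<in> Z2 \<Longrightarrow> xc p = 0"
    using conic by (auto simp: Z2_def)
  have Z0: "finite Z0" "\<And>p. p \<in> Z0 \<Longrightarrow> p < s" "\<And>p. p \<in> Z0 \<Longrightarrow> xc p = 0" "\<And>p. p \<in> Z0 \<Longrightarrow> yc p = 0"
    by (auto simp: Z0_def)
  have cover: "p \<in> Z1 \<or> p \<in> Z2 \<or> p \<in> Z0" if "p < s" for p using that by (auto simp: Z0_def Z1_def Z2_def)
  have sum_split: "(\<Sum>p<s. F p) = (\<Sum>p\<in>Z1. F p) + (\<Sum>p\<in>Z2. F p) + (\<Sum>p\<in>Z0. F p)" for F :: "nat \<Rightarrow> 'k"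
  proof -
    have "{..<s} = Z1 \<union> Z2 \<union> Z0" using Z1(2) Z2(2) Z0(2) cover by auto
    moreover have "Z1 \<inter> Z2 = {}" "(Z1 \<union> Z2) \<inter> Z0 = {}"
      using Z1(3) Z2(3,4) Z0(3,4) by blast+
    ultimately show ?thesis using Z1(1) Z2(1) Z0(1) by (simp add: sum.union_disjoint)
  qed
  have inj1: "inj_on xc Z1" using coords_inj Z1 by (auto intro!: inj_onI)
  have inj2: "inj_on yc Z2" using coords_inj Z2 by (auto intro!: inj_onI)
  have c1: "card Z1 \<le> \<tau> + 1"
    using separated_card_le[of Z1 xc \<gamma>1 1] Z1 inj1 \<gamma> by (auto simp: pt\<gamma>)
  have c2: "card Z2 \<le> card Z1" using card_le by (simp add: Z1_def Z2_def)
  define sect where "sect = (\<lambda>c i q. Polynomial.degree q \<le> i \<and> poly q 0 = 1 \<and>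
    (\<forall>g. Polynomial.degree g \<le> i \<longrightarrow> poly g 0 = 0 \<longrightarrow>
      (\<Sum>j\<in>Z2. \<beta> j * (1 + c * yc j) ^ (d - 2 * i) * poly q (yc j) * poly g (yc j)) = 0) \<and>
    (\<forall>f. Polynomial.degree f \<le> i \<longrightarrow>
      (\<forall>g. Polynomial.degree g \<le> i \<longrightarrow> poly g 0 = 0 \<longrightarrow>
        (\<Sum>j\<in>Z2. \<beta> j * (1 + c * yc j) ^ (d - 2 * i) * poly f (yc j) * poly g (yc j)) = 0) \<longrightarrow>
      (\<forall>j\<in>Z2. poly f (yc j) = poly f 0 * poly q (yc j))))"
  \<comment> \<open>The bound \<open>card Z2 \<le> (d - 2 * i) + i\<close> holds because
    \<open>card Z2 \<le> \<tau> + 1\<close>, \<open>i < \<tau>\<close> and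
    \<open>2 * \<tau> \<le> d\<close>.\<close>
  have "finite {c. \<not> (\<exists>q. sect c i q)}" if "i < \<tau>" for i
    unfolding sect_def by (rule finite_no_orthogonal_section) (use Z2 inj2 \<beta>_nonzero c1 c2 \<tau> that in auto)
  then have "finite ((\<Union>i<\<tau>. {c. \<not> (\<exists>q. sect c i q)}) \<union> (\<lambda>p. - 1 / yc p) ` Z2)" using Z2(1) by blast
  then obtain m2 where m2: "m2 \<notin> (\<Union>i<\<tau>. {c. \<not> (\<exists>q. sect c i q)}) \<union> (\<lambda>p. - 1 / yc p) ` Z2"
    using ex_new_if_finite infinite_UNIV_char_0 by blast
  then have "\<forall>i<\<tau>. \<exists>q. sect m2 i q" by blast
  then obtain q where q: "\<And>i. i < \<tau> \<Longrightarrow> sect m2 i (q i)" by metis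
  \<comment> \<open>The twisted self-pairing of the section \<open>q i\<close> on \<open>Z2\<close>,
    plus the weight of the node itself, where both \<open>q i\<close> and \<open>l\<close> take the
    value 1. If it is zero, the node must be left out of \<open>J i\<close>, as the one-variable
    statement requires nonzero weights.\<close>
  define \<kappa> where "\<kappa> = (\<lambda>i. (\<Sum>p\<in>Z2. \<beta> p * (1 + m2 * yc p) ^ (d - 2 * i) * poly (q i) (yc p) * poly (q i) (yc p))
    + (\<Sum>p\<in>Z0. \<beta> p))"
  \<comment> \<open>The index \<open>s\<close>, not used by any point, stands for the node with weight \<open>\<kappa> i\<close>.\<close>
  define J where "J = (\<lambda>i. if \<kappa> i = 0 then Z1 else insert s Z1)"
  define t where "t = xc(s := 0)"
  have sZ1: "s \<notin> Z1" using Z1(2) by blast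
  have t: "t s = 0" "\<And>p. p \<in> Z1 \<Longrightarrow> t p = xc p" using sZ1 by (auto simp: t_def)
  define B where "B = (\<lambda>i. {c. \<exists>f. Polynomial.degree f \<le> i \<and>
    (\<forall>g. Polynomial.degree g \<le> i \<longrightarrow>
      (\<Sum>j\<in>J i. (\<beta>(s := \<kappa> i)) j * (1 + c * t j) ^ (d - 2 * i) * poly f (t j) * poly g (t j)) = 0) \<and>
    (\<exists>j\<in>J i. poly f (t j) \<noteq> 0)})"
  have "finite (B i)" if i: "i < \<tau>" for i
    unfolding B_def
  proof (rule finite_degenerate_slopes)
    show "finite (J i)" by (simp add: J_def Z1)
    show "inj_on t (J i)" using inj1 Z1(3) sZ1 by (auto simp: J_def t_def inj_on_def)
    show "(\<beta>(s := \<kappa> i)) j \<noteq> 0" if "j \<in> J i" for j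
      using that Z1(2) \<beta>_nonzero by (auto simp: J_def split: if_splits)
    \<comment> \<open>The node may add one point to \<open>Z1\<close>, giving
      \<open>\<tau> + 2\<close> at most, which is still within \<open>d - i + 1\<close>.\<close>
    show "card (J i) \<le> d - 2 * i + i + 1" using c1 \<tau> i Z1(1) sZ1 by (auto simp: J_def)
  qed
  then have "finite ((\<Union>i<\<tau>. B i) \<union> (\<lambda>p. - 1 / xc p) ` Z1)" using Z1(1) by blast
  then obtain m1 where m1: "m1 \<notin> (\<Union>i<\<tau>. B i) \<union> (\<lambda>p. - 1 / xc p) ` Z1"
    using ex_new_if_finite infinite_UNIV_char_0 by blast
  have l1: "1 + m1 * xc p \<noteq> 0" if "p \<in> Z1" for p
  proof
    assume "1 + m1 * xc p = 0"
    then have "m1 = - 1 / xc p" using Z1(3)[OF that] by (simp add: field_simps add_eq_0_iff)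
    then show False using m1 that by blast
  qed
  have l2: "1 + m2 * yc p \<noteq> 0" if "p \<in> Z2" for p
  proof
    assume "1 + m2 * yc p = 0"
    then have "m2 = - 1 / yc p" using Z2(3)[OF that] by (simp add: field_simps add_eq_0_iff)
    then show False using m2 that by blast
  qed
  define l where "l = X0 + const3 m1 * X1 + const3 m2 * X2"
  have l: "l \<in> forms 1" unfolding l_def by (intro forms_add forms_const_mult forms_dual_form)
  have lpt: "eval3 l (pt x y) = 1 + m1 * x + m2 * y" for x y
    unfolding l_def by (simp only: eval3_add eval3_mult eval3_single eval_pt monom_val_0) simp
  have "eval3 l (a p) \<noteq> 0" if "p < s" for p
    using cover[OF that] l1[of p] l2[of p] Z1(4)[of p] Z2(4)[of p] Z0(3,4)[of p]
    by (auto simp: eval_a_0_iff[OF l that] lpt)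
  moreover have "\<forall>p<s. eval3 g (a p) = 0"
    if i: "i < \<tau>" and g: "g \<in> forms i" and rad: "\<forall>h\<in>forms i. Lam (l ^ (d - 2 * i) * g * h) = 0" for i g
  proof -
    let ?e = "d - 2 * i"
    obtain G1 where "Polynomial.degree G1 \<le> 1 * i" "\<And>x. poly G1 x = eval3 g (pt x 0)"
      using restrict_to_curve[OF g, of \<gamma>1 1, OF \<gamma>(1)] unfolding pt\<gamma> by blast
    then have G1: "Polynomial.degree G1 \<le> i" "\<And>x. poly G1 x = eval3 g (pt x 0)" by simp_all
    obtain G2 where "Polynomial.degree G2 \<le> 1 * i" "\<And>x. poly G2 x = eval3 g (pt 0 x)"
      using restrict_to_curve[OF g, of \<gamma>2 1, OF \<gamma>(2)] unfolding pt\<gamma> by blast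
    then have G2: "Polynomial.degree G2 \<le> i" "\<And>x. poly G2 x = eval3 g (pt 0 x)" by simp_all
    have G0: "poly G2 0 = poly G1 0" by (simp add: G1 G2)
    \<comment> \<open>Orthogonality against an arbitrary pair of polynomials on the two lines that
      agree at the node.\<close>
    have key: "(\<Sum>p\<in>Z1. \<beta> p * (1 + m1 * xc p) ^ ?e * poly G1 (xc p) * poly H1 (xc p)) +
        (\<Sum>p\<in>Z2. \<beta> p * (1 + m2 * yc p) ^ ?e * poly G2 (yc p) * poly H2 (yc p)) +
        (\<Sum>p\<in>Z0. \<beta> p * poly G1 0 * poly H1 0) = 0"
      if H: "Polynomial.degree H1 \<le> i" "Polynomial.degree H2 \<le> i" "poly H1 0 = poly H2 0" for H1 H2
    proof -
      have expand: "poly h x = Polynomial.coeff h 0 + (\<Sum>k\<in>{1..i}. Polynomial.coeff h k * x ^ k)"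
        if "Polynomial.degree h \<le> i" for h and x :: 'k
      proof -
        have "poly h x = (\<Sum>k\<le>i. Polynomial.coeff h k * x ^ k)"
          unfolding poly_altdef using that by (intro sum.mono_neutral_left) (auto simp: coeff_eq_0)
        also have "{..i} = insert 0 {1..i}" by auto
        finally show ?thesis by simp
      qed
      \<comment> \<open>A form of degree \<open>i\<close> restricting to \<open>H1\<close> and
        \<open>H2\<close>: the common constant term is taken once, and no monomial mixes
        \<open>X1\<close> with \<open>X2\<close>.\<close>
      define K where "K = const3 (Polynomial.coeff H1 0) * (X0 ^ i * X1 ^ 0 * X2 ^ 0)
        + (\<Sum>k\<in>{1..i}. const3 (Polynomial.coeff H1 k) * (X0 ^ (i - k) * X1 ^ k * X2 ^ 0))
        + (\<Sum>k\<in>{1..i}. const3 (Polynomial.coeff H2 k) * (X0 ^ (i - k) * X1 ^ 0 * X2 ^ k))"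
      have K: "K \<in> forms i" unfolding K_def
        by (intro forms_add forms_sum forms_const_mult forms_monomial forms_dual_form) auto
      have evK: "eval3 K (pt x y) = Polynomial.coeff H1 0
          + (\<Sum>k\<in>{1..i}. Polynomial.coeff H1 k * x ^ k) + (\<Sum>k\<in>{1..i}. Polynomial.coeff H2 k * y ^ k)" for x y
        by (simp only: K_def eval3_add eval3_sum eval3_mult eval3_power eval3_single eval_pt monom_val_0) simp
      have "Polynomial.coeff H1 0 = Polynomial.coeff H2 0" using H(3) by (simp add: poly_0_coeff_0)
      moreover have "(\<Sum>k\<in>{1..i}. f k * (0::'k) ^ k) = 0" for f by (intro sum.neutral) (simp add: power_0_left)
      ultimately have K1: "eval3 K (pt x 0) = poly H1 x" and K2: "eval3 K (pt 0 x) = poly H2 x" for x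
        using expand[OF H(1), of x] expand[OF H(2), of x] by (simp_all add: evK)
      have "(\<Sum>p<s. \<beta> p * eval3 l (pt (xc p) (yc p)) ^ ?e * eval3 g (pt (xc p) (yc p)) * eval3 K (pt (xc p) (yc p))) = 0"
        using rad K Lam_lgh[OF l g K i] by simp
      then show ?thesis unfolding sum_split
        by (simp add: Z1(4) Z2(4) Z0(3,4) lpt K1 K2 G1(2) G2(2) cong: sum.cong)
    qed
    have key2: "(\<Sum>p\<in>Z2. \<beta> p * (1 + m2 * yc p) ^ ?e * poly G2 (yc p) * poly h (yc p)) = 0"
      if "Polynomial.degree h \<le> i" "poly h 0 = 0" for h
      using key[of 0 h] that by simp
    have key1: "(\<Sum>p\<in>Z1. \<beta> p * (1 + m1 * xc p) ^ ?e * poly G1 (xc p) * poly h (xc p)) = 0"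
      if "Polynomial.degree h \<le> i" "poly h 0 = 0" for h
      using key[of h 0] that by simp
    have "(\<forall>p\<in>Z1. poly G1 (xc p) = 0) \<and> (\<forall>p\<in>Z2. poly G2 (yc p) = 0) \<and> (\<forall>p\<in>Z0. poly G1 0 = 0)"
    proof (cases "card Z1 \<le> i")
      case True
      \<comment> \<open>With at most \<open>i\<close> points per line away from the node, tests
        vanishing at the node already isolate each of these points; what remains is the node, tested
        with the pair \<open>1\<close>, \<open>1\<close>.\<close>
      have a1: "\<forall>p\<in>Z1. poly G1 (xc p) = 0"
        by (rule vanishing_from_orthogonality[OF Z1(1) inj1 Z1(3) _ True key1])
          (use l1 \<beta>_nonzero Z1(2) in auto)
      have a2: "\<forall>p\<in>Z2. poly G2 (yc p) = 0"
        by (rule vanishing_from_orthogonality[OF Z2(1) inj2 Z2(3) _ _ key2])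
          (use l2 \<beta>_nonzero Z2(2) True c2 in auto)
      have "poly G1 0 = 0" if p: "p \<in> Z0" for p
      proof -
        have "Z0 = {p}" using p coords_inj Z0 by (metis is_singletonI' is_singleton_the_elem empty_iff singletonD)
        then show ?thesis using key[of 1 1] a1 a2 \<beta>_nonzero[of p] Z0(2)[OF p] by simp
      qed
      then show ?thesis using a1 a2 by blast
    next
      case False
      have sec: "sect m2 i (q i)" using q i by blast
      then have dq: "Polynomial.degree (q i) \<le> i" and q0: "poly (q i) 0 = 1" by (auto simp: sect_def)
      \<comment> \<open>By \<open>key2\<close>, \<open>G2\<close> is orthogonal to all polynomials
        vanishing at the node, hence on \<open>Z2\<close> it is a multiple of the section.\<close>
      have G2q: "\<forall>p\<in>Z2. poly G2 (yc p) = poly G1 0 * poly (q i) (yc p)"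
        using sec key2 G2(1) unfolding sect_def G0[symmetric] by blast
      have orth: "(\<Sum>j\<in>J i. (\<beta>(s := \<kappa> i)) j * (1 + m1 * t j) ^ ?e * poly G1 (t j) * poly h (t j)) = 0"
        if h: "Polynomial.degree h \<le> i" for h
      proof -
        \<comment> \<open>The pair of tests \<open>h\<close> and \<open>h(0) * q i\<close> agrees at
          the node and collapses the sums over \<open>Z2\<close> and \<open>Z0\<close> into one term
          with weight \<open>\<kappa> i\<close>.\<close>
        have "Polynomial.degree (smult (poly h 0) (q i)) \<le> i" using dq degree_smult_le le_trans by blast
        from key[OF h this] have A:
          "(\<Sum>p\<in>Z1. \<beta> p * (1 + m1 * xc p) ^ ?e * poly G1 (xc p) * poly h (xc p)) + poly G1 0 * poly h 0 * \<kappa> i = 0"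
          using G2q q0 unfolding \<kappa>_def
          by (simp add: distrib_left sum_distrib_left mult_ac add.assoc cong: sum.cong)
        have B: "(\<Sum>p\<in>Z1. (\<beta>(s := \<kappa> i)) p * (1 + m1 * t p) ^ ?e * poly G1 (t p) * poly h (t p)) =
            (\<Sum>p\<in>Z1. \<beta> p * (1 + m1 * xc p) ^ ?e * poly G1 (xc p) * poly h (xc p))"
          using sZ1 by (intro sum.cong) (auto simp: t)
        have node: "(\<beta>(s := \<kappa> i)) s * (1 + m1 * t s) ^ ?e * poly G1 (t s) * poly h (t s) = poly G1 0 * poly h 0 * \<kappa> i"
          by (simp add: t(1))
        show ?thesis
        proof (cases "\<kappa> i = 0")
          case True
          then show ?thesis using A unfolding B[symmetric] by (simp only: J_def simp_thms if_True mult_zero_right add_0_right)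
        next
          case False
          then show ?thesis using A unfolding B[symmetric]
            by (simp only: J_def if_False sum.insert[OF Z1(1) sZ1] node add.commute)
        qed
      qed
      have zero: "\<forall>j\<in>J i. poly G1 (t j) = 0" using m1 i G1(1) orth unfolding B_def by blast
      then have a1: "\<forall>p\<in>Z1. poly G1 (xc p) = 0" using t(2) by (auto simp: J_def split: if_splits)
      \<comment> \<open>More than \<open>i\<close> roots force \<open>G1 = 0\<close>; this also
        yields the value at the node when \<open>\<kappa> i = 0\<close> and the node is absent from
        \<open>J i\<close>.\<close>
      have "G1 = 0"
      proof (rule ccontr)
        assume "G1 \<noteq> 0"
        have "card Z1 = card (xc ` Z1)" by (simp add: card_image inj1)
        also have "\<dots> \<le> card {x. poly G1 x = 0}"
          using a1 by (intro card_mono poly_roots_finite \<open>G1 \<noteq> 0\<close>) auto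
        also have "\<dots> \<le> i" using card_poly_roots_bound[OF \<open>G1 \<noteq> 0\<close>] G1(1) by linarith
        finally show False using False by simp
      qed
      then show ?thesis using G2q by simp
    qed
    then have "eval3 g (pt (xc p) (yc p)) = 0" if "p < s" for p
      using cover[OF that] Z1(4)[of p] Z2(4)[of p] Z0(3,4)[of p] G1(2) G2(2) by auto
    then show ?thesis using eval_a_0_iff[OF g] by blast
  qed
  ultimately have "good l" unfolding good_def using l by blast
  then show ?thesis ..
qed

text \<open>Exchanging the two affine coordinates reduces to the case where \<open>Z1\<close> is the
  larger set.\<close>

lemma good_lines:
  assumes conic: "\<And>p. p < s \<Longrightarrow> xc p * yc p = 0"
  shows "\<exists>l. good l"
proof (cases "card {p. p < s \<and> yc p \<noteq> 0} \<le> card {p. p < s \<and> xc p \<noteq> 0}")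
  case True
  then show ?thesis using good_lines_ordered conic by blast
next
  case False
  interpret sw: conic_frame s d \<alpha> a v0 v2 v1 \<xi>0 \<xi>2 \<xi>1 \<tau>
  proof
    show "b i = eval3 X0 b * v0 i + eval3 X2 b * v2 i + eval3 X1 b * v1 i" for b i
      using recon[of b i] by (simp add: add_ac)
    show "eval3 X0 (\<lambda>i. v0 i + x * v2 i + y * v1 i) = 1" "eval3 X2 (\<lambda>i. v0 i + x * v2 i + y * v1 i) = x"
      "eval3 X1 (\<lambda>i. v0 i + x * v2 i + y * v1 i) = y" for x y
      using dual[of y x] by (simp_all add: add_ac)
  qed (use finite_part \<alpha>_nonzero distinct_points \<tau> separate in blast)+
  have "sw.xc p = yc p" "sw.yc p = xc p" for p
    by (simp_all add: sw.xc_def sw.yc_def xc_def yc_def sw.lam_def lam_def)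
  then have "\<exists>l. sw.good l"
    using sw.good_lines_ordered conic False by (simp add: mult.commute)
  then show ?thesis unfolding sw.good_def good_def .
qed

end

section \<open>Affine coordinates for a conic\<close>

text \<open>Coordinate changes are made on linear functions of vectors, so no substitution into
  polynomials is required; coefficient vectors are recovered at the end.\<close>

definition linear_fun3 :: "((3 \<Rightarrow> 'k) \<Rightarrow> 'k::comm_ring_1) \<Rightarrow> bool"
  where "linear_fun3 L \<longleftrightarrow> (\<exists>c. \<forall>b. L b = (\<Sum>i\<in>UNIV. c i * b i))"

lemma linear_fun3_coord: "linear_fun3 (\<lambda>b. b i)"
  unfolding linear_fun3_def
  by (rule exI[of _ "\<lambda>j. if j = i then 1 else 0"]) (simp add: if_distrib[of "\<lambda>x. x * _"] cong: if_cong)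

lemma linear_fun3_add: "linear_fun3 K \<Longrightarrow> linear_fun3 L \<Longrightarrow> linear_fun3 (\<lambda>b. K b + L b)"
  unfolding linear_fun3_def
proof (elim exE)
  fix c c' assume "\<forall>b. K b = (\<Sum>i\<in>UNIV. c i * b i)" "\<forall>b. L b = (\<Sum>i\<in>UNIV. c' i * b i)"
  then show "\<exists>c. \<forall>b. K b + L b = (\<Sum>i\<in>UNIV. c i * b i)"
    by (intro exI[of _ "\<lambda>i. c i + c' i"]) (simp add: distrib_right sum.distrib)
qed

lemma linear_fun3_mult: "linear_fun3 L \<Longrightarrow> linear_fun3 (\<lambda>b. r * L b)"
  unfolding linear_fun3_def
proof (elim exE)
  fix c assume "\<forall>b. L b = (\<Sum>i\<in>UNIV. c i * b i)"
  then show "\<exists>c. \<forall>b. r * L b = (\<Sum>i\<in>UNIV. c i * b i)"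
    by (intro exI[of _ "\<lambda>i. r * c i"]) (simp add: sum_distrib_left mult.assoc)
qed

lemmas linear_fun3_intros = linear_fun3_coord linear_fun3_add linear_fun3_mult

definition vec3 :: "'k \<Rightarrow> 'k \<Rightarrow> 'k \<Rightarrow> 3 \<Rightarrow> 'k"
  where "vec3 x y z = (\<lambda>i. if i = 0 then x else if i = 1 then y else z)"

lemma vec3_simps [simp]: "vec3 x y z 0 = x" "vec3 x y z 1 = y" "vec3 x y z 2 = z"
  by (simp_all add: vec3_def)

lemma fun3_eq_iff: "b = c \<longleftrightarrow> b 0 = c 0 \<and> b 1 = c 1 \<and> b (2::3) = c 2"
  by (auto simp: fun_eq_iff all_3)

definition det3 :: "(3 \<Rightarrow> 'k::comm_ring_1) \<Rightarrow> (3 \<Rightarrow> 'k) \<Rightarrow> (3 \<Rightarrow> 'k) \<Rightarrow> 'k"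
  where "det3 u v w = u 0 * (v 1 * w 2 - v 2 * w 1) + u 1 * (v 2 * w 0 - v 0 * w 2) + u 2 * (v 0 * w 1 - v 1 * w 0)"

definition cross :: "(3 \<Rightarrow> 'k::comm_ring_1) \<Rightarrow> (3 \<Rightarrow> 'k) \<Rightarrow> 3 \<Rightarrow> 'k"
  where "cross v w = vec3 (v 1 * w 2 - v 2 * w 1) (v 2 * w 0 - v 0 * w 2) (v 0 * w 1 - v 1 * w 0)"

lemma sum_cross: "(\<Sum>i\<in>UNIV. u i * cross v w i) = det3 u v w"
  by (simp add: sum_3 cross_def det3_def)

lemma det3_simps: "det3 u u v = 0" "det3 u v u = 0" "det3 u v v = 0"
  "det3 v w u = det3 u v w" "det3 w u v = det3 u v w"
  by (simp_all add: det3_def algebra_simps)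

text \<open>If the determinant vanishes, the cross products of pairs lie in the common kernel, so
  they are zero and the three vectors are pairwise dependent. A vector orthogonal to one of them is
  then tested against all three, which forces all entries to be zero.\<close>

lemma det3_nonzero:
  fixes u v w :: "3 \<Rightarrow> 'k::field"
  assumes ker: "\<And>b. (\<Sum>i\<in>UNIV. u i * b i) = 0 \<Longrightarrow> (\<Sum>i\<in>UNIV. v i * b i) = 0 \<Longrightarrow> (\<Sum>i\<in>UNIV. w i * b i) = 0 \<Longrightarrow> b = (\<lambda>_. 0)"
  shows "det3 u v w \<noteq> 0"
proof
  assume D: "det3 u v w = 0"
  have c: "cross u v = (\<lambda>_. 0)" "cross v w = (\<lambda>_. 0)" "cross w u = (\<lambda>_. 0)"
    by (rule ker; simp add: sum_cross det3_simps D)+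
  have z: "c 0 = 0 \<and> c 1 = 0 \<and> c 2 = 0" if "c = u \<or> c = v \<or> c = w" for c
  proof -
    have "vec3 (c 1) (- c 0) 0 = (\<lambda>_. 0)"
      by (rule ker; use c that in \<open>auto simp: sum_3 cross_def fun3_eq_iff algebra_simps\<close>)
    moreover have "vec3 (c 2) 0 (- c 0) = (\<lambda>_. 0)"
      by (rule ker; use c that in \<open>auto simp: sum_3 cross_def fun3_eq_iff algebra_simps\<close>)
    ultimately show ?thesis by (simp add: fun3_eq_iff)
  qed
  have "vec3 1 0 0 = (\<lambda>_. 0 :: 'k)"
    by (rule ker) (use z[of u] z[of v] z[of w] in \<open>simp_all add: sum_3\<close>)
  then show False by (simp add: fun3_eq_iff)
qed

text \<open>Cramer's rule: the dual vectors are the cross products of pairs divided by the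
  determinant.\<close>

lemma dual_basis:
  fixes u v w :: "3 \<Rightarrow> 'k::field"
  assumes D: "det3 u v w \<noteq> 0"
  shows "\<exists>u' v' w'.
    (\<forall>b i. b i = (\<Sum>i\<in>UNIV. u i * b i) * u' i + (\<Sum>i\<in>UNIV. v i * b i) * v' i + (\<Sum>i\<in>UNIV. w i * b i) * w' i) \<and>
    (\<forall>x y. (\<Sum>i\<in>UNIV. u i * (u' i + x * v' i + y * w' i)) = 1) \<and>
    (\<forall>x y. (\<Sum>i\<in>UNIV. v i * (u' i + x * v' i + y * w' i)) = x) \<and>
    (\<forall>x y. (\<Sum>i\<in>UNIV. w i * (u' i + x * v' i + y * w' i)) = y)"
proof -
  define \<delta> where "\<delta> = inverse (det3 u v w)"
  have \<delta>: "\<delta> * det3 u v w = 1" using D by (simp add: \<delta>_def)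
  let ?u = "\<lambda>i. \<delta> * cross v w i" and ?v = "\<lambda>i. \<delta> * cross w u i" and ?w = "\<lambda>i. \<delta> * cross u v i"
  have recon: "b i = (\<Sum>i\<in>UNIV. u i * b i) * ?u i + (\<Sum>i\<in>UNIV. v i * b i) * ?v i + (\<Sum>i\<in>UNIV. w i * b i) * ?w i" for b i
  proof -
    have "i = 0 \<or> i = 1 \<or> i = 2" using UNIV_3 by blast
    moreover have "b 0 * det3 u v w = (\<Sum>i\<in>UNIV. u i * b i) * cross v w 0 + (\<Sum>i\<in>UNIV. v i * b i) * cross w u 0 + (\<Sum>i\<in>UNIV. w i * b i) * cross u v 0"
      "b 1 * det3 u v w = (\<Sum>i\<in>UNIV. u i * b i) * cross v w 1 + (\<Sum>i\<in>UNIV. v i * b i) * cross w u 1 + (\<Sum>i\<in>UNIV. w i * b i) * cross u v 1"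
      "b 2 * det3 u v w = (\<Sum>i\<in>UNIV. u i * b i) * cross v w 2 + (\<Sum>i\<in>UNIV. v i * b i) * cross w u 2 + (\<Sum>i\<in>UNIV. w i * b i) * cross u v 2"
      by (simp_all add: sum_3 cross_def det3_def algebra_simps)
    ultimately have "b i * det3 u v w = (\<Sum>i\<in>UNIV. u i * b i) * cross v w i + (\<Sum>i\<in>UNIV. v i * b i) * cross w u i + (\<Sum>i\<in>UNIV. w i * b i) * cross u v i"
      by (elim disjE) (simp_all only:)
    then have "\<delta> * (b i * det3 u v w) = \<delta> * ((\<Sum>i\<in>UNIV. u i * b i) * cross v w i + (\<Sum>i\<in>UNIV. v i * b i) * cross w u i + (\<Sum>i\<in>UNIV. w i * b i) * cross u v i)"
      by simp
    moreover have "\<delta> * (b i * det3 u v w) = b i" using \<delta> by (simp add: mult.left_commute)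
    ultimately show ?thesis by (simp add: algebra_simps)
  qed
  have "(\<Sum>i\<in>UNIV. c i * (?u i + x * ?v i + y * ?w i)) =
      \<delta> * det3 c v w + x * (\<delta> * det3 c w u) + y * (\<delta> * det3 c u v)" for c x y
    by (simp add: distrib_left sum.distrib sum_distrib_left mult.left_commute flip: sum_cross)
  note expand = this
  have "det3 v w u = det3 u v w" "det3 w u v = det3 u v w" by (rule det3_simps)+
  then have dual: "(\<Sum>i\<in>UNIV. u i * (?u i + x * ?v i + y * ?w i)) = 1"
    "(\<Sum>i\<in>UNIV. v i * (?u i + x * ?v i + y * ?w i)) = x"
    "(\<Sum>i\<in>UNIV. w i * (?u i + x * ?v i + y * ?w i)) = y" for x y
    unfolding expand using \<delta> by (simp_all add: det3_simps(1-3))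
  show ?thesis
    by (rule exI[of _ ?u], rule exI[of _ ?v], rule exI[of _ ?w]) (intro conjI allI recon dual)
qed

section \<open>Quadratic forms and their normal forms\<close>

lemma quadratic_form_expansion:
  fixes q :: "'k::field_char_0 mpoly3"
  assumes "q \<in> forms 2" "q \<noteq> 0"
  obtains A B C D E F where "\<not> (A = 0 \<and> B = 0 \<and> C = 0 \<and> D = 0 \<and> E = 0 \<and> F = 0)"
    "\<And>b. eval3 q b = A * (b 0)\<^sup>2 + B * (b 1)\<^sup>2 + C * (b 2)\<^sup>2 + D * (b 0 * b 1) + E * (b 0 * b 2) + F * (b 1 * b 2)"
proof -
  let ?s = "Poly_Mapping.single :: 3 \<Rightarrow> nat \<Rightarrow> _"
  define M where "M = {?s 0 2, ?s 1 2, ?s 2 2, ?s 0 1 + ?s 1 1, ?s 0 1 + ?s 2 1, ?s 1 1 + ?s 2 1}"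
  have sub: "Poly_Mapping.keys q \<subseteq> M"
  proof
    fix m assume "m \<in> Poly_Mapping.keys q"
    then have deg: "Poly_Mapping.lookup m 0 + Poly_Mapping.lookup m 1 + Poly_Mapping.lookup m 2 = 2"
      using assms(1) by (auto simp: forms_def mdeg_def sum_3)
    have eq: "m = m' \<longleftrightarrow> Poly_Mapping.lookup m 0 = Poly_Mapping.lookup m' 0 \<and>
        Poly_Mapping.lookup m 1 = Poly_Mapping.lookup m' 1 \<and> Poly_Mapping.lookup m 2 = Poly_Mapping.lookup m' 2" for m'
      by (simp add: poly_mapping_eq_iff fun3_eq_iff)
    have split: "x + y + z = 2 \<Longrightarrow> x = 2 \<and> y = 0 \<and> z = 0 \<or> x = 0 \<and> y = 2 \<and> z = 0 \<or> x = 0 \<and> y = 0 \<and> z = 2 \<or>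
        x = 1 \<and> y = 1 \<and> z = 0 \<or> x = 1 \<and> y = 0 \<and> z = 1 \<or> x = 0 \<and> y = 1 \<and> z = 1" for x y z :: nat
      by presburger
    show "m \<in> M" unfolding M_def insert_iff eq empty_iff
      using split[OF deg] by (simp add: lookup_add lookup_single when_def del: single_numeral)
  qed
  have neq: "?s 0 2 \<noteq> ?s 1 2" "?s 0 2 \<noteq> ?s 2 2" "?s 1 2 \<noteq> ?s 2 2"
    "?s 0 2 \<noteq> ?s 0 1 + ?s 1 1" "?s 0 2 \<noteq> ?s 0 1 + ?s 2 1" "?s 0 2 \<noteq> ?s 1 1 + ?s 2 1"
    "?s 1 2 \<noteq> ?s 0 1 + ?s 1 1" "?s 1 2 \<noteq> ?s 0 1 + ?s 2 1" "?s 1 2 \<noteq> ?s 1 1 + ?s 2 1"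
    "?s 2 2 \<noteq> ?s 0 1 + ?s 1 1" "?s 2 2 \<noteq> ?s 0 1 + ?s 2 1" "?s 2 2 \<noteq> ?s 1 1 + ?s 2 1"
    "?s 0 1 + ?s 1 1 \<noteq> ?s 0 1 + ?s 2 1" "?s 0 1 + ?s 1 1 \<noteq> ?s 1 1 + ?s 2 1" "?s 0 1 + ?s 2 1 \<noteq> ?s 1 1 + ?s 2 1"
    by (simp_all add: poly_mapping_eq_iff fun3_eq_iff lookup_add lookup_single when_def del: single_numeral)
  let ?c = "Poly_Mapping.lookup q"
  have "eval3 q b = (\<Sum>m\<in>M. ?c m * monom_val b m)" for b
    unfolding eval3_lin_ext lin_ext_def
    by (rule sum.mono_neutral_left) (use sub in \<open>auto simp: M_def in_keys_iff\<close>)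
  then have ev: "eval3 q b = ?c (?s 0 2) * (b 0)\<^sup>2 + ?c (?s 1 2) * (b 1)\<^sup>2 + ?c (?s 2 2) * (b 2)\<^sup>2
      + ?c (?s 0 1 + ?s 1 1) * (b 0 * b 1) + ?c (?s 0 1 + ?s 2 1) * (b 0 * b 2) + ?c (?s 1 1 + ?s 2 1) * (b 1 * b 2)" for b
    unfolding M_def using neq by (simp add: monom_val_add del: One_nat_def single_numeral single_one)
  obtain m where "m \<in> Poly_Mapping.keys q" using assms(2) by (metis ex_in_conv keys_eq_empty)
  then have "m \<in> M" "?c m \<noteq> 0" using sub by (auto simp: in_keys_iff)
  then have "\<not> (?c (?s 0 2) = 0 \<and> ?c (?s 1 2) = 0 \<and> ?c (?s 2 2) = 0 \<and> ?c (?s 0 1 + ?s 1 1) = 0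
      \<and> ?c (?s 0 1 + ?s 2 1) = 0 \<and> ?c (?s 1 1 + ?s 2 1) = 0)"
    by (auto simp: M_def simp del: One_nat_def single_numeral single_one)
  then show thesis using that ev by blast
qed

text \<open>Choose coordinates in which \<open>G\<close> and \<open>Y\<close> vanish at
  \<open>z\<close>. Since \<open>z\<close> lies on the conic, no \<open>Z^2\<close> term remains,
  and \<open>m\<close>, \<open>n\<close> are the coefficients of the linear form cutting out the
  tangent at \<open>z\<close>.\<close>

lemma quadratic_form_at_point:
  fixes q :: "'k::field_char_0 mpoly3"
  assumes "q \<in> forms 2" "q \<noteq> 0" and z: "eval3 q z = 0" "z \<noteq> (\<lambda>_. 0)"
  obtains G Y Z e f g m n where "linear_fun3 G" "linear_fun3 Y" "linear_fun3 Z"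
    "\<And>b. G b = 0 \<Longrightarrow> Y b = 0 \<Longrightarrow> Z b = 0 \<Longrightarrow> b = (\<lambda>_. 0)"
    "\<not> (e = 0 \<and> f = 0 \<and> g = 0 \<and> m = 0 \<and> n = 0)"
    "\<And>b. eval3 q b = e * (G b)\<^sup>2 + f * (Y b)\<^sup>2 + g * (G b * Y b) + m * (G b * Z b) + n * (Y b * Z b)"
proof -
  obtain A B C D E F where nz: "\<not> (A = 0 \<and> B = 0 \<and> C = 0 \<and> D = 0 \<and> E = 0 \<and> F = 0)"
    and ev: "\<And>b. eval3 q b = A * (b 0)\<^sup>2 + B * (b 1)\<^sup>2 + C * (b 2)\<^sup>2 + D * (b 0 * b 1) + E * (b 0 * b 2) + F * (b 1 * b 2)"
    using quadratic_form_expansion[OF assms(1,2)] by blast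
  \<comment> \<open>Permute the variables so that \<open>z\<close> has a nonzero coordinate at
    \<open>i\<close>.\<close>
  obtain i j k A B C D E F where ijk: "\<And>b :: 3 \<Rightarrow> 'k. b i = 0 \<Longrightarrow> b j = 0 \<Longrightarrow> b k = 0 \<Longrightarrow> b = (\<lambda>_. 0)" and oi: "z i \<noteq> 0"
    and nz: "\<not> (A = 0 \<and> B = 0 \<and> C = 0 \<and> D = 0 \<and> E = 0 \<and> F = 0)"
    and ev: "\<And>b. eval3 q b = A * (b i)\<^sup>2 + B * (b j)\<^sup>2 + C * (b k)\<^sup>2 + D * (b i * b j) + E * (b i * b k) + F * (b j * b k)"
  proof -
    have "z 0 \<noteq> 0 \<or> z 1 \<noteq> 0 \<or> z 2 \<noteq> 0" using z(2) by (auto simp: fun3_eq_iff)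
    then show thesis
    proof (elim disjE)
      assume "z 0 \<noteq> 0"
      show thesis by (rule that[of 0 1 2 A B C D E F]) (use \<open>z 0 \<noteq> 0\<close> nz ev in \<open>auto simp: fun3_eq_iff\<close>)
    next
      assume "z 1 \<noteq> 0"
      show thesis by (rule that[of 1 0 2 B A C D F E]) (use \<open>z 1 \<noteq> 0\<close> nz ev in \<open>auto simp: fun3_eq_iff algebra_simps\<close>)
    next
      assume "z 2 \<noteq> 0"
      show thesis by (rule that[of 2 0 1 C A B E F D]) (use \<open>z 2 \<noteq> 0\<close> nz ev in \<open>auto simp: fun3_eq_iff algebra_simps\<close>)
    qed
  qed
  define r where "r = z j / z i"
  define t where "t = z k / z i"
  have oj: "z j = r * z i" and ok: "z k = t * z i" using oi by (simp_all add: r_def t_def)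
  have "(A + B * r\<^sup>2 + C * t\<^sup>2 + D * r + E * t + F * (r * t)) * (z i)\<^sup>2 = 0"
    using z(1) unfolding ev oj ok by (simp add: algebra_simps power2_eq_square)
  then have A: "A = - (B * r\<^sup>2 + C * t\<^sup>2 + D * r + E * t + F * (r * t))" using oi
    by (simp only: mult_eq_0_iff power_eq_0_iff eq_neg_iff_add_eq_0 add.assoc simp_thms)
  show thesis
  proof (rule that[of "\<lambda>b. b j + (- r) * b i" "\<lambda>b. b k + (- t) * b i" "\<lambda>b. b i" B C F "D + 2 * B * r + F * t" "E + 2 * C * t + F * r"])
    show "b = (\<lambda>_. 0)" if "b j + (- r) * b i = 0" "b k + (- t) * b i = 0" "b i = 0" for b
      using ijk[of b] that by simp
    show "\<not> (B = 0 \<and> C = 0 \<and> F = 0 \<and> D + 2 * B * r + F * t = 0 \<and> E + 2 * C * t + F * r = 0)"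
      using nz A by auto
    show "eval3 q b = B * (b j + (- r) * b i)\<^sup>2 + C * (b k + (- t) * b i)\<^sup>2 + F * ((b j + (- r) * b i) * (b k + (- t) * b i))
        + (D + 2 * B * r + F * t) * ((b j + (- r) * b i) * b i) + (E + 2 * C * t + F * r) * ((b k + (- t) * b i) * b i)" for b
      unfolding ev A by (simp add: algebra_simps power2_eq_square)
  qed (intro linear_fun3_intros)+
qed

text \<open>A binary quadratic form with a rational zero \<open>(x, y)\<close> is divisible by the
  linear form vanishing there; the cofactor is found by comparing coefficients.\<close>

lemma binary_quadratic_factor:
  fixes e f g x y :: "'k::field"
  assumes "e * x\<^sup>2 + f * y\<^sup>2 + g * (x * y) = 0" "\<not> (x = 0 \<and> y = 0)" "\<not> (e = 0 \<and> f = 0 \<and> g = 0)"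
  obtains p q where "\<not> (p = 0 \<and> q = 0)"
    "\<And>G Y. e * G\<^sup>2 + f * Y\<^sup>2 + g * (G * Y) = (y * G - x * Y) * (p * G + q * Y)"
proof (cases "y = 0")
  case True
  then have "x \<noteq> 0" "e = 0" using assms by auto
  then have "e * G\<^sup>2 + f * Y\<^sup>2 + g * (G * Y) = (y * G - x * Y) * ((- g / x) * G + (- f / x) * Y)" for G Y
    using True by (simp add: field_simps power2_eq_square)
  moreover have "\<not> (- g / x = 0 \<and> - f / x = 0)" using \<open>x \<noteq> 0\<close> \<open>e = 0\<close> assms(3) by auto
  ultimately show thesis using that by blast
next
  case False
  define p q where "p = e / y" and "q = (g + x * p) / y"
  have e: "e = y * p" and g: "g = y * q - x * p" using False by (simp_all add: p_def q_def)
  have "(f + x * q) * y\<^sup>2 = 0"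
    using assms(1) unfolding e g by (simp add: algebra_simps power2_eq_square)
  then have f: "f = - x * q" using False by (simp add: eq_neg_iff_add_eq_0)
  have "e * G\<^sup>2 + f * Y\<^sup>2 + g * (G * Y) = (y * G - x * Y) * (p * G + q * Y)" for G Y
    unfolding e f g by (simp add: algebra_simps power2_eq_square)
  moreover have "\<not> (p = 0 \<and> q = 0)" using assms(3) e f g by auto
  ultimately show thesis using that by blast
qed

text \<open>Only the zeros in \<open>P\<close> matter, so everything stays rational. If the chosen
  point \<open>z\<close> is singular (\<open>m = n = 0\<close>), the form is binary in
  \<open>G\<close> and \<open>Y\<close> and any second point of \<open>P\<close> factors it.
  Otherwise the tangent at \<open>z\<close> serves as \<open>U\<close>, giving
  \<open>U W + f' V^2\<close>.\<close>

lemma conic_normal_form: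
  fixes q :: "'k::field_char_0 mpoly3"
  assumes q: "q \<in> forms 2" "q \<noteq> 0" and P: "\<And>b. b \<in> P \<Longrightarrow> eval3 q b = 0" "\<And>b. b \<in> P \<Longrightarrow> b \<noteq> (\<lambda>_. 0)"
    and "P \<noteq> {}"
  obtains U V T where "linear_fun3 U" "linear_fun3 V" "linear_fun3 T"
    "\<And>b. U b = 0 \<Longrightarrow> V b = 0 \<Longrightarrow> T b = 0 \<Longrightarrow> b = (\<lambda>_. 0)"
    "(\<forall>b\<in>P. U b * T b = (V b)\<^sup>2) \<or> (\<forall>b\<in>P. U b * T b = 0)"
proof -
  note result = that
  obtain z where z: "z \<in> P" using \<open>P \<noteq> {}\<close> by blast
  obtain G Y Z e f g m n where lin: "linear_fun3 G" "linear_fun3 Y" "linear_fun3 Z"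
    and ker: "\<And>b. G b = 0 \<Longrightarrow> Y b = 0 \<Longrightarrow> Z b = 0 \<Longrightarrow> b = (\<lambda>_. 0)"
    and nz: "\<not> (e = 0 \<and> f = 0 \<and> g = 0 \<and> m = 0 \<and> n = 0)"
    and ev: "\<And>b. eval3 q b = e * (G b)\<^sup>2 + f * (Y b)\<^sup>2 + g * (G b * Y b) + m * (G b * Z b) + n * (Y b * Z b)"
    using quadratic_form_at_point[OF q P(1)[OF z] P(2)[OF z]] by blast
  have two_lines: thesis
    if u: "\<not> (u1 = 0 \<and> u2 = 0)" and w: "\<not> (w1 = 0 \<and> w2 = 0)"
      and zero: "\<And>b. b \<in> P \<Longrightarrow> (u1 * G b + u2 * Y b) * (w1 * G b + w2 * Y b) = 0" for u1 u2 w1 w2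
  proof -
    obtain w1' w2' where D: "u1 * w2' - u2 * w1' \<noteq> 0"
      and zerz: "\<And>b. b \<in> P \<Longrightarrow> (u1 * G b + u2 * Y b) * (w1' * G b + w2' * Y b) = 0"
    proof (cases "u1 * w2 - u2 * w1 = 0")
      case False
      then show thesis using that zero by blast
    next
      case True
      \<comment> \<open>For a double line every point lies on the first line, so the second may be
        replaced by any independent one.\<close>
      have "u1 * G b + u2 * Y b = 0" if "b \<in> P" for b
      proof -
        have "w1 * (u1 * G b + u2 * Y b) = u1 * (w1 * G b + w2 * Y b)"
          "w2 * (u1 * G b + u2 * Y b) = u2 * (w1 * G b + w2 * Y b)"
          using True by (auto simp: algebra_simps)
        then show ?thesis using zero[OF that] u w by auto
      qed
      then show thesis using that[of 1 0] that[of 0 1] u by auto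
    qed
    show thesis
    proof (rule result[of "\<lambda>b. u1 * G b + u2 * Y b" Z "\<lambda>b. w1' * G b + w2' * Y b"])
      fix b assume b: "u1 * G b + u2 * Y b = 0" "Z b = 0" "w1' * G b + w2' * Y b = 0"
      have "(u1 * w2' - u2 * w1') * G b = w2' * (u1 * G b + u2 * Y b) - u2 * (w1' * G b + w2' * Y b)"
        "(u1 * w2' - u2 * w1') * Y b = u1 * (w1' * G b + w2' * Y b) - w1' * (u1 * G b + u2 * Y b)"
        by (simp_all add: algebra_simps)
      then show "b = (\<lambda>_. 0)" using b D ker by simp
    qed (use zerz in \<open>auto intro!: linear_fun3_intros lin\<close>)
  qed
  have tangent: thesis
    if lin': "linear_fun3 U" "linear_fun3 V" and ker': "\<And>b. U b = 0 \<Longrightarrow> V b = 0 \<Longrightarrow> G b = 0 \<and> Y b = 0"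
      and ev': "\<And>b. eval3 q b = U b * (Z b + e' * U b + g' * V b) + f' * (V b)\<^sup>2" for U V e' f' g'
  proof -
    \<comment> \<open>All terms divisible by \<open>U\<close> are absorbed into \<open>W\<close>. If
      \<open>f' = 0\<close> the conic is a pair of lines, otherwise rescaling \<open>W\<close> gives
      \<open>U T = V^2\<close> on \<open>P\<close>.\<close>
    define W where "W = (\<lambda>b. Z b + e' * U b + g' * V b)"
    have W: "linear_fun3 W" unfolding W_def by (intro linear_fun3_intros lin lin')
    have kerW: "b = (\<lambda>_. 0)" if "U b = 0" "V b = 0" "W b = 0" for b
      using that ker' ker by (auto simp: W_def)
    show thesis
    proof (cases "f' = 0")
      case True
      then show thesis using result[OF lin' W kerW] ev' P(1) by (simp add: W_def)
    next
      case False
      have eq: "U b * (- 1 / f' * W b) = (V b)\<^sup>2" if "b \<in> P" for b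
      proof -
        have "U b * W b + f' * (V b)\<^sup>2 = 0" using ev'[of b] P(1)[OF that] by (simp add: W_def)
        then have "f' * (V b)\<^sup>2 = - (U b * W b)" by (simp add: eq_neg_iff_add_eq_0 add.commute)
        then show ?thesis using False by (simp add: field_simps)
      qed
      show thesis
        by (rule result[OF lin' linear_fun3_mult[OF W, of "- 1 / f'"]]) (use eq kerW False in auto)
    qed
  qed
  consider "m = 0" "n = 0" | "m \<noteq> 0" | "n \<noteq> 0" by blast
  then show thesis
  proof cases
    case 1
    show thesis
    proof (cases "\<forall>b\<in>P. G b = 0 \<and> Y b = 0")
      case True
      \<comment> \<open>All of \<open>P\<close> sits at the point \<open>z\<close>, so the two lines
        \<open>G = 0\<close> and \<open>Y = 0\<close> through it will do.\<close>
      then show thesis using two_lines[of 1 0 0 1] by simp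
    next
      case False
      then obtain b0 where b0: "b0 \<in> P" "\<not> (G b0 = 0 \<and> Y b0 = 0)" by blast
      have "e * (G b0)\<^sup>2 + f * (Y b0)\<^sup>2 + g * (G b0 * Y b0) = 0"
        using P(1)[OF b0(1)] ev 1 by simp
      moreover have "\<not> (e = 0 \<and> f = 0 \<and> g = 0)" using nz 1 by simp
      ultimately obtain p r where pr: "\<not> (p = 0 \<and> r = 0)"
        "\<And>x y. e * x\<^sup>2 + f * y\<^sup>2 + g * (x * y) = (Y b0 * x - G b0 * y) * (p * x + r * y)"
        using binary_quadratic_factor b0(2) by metis
      show thesis
      proof (rule two_lines[of "Y b0" "- G b0" p r])
        fix b assume "b \<in> P"
        then have "e * (G b)\<^sup>2 + f * (Y b)\<^sup>2 + g * (G b * Y b) = 0" using P(1) ev 1 by simp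
        then show "(Y b0 * G b + - G b0 * Y b) * (p * G b + r * Y b) = 0" by (simp add: pr(2))
      qed (use b0 pr in auto)
    qed
  next
    case 2
    show thesis
    proof (rule tangent[of "\<lambda>b. m * G b + n * Y b" Y "e / m\<^sup>2" "g / m - 2 * e * n / m\<^sup>2" "f - g * n / m + e * n\<^sup>2 / m\<^sup>2"])
      show "eval3 q b = (m * G b + n * Y b) * (Z b + e / m\<^sup>2 * (m * G b + n * Y b) + (g / m - 2 * e * n / m\<^sup>2) * Y b)
          + (f - g * n / m + e * n\<^sup>2 / m\<^sup>2) * (Y b)\<^sup>2" for b
        unfolding ev using 2 by (simp add: field_simps power2_eq_square)
    qed (use 2 in \<open>auto intro!: linear_fun3_intros lin\<close>)
  next
    case 3
    show thesis
    proof (rule tangent[of "\<lambda>b. m * G b + n * Y b" G "f / n\<^sup>2" "g / n - 2 * f * m / n\<^sup>2" "e - g * m / n + f * m\<^sup>2 / n\<^sup>2"])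
      show "eval3 q b = (m * G b + n * Y b) * (Z b + f / n\<^sup>2 * (m * G b + n * Y b) + (g / n - 2 * f * m / n\<^sup>2) * G b)
          + (e - g * m / n + f * m\<^sup>2 / n\<^sup>2) * (G b)\<^sup>2" for b
        unfolding ev using 3 by (simp add: field_simps power2_eq_square)
    qed (use 3 in \<open>auto intro!: linear_fun3_intros lin\<close>)
  qed
qed

text \<open>The parameter \<open>c\<close> moves the line at infinity off the finitely many given points.\<close>

lemma affine_conic_coordinates:
  fixes q :: "'k::field_char_0 mpoly3"
  assumes q: "q \<in> forms 2" "q \<noteq> 0" and P: "\<And>b. b \<in> P \<Longrightarrow> eval3 q b = 0" "\<And>b. b \<in> P \<Longrightarrow> b \<noteq> (\<lambda>_. 0)"
    and "P \<noteq> {}" "finite P"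
  obtains L0 L1 L2 where "linear_fun3 L0" "linear_fun3 L1" "linear_fun3 L2"
    "\<And>b. L0 b = 0 \<Longrightarrow> L1 b = 0 \<Longrightarrow> L2 b = 0 \<Longrightarrow> b = (\<lambda>_. 0)" "\<And>b. b \<in> P \<Longrightarrow> L0 b \<noteq> 0"
    "(\<forall>b\<in>P. L0 b * L2 b = (L1 b)\<^sup>2) \<or> (\<forall>b\<in>P. L1 b * L2 b = 0)"
proof -
  obtain U V T where lin: "linear_fun3 U" "linear_fun3 V" "linear_fun3 T"
    and ker: "\<And>b. U b = 0 \<Longrightarrow> V b = 0 \<Longrightarrow> T b = 0 \<Longrightarrow> b = (\<lambda>_. 0)"
    and eq: "(\<forall>b\<in>P. U b * T b = (V b)\<^sup>2) \<or> (\<forall>b\<in>P. U b * T b = 0)"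
    using conic_normal_form[OF q P \<open>P \<noteq> {}\<close>] by blast
  \<comment> \<open>For each point the expression is a nonzero polynomial in \<open>c\<close>, so
    only finitely many \<open>c\<close> are excluded.\<close>
  have generic: "\<exists>c. \<forall>b\<in>P. K b + c * L b + c\<^sup>2 * M b \<noteq> 0"
    if "\<And>b. b \<in> P \<Longrightarrow> \<not> (K b = 0 \<and> L b = 0 \<and> M b = 0)" for K L M :: "(3 \<Rightarrow> 'k) \<Rightarrow> 'k"
  proof -
    have "finite {c. poly [:K b, L b, M b:] c = 0}" if "b \<in> P" for b
      using \<open>\<And>b. b \<in> P \<Longrightarrow> \<not> (K b = 0 \<and> L b = 0 \<and> M b = 0)\<close>[OF that] by (intro poly_roots_finite) auto
    then have "finite (\<Union>b\<in>P. {c. poly [:K b, L b, M b:] c = 0})" using \<open>finite P\<close> by blast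
    then obtain c where "c \<notin> (\<Union>b\<in>P. {c. poly [:K b, L b, M b:] c = 0})"
      using ex_new_if_finite infinite_UNIV_char_0 by blast
    then show ?thesis by (intro exI[of _ c]) (auto simp: power2_eq_square algebra_simps)
  qed
  from eq show thesis
  proof
    assume par: "\<forall>b\<in>P. U b * T b = (V b)\<^sup>2"
    \<comment> \<open>The new line at infinity is the tangent to \<open>U T = V^2\<close> at the
      point \<open>(c^2, c, 1)\<close>; replacing \<open>V\<close> by \<open>V - c T\<close>
      preserves the shape of the equation.\<close>
    obtain c where c: "\<forall>b\<in>P. U b + c * (- 2 * V b) + c\<^sup>2 * T b \<noteq> 0"
      using generic[of U "\<lambda>b. - 2 * V b" T] ker P(2) by auto
    show thesis
    proof (rule that[of "\<lambda>b. U b + c * (- 2 * V b) + c\<^sup>2 * T b" "\<lambda>b. V b + (- c) * T b" T])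
      show "b = (\<lambda>_. 0)" if "U b + c * (- 2 * V b) + c\<^sup>2 * T b = 0" "V b + - c * T b = 0" "T b = 0" for b
        using that ker[of b] by simp
      have "(U b + c * (- 2 * V b) + c\<^sup>2 * T b) * T b = (V b + (- c) * T b)\<^sup>2" if "b \<in> P" for b
      proof -
        have "(U b + c * (- 2 * V b) + c\<^sup>2 * T b) * T b = U b * T b - 2 * c * V b * T b + c\<^sup>2 * (T b)\<^sup>2"
          by (simp add: algebra_simps power2_eq_square)
        also have "\<dots> = (V b + (- c) * T b)\<^sup>2"
          using par that by (simp add: algebra_simps power2_eq_square)
        finally show ?thesis .
      qed
      then show "(\<forall>b\<in>P. (U b + c * (- 2 * V b) + c\<^sup>2 * T b) * T b = (V b + (- c) * T b)\<^sup>2) \<or>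
          (\<forall>b\<in>P. (V b + (- c) * T b) * T b = 0)" by blast
    qed (intro linear_fun3_intros lin, intro linear_fun3_intros lin, rule lin, use c in blast)
  next
    assume lines: "\<forall>b\<in>P. U b * T b = 0"
    obtain c where c: "\<forall>b\<in>P. V b + c * U b + c\<^sup>2 * T b \<noteq> 0"
      using generic[of V U T] ker P(2) by auto
    show thesis
      by (rule that[of "\<lambda>b. V b + c * U b + c\<^sup>2 * T b" U T])
        (use c lines ker in \<open>auto intro!: linear_fun3_intros lin\<close>)
  qed
qed

section \<open>Hilbert functions of point sets\<close>

lemma coset_0: "I +>\<^bsub>poly3_ring\<^esub> 0 = I"
  by (auto simp: a_r_coset_def r_coset_def)

text \<open>Needed for dimensions over \<open>quot_scalars I\<close> to be well defined: the
  constants are the image of a field under a ring homomorphism into a nonzero ring.\<close>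

lemma subfield_quot_scalars:
  assumes I: "ideal I (poly3_ring :: 'k::field_char_0 mpoly3 ring)" and proper: "1 \<notin> I"
  shows "subfield (quot_scalars I) (poly3_ring Quot I)"
proof -
  let ?k = "ring_of_type_algebra :: 'k ring"
  let ?h = "\<lambda>c :: 'k. I +>\<^bsub>poly3_ring\<^esub> const3 c"
  have k: "carrier ?k = UNIV" "x \<otimes>\<^bsub>?k\<^esub> y = x * y" "x \<oplus>\<^bsub>?k\<^esub> y = x + y" "\<one>\<^bsub>?k\<^esub> = 1" for x y
    by (simp_all add: ring_of_type_algebra_def)
  interpret k: field ?k by (rule field_from_type_algebra)
  interpret Q: ring "poly3_ring Quot I" by (rule ideal.quotient_is_ring[OF I])
  have "?h \<in> ring_hom ?k (poly3_ring Quot I)"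
  proof (rule ring_hom_memI)
    fix x y :: 'k
    show "?h x \<in> carrier (poly3_ring Quot I)" by (auto simp: FactRing_def A_RCOSETS_def')
    show "?h (x \<otimes>\<^bsub>?k\<^esub> y) = ?h x \<otimes>\<^bsub>poly3_ring Quot I\<^esub> ?h y"
      unfolding quot_mult[OF I] by (simp add: k mult_single)
    show "?h (x \<oplus>\<^bsub>?k\<^esub> y) = ?h x \<oplus>\<^bsub>poly3_ring Quot I\<^esub> ?h y"
      unfolding quot_add[OF I] by (simp add: k single_add)
    show "?h \<one>\<^bsub>?k\<^esub> = \<one>\<^bsub>poly3_ring Quot I\<^esub>" by (simp add: k FactRing_def)
  qed
  then interpret h: ring_hom_ring ?k "poly3_ring Quot I" ?h
    by (intro ring_hom_ringI2 k.ring_axioms Q.ring_axioms)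
  have "\<one>\<^bsub>poly3_ring Quot I\<^esub> \<noteq> \<zero>\<^bsub>poly3_ring Quot I\<^esub>"
  proof
    assume "\<one>\<^bsub>poly3_ring Quot I\<^esub> = \<zero>\<^bsub>poly3_ring Quot I\<^esub>"
    then have "I +>\<^bsub>poly3_ring\<^esub> 1 = I +>\<^bsub>poly3_ring\<^esub> 0" by (simp add: FactRing_def coset_0)
    then show False using proper by (simp only: coset_eq_iff[OF I] diff_zero)
  qed
  then have "subfield (?h ` carrier ?k) (poly3_ring Quot I)"
    by (rule h.img_is_subfield(2)[OF k.carrier_is_subfield])
  then show ?thesis by (simp add: k quot_scalars_def)
qed

text \<open>The cosets of the \<open>h p\<close> form a basis of the graded piece: evaluation at the
  points of \<open>Y\<close> shows independence, and \<open>Y_max\<close> shows that a form agrees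
  modulo \<open>I\<close> with its interpolant on \<open>Y\<close>.\<close>

lemma hilbert_fun_eq_card:
  fixes a :: "nat \<Rightarrow> 3 \<Rightarrow> 'k::field_char_0"
  assumes I: "ideal I poly3_ring" and proper: "1 \<notin> I"
    and I_iff: "\<And>f. f \<in> forms n \<Longrightarrow> f \<in> I \<longleftrightarrow> (\<forall>p<s. eval3 f (a p) = 0)"
    and Y: "Y \<subseteq> {..<s}" and h: "\<And>p. p \<in> Y \<Longrightarrow> h p \<in> forms n"
    and h_eval: "\<And>p q. p \<in> Y \<Longrightarrow> q \<in> Y \<Longrightarrow> eval3 (h p) (a q) = (if q = p then 1 else 0)"
    and Y_max: "\<And>f. f \<in> forms n \<Longrightarrow> (\<And>p. p \<in> Y \<Longrightarrow> eval3 f (a p) = 0) \<Longrightarrow> f \<in> I"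
  shows "hilbert_fun I n = card Y"
proof -
  interpret Q: ring "poly3_ring Quot I" by (rule ideal.quotient_is_ring[OF I])
  let ?c = "\<lambda>f. I +>\<^bsub>poly3_ring\<^esub> f"
  define span where "span W = {?c (\<Sum>p\<in>W. const3 (c p) * h p) | c. True}" for W
  have eval_sum: "eval3 (\<Sum>p\<in>W. const3 (c p) * h p) (a q) = (if q \<in> W then c q else 0)"
    if "W \<subseteq> Y" "q \<in> Y" for W c q
  proof -
    have "finite W" using that(1) Y finite_subset by (meson finite_lessThan)
    have "eval3 (\<Sum>p\<in>W. const3 (c p) * h p) (a q) = (\<Sum>p\<in>W. if q = p then c p else 0)"
      unfolding eval3_sum using that by (intro sum.cong) (auto simp: h_eval)
    then show ?thesis using \<open>finite W\<close> by simp
  qed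
  have sum_forms: "(\<Sum>p\<in>W. const3 (c p) * h p) \<in> forms n" if "W \<subseteq> Y" for W c
    using that h by (intro forms_sum forms_const_mult) auto
  have fin: "finite Y" using Y finite_subset by blast
  have "Q.dimension (card W) (quot_scalars I) (span W)" if "finite W" "W \<subseteq> Y" for W
    using that
  proof (induction W rule: finite_induct)
    case empty
    have "span {} = {\<zero>\<^bsub>poly3_ring Quot I\<^esub>}" by (simp add: span_def coset_0 FactRing_def)
    then show ?case by (metis Q.zero_dim card.empty)
  next
    case (insert q W)
    have "?c (h q) \<in> carrier (poly3_ring Quot I)" by (auto simp: FactRing_def A_RCOSETS_def')
    moreover have "?c (h q) \<notin> span W"
    proof
      assume "?c (h q) \<in> span W"
      then obtain c where "h q - (\<Sum>p\<in>W. const3 (c p) * h p) \<in> I"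
        unfolding span_def using coset_eq_iff[OF I] by blast
      moreover have "h q - (\<Sum>p\<in>W. const3 (c p) * h p) \<in> forms n"
        using insert.prems h sum_forms by (intro forms_diff) auto
      ultimately have "eval3 (h q - (\<Sum>p\<in>W. const3 (c p) * h p)) (a q) = 0"
        using I_iff insert.prems Y by blast
      then show False unfolding eval3_diff using eval_sum[of W q c] h_eval[of q q] insert by simp
    qed
    ultimately have "Q.dimension (Suc (card W)) (quot_scalars I)
        (Q.line_extension (quot_scalars I) (?c (h q)) (span W))"
      using insert by (intro Q.Suc_dim) auto
    moreover have "Q.line_extension (quot_scalars I) (?c (h q)) (span W) = span (insert q W)"
    proof -
      have add: "?c (const3 r) \<otimes>\<^bsub>poly3_ring Quot I\<^esub> ?c (h q) \<oplus>\<^bsub>poly3_ring Quot I\<^esub> ?c f = ?c (const3 r * h q + f)" for r f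
        by (simp only: quot_mult[OF I] quot_add[OF I])
      show ?thesis
      proof (intro Set.set_eqI iffI)
        fix u assume "u \<in> Q.line_extension (quot_scalars I) (?c (h q)) (span W)"
        then obtain r c where "u = ?c (const3 r) \<otimes>\<^bsub>poly3_ring Quot I\<^esub> ?c (h q) \<oplus>\<^bsub>poly3_ring Quot I\<^esub> ?c (\<Sum>p\<in>W. const3 (c p) * h p)"
          unfolding Q.line_extension_mem_iff quot_scalars_def span_def by blast
        then have u: "u = ?c (const3 r * h q + (\<Sum>p\<in>W. const3 (c p) * h p))" by (simp only: add)
        have "(\<Sum>p\<in>W. const3 ((c(q := r)) p) * h p) = (\<Sum>p\<in>W. const3 (c p) * h p)"
          using insert.hyps by (intro sum.cong) auto
        then have "(\<Sum>p\<in>insert q W. const3 ((c(q := r)) p) * h p) = const3 r * h q + (\<Sum>p\<in>W. const3 (c p) * h p)"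
          using insert.hyps by simp
        then show "u \<in> span (insert q W)" unfolding span_def u
          by (intro CollectI exI[of _ "c(q := r)"] conjI TrueI) (simp only:)
      next
        fix u assume "u \<in> span (insert q W)"
        then obtain c where "u = ?c (\<Sum>p\<in>insert q W. const3 (c p) * h p)" by (auto simp: span_def)
        then have "u = ?c (const3 (c q)) \<otimes>\<^bsub>poly3_ring Quot I\<^esub> ?c (h q) \<oplus>\<^bsub>poly3_ring Quot I\<^esub> ?c (\<Sum>p\<in>W. const3 (c p) * h p)"
          using insert.hyps add by simp
        then show "u \<in> Q.line_extension (quot_scalars I) (?c (h q)) (span W)"
          unfolding Q.line_extension_mem_iff quot_scalars_def span_def by blast
      qed
    qed
    ultimately show ?case using insert.hyps by simp
  qed
  then have "Q.dimension (card Y) (quot_scalars I) (span Y)" using fin by blast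
  moreover have "quot_piece I n = span Y"
  proof (intro Set.set_eqI iffI)
    fix u assume "u \<in> quot_piece I n"
    then obtain f where f: "f \<in> forms n" "u = ?c f" by (auto simp: quot_piece_def)
    define f' where "f' = (\<Sum>p\<in>Y. const3 (eval3 f (a p)) * h p)"
    have "f - f' \<in> I"
    proof (rule Y_max)
      show "f - f' \<in> forms n" unfolding f'_def using f(1) sum_forms[of Y] by (intro forms_diff) auto
      show "eval3 (f - f') (a p) = 0" if "p \<in> Y" for p
        unfolding f'_def eval3_diff using that by (subst eval_sum) auto
    qed
    then have "u = ?c f'" using f by (simp add: coset_eq_iff[OF I])
    then show "u \<in> span Y" unfolding span_def f'_def
      by (intro CollectI exI[of _ "\<lambda>p. eval3 f (a p)"] conjI TrueI)
  next
    fix u assume "u \<in> span Y"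
    then show "u \<in> quot_piece I n" unfolding span_def quot_piece_def using sum_forms[of Y] by blast
  qed
  ultimately show ?thesis
    using Q.dimI[OF subfield_quot_scalars[OF I proper]] by (simp add: hilbert_fun_def over_def)
qed

text \<open>The points indexed by \<open>Y\<close> impose independent conditions on forms of degree
  \<open>n\<close>.\<close>

definition separated :: "nat \<Rightarrow> (nat \<Rightarrow> 3 \<Rightarrow> 'k::field_char_0) \<Rightarrow> nat set \<Rightarrow> bool"
  where "separated n a Y \<longleftrightarrow>
    (\<forall>p\<in>Y. \<exists>h\<in>forms n. eval3 h (a p) \<noteq> 0 \<and> (\<forall>q\<in>Y. q \<noteq> p \<longrightarrow> eval3 h (a q) = 0))"

text \<open>The Hilbert function is the size of a largest separated subset \<open>Y\<close>: a form
  vanishing on \<open>Y\<close> but not at some further point would allow that point to be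
  added.\<close>

lemma hilbert_fun_eq_iff_separated:
  fixes a :: "nat \<Rightarrow> 3 \<Rightarrow> 'k::field_char_0"
  assumes I: "ideal I poly3_ring" and proper: "1 \<notin> I"
    and I_iff: "\<And>f. f \<in> forms n \<Longrightarrow> f \<in> I \<longleftrightarrow> (\<forall>p<s. eval3 f (a p) = 0)"
  shows "hilbert_fun I n = s \<longleftrightarrow> separated n a {..<s}"
proof -
  let ?S = "\<lambda>Y. Y \<subseteq> {..<s} \<and> separated n a Y"
  have card: "hilbert_fun I n = card Y"
    if Y: "?S Y" and Y_max: "\<And>f. f \<in> forms n \<Longrightarrow> (\<And>p. p \<in> Y \<Longrightarrow> eval3 f (a p) = 0) \<Longrightarrow> f \<in> I" for Y
  proof -
    obtain h where h: "\<And>p. p \<in> Y \<Longrightarrow> h p \<in> forms n" "\<And>p. p \<in> Y \<Longrightarrow> eval3 (h p) (a p) \<noteq> 0"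
      "\<And>p q. p \<in> Y \<Longrightarrow> q \<in> Y \<Longrightarrow> q \<noteq> p \<Longrightarrow> eval3 (h p) (a q) = 0"
      using Y unfolding separated_def by metis
    show ?thesis
      by (rule hilbert_fun_eq_card[OF I proper I_iff, where h = "\<lambda>p. const3 (inverse (eval3 (h p) (a p))) * h p"])
        (use Y Y_max h in \<open>auto intro: forms_const_mult\<close>)
  qed
  have "?S {}" by (simp add: separated_def)
  moreover have "\<forall>Y. ?S Y \<longrightarrow> card Y < Suc s" using card_mono[of "{..<s}"] by (auto simp: less_Suc_eq_le)
  ultimately obtain Y where Y: "?S Y" and maxi: "\<And>Y'. ?S Y' \<Longrightarrow> card Y' \<le> card Y"
    using ex_has_greatest_nat[of ?S "{}" card "Suc s"] by metis
  have fin: "finite Y" using Y finite_subset by blast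
  have "f \<in> I" if f: "f \<in> forms n" "\<And>p. p \<in> Y \<Longrightarrow> eval3 f (a p) = 0" for f
  proof (rule ccontr)
    assume "f \<notin> I"
    then obtain q where q: "q < s" "eval3 f (a q) \<noteq> 0" using I_iff f by blast
    then have "q \<notin> Y" using f by blast
    have "separated n a (insert q Y)"
      unfolding separated_def
    proof
      fix p assume p: "p \<in> insert q Y"
      show "\<exists>h\<in>forms n. eval3 h (a p) \<noteq> 0 \<and> (\<forall>r\<in>insert q Y. r \<noteq> p \<longrightarrow> eval3 h (a r) = 0)"
      proof (cases "p = q")
        case True
        then show ?thesis using f q by (intro bexI[of _ f]) auto
      next
        case False
        then obtain h where h: "h \<in> forms n" "eval3 h (a p) \<noteq> 0" "\<And>r. r \<in> Y \<Longrightarrow> r \<noteq> p \<Longrightarrow> eval3 h (a r) = 0"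
          using p Y unfolding separated_def by blast
        \<comment> \<open>A multiple of \<open>f\<close> corrects \<open>h\<close> to vanish at
          \<open>q\<close> without changing its values on \<open>Y\<close>.\<close>
        show ?thesis
          using False p h f q
          by (intro bexI[of _ "h - const3 (eval3 h (a q) / eval3 f (a q)) * f"]) (auto intro: forms_diff forms_const_mult)
      qed
    qed
    then have "card (insert q Y) \<le> card Y" using maxi Y q by blast
    then show False using fin \<open>q \<notin> Y\<close> by simp
  qed
  then have "hilbert_fun I n = card Y" using card Y by blast
  moreover have "card Y = s \<longleftrightarrow> Y = {..<s}" using Y card_subset_eq[of "{..<s}" Y] by auto
  moreover have "Y = {..<s}" if "separated n a {..<s}"
    using maxi[of "{..<s}"] that Y by (intro card_seteq) auto
  ultimately show ?thesis using Y by auto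
qed

section \<open>Projective points, separation and vanishing ideals\<close>

lemma proportional_if_minors:
  fixes b c :: "3 \<Rightarrow> 'k::field"
  assumes "b \<noteq> (\<lambda>_. 0)" "c \<noteq> (\<lambda>_. 0)" "\<And>j k. b j * c k = b k * c j"
  shows "\<exists>r. r \<noteq> 0 \<and> c = (\<lambda>i. r * b i)"
proof -
  obtain i where i: "b i \<noteq> 0" using assms(1) by auto
  have "c k = c i / b i * b k" for k using assms(3)[of i k] i by (simp add: field_simps)
  then have c: "c = (\<lambda>k. c i / b i * b k)" by blast
  moreover have "c i / b i \<noteq> 0" using assms(2) c by auto
  ultimately show ?thesis by blast
qed

lemma linear_fun3_dual_form: "linear_fun3 L \<Longrightarrow> \<exists>\<xi>. \<forall>b. L b = eval3 (dual_form \<xi>) b"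
  by (simp add: linear_fun3_def eval3_dual_form)

text \<open>A product of \<open>s - 1\<close> lines, one through each other point and missing
  \<open>p\<close>, isolates \<open>p\<close>. This guarantees that the minimum defining
  \<open>tau\<close> is attained.\<close>

lemma separated_large_degree:
  fixes a :: "nat \<Rightarrow> 3 \<Rightarrow> 'k::field_char_0"
  assumes nz: "\<And>p. p < s \<Longrightarrow> a p \<noteq> (\<lambda>_. 0)"
    and dist: "\<And>p q c. p < s \<Longrightarrow> q < s \<Longrightarrow> c \<noteq> 0 \<Longrightarrow> a q = (\<lambda>i. c * a p i) \<Longrightarrow> p = q"
  shows "separated (s - 1) a {..<s}"
  unfolding separated_def
proof
  fix p assume p: "p \<in> {..<s}"
  have "\<exists>\<xi>. eval3 (dual_form \<xi>) (a q) = 0 \<and> eval3 (dual_form \<xi>) (a p) \<noteq> 0" if q: "q \<in> {..<s} - {p}" for q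
  proof -
    have "\<not> (\<forall>j k. a q j * a p k = a q k * a p j)"
      using proportional_if_minors[of "a q" "a p"] nz dist[of q p] p q by auto
    then obtain j k where jk: "a q j * a p k \<noteq> a q k * a p j" by blast
    \<comment> \<open>A nonvanishing minor of \<open>a q\<close> and \<open>a p\<close>, read as a
      linear form in the second vector.\<close>
    have "linear_fun3 (\<lambda>b. a q j * b k + (- a q k) * b j)" by (intro linear_fun3_intros)
    then obtain \<xi> where "\<forall>b. a q j * b k + (- a q k) * b j = eval3 (dual_form \<xi>) b"
      using linear_fun3_dual_form by blast
    from this[rule_format, of "a q", symmetric] this[rule_format, of "a p", symmetric] show ?thesis
      using jk by (intro exI[of _ \<xi>]) simp
  qed
  then obtain \<xi> where \<xi>: "\<And>q. q \<in> {..<s} - {p} \<Longrightarrow> eval3 (dual_form (\<xi> q)) (a q) = 0"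
    "\<And>q. q \<in> {..<s} - {p} \<Longrightarrow> eval3 (dual_form (\<xi> q)) (a p) \<noteq> 0" by metis
  let ?h = "\<Prod>q\<in>{..<s} - {p}. dual_form (\<xi> q)"
  have "?h \<in> forms (card ({..<s} - {p}))" by (intro forms_prod_one forms_dual_form) simp
  then have "?h \<in> forms (s - 1)" using p by simp
  moreover have "eval3 ?h (a p) \<noteq> 0" using \<xi>(2) by simp
  moreover have "eval3 ?h (a q) = 0" if "q \<in> {..<s}" "q \<noteq> p" for q
    using \<xi>(1)[of q] that by (auto intro!: prod_zero bexI[of _ q])
  ultimately show "\<exists>h\<in>forms (s - 1). eval3 h (a p) \<noteq> 0 \<and> (\<forall>q\<in>{..<s}. q \<noteq> p \<longrightarrow> eval3 h (a q) = 0)" by blast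
qed

lemma proj_plane_member:
  assumes "p \<in> proj_plane" "b \<in> p"
  shows "b \<noteq> (\<lambda>_. 0)" and "p = {c. \<exists>r. r \<noteq> 0 \<and> c = (\<lambda>i. r * b i)}"
proof -
  obtain x where x: "x \<noteq> (\<lambda>_. 0)" "p = proportional `` {x}"
    using assms(1) by (auto simp: proj_plane_def quotient_def)
  obtain t where t: "t \<noteq> 0" "b = (\<lambda>i. t * x i)" and b: "b \<noteq> (\<lambda>_. 0)"
    using assms(2) x by (auto simp: proportional_def)
  show "b \<noteq> (\<lambda>_. 0)" by fact
  have xb: "x = (\<lambda>i. inverse t * b i)" using t by auto
  show "p = {c. \<exists>r. r \<noteq> 0 \<and> c = (\<lambda>i. r * b i)}"
  proof (intro Set.set_eqI iffI)
    fix c assume "c \<in> p"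
    then obtain r where "r \<noteq> 0" "c = (\<lambda>i. r * x i)" using x by (auto simp: proportional_def)
    then show "c \<in> {c. \<exists>r. r \<noteq> 0 \<and> c = (\<lambda>i. r * b i)}"
      using t by (intro CollectI exI[of _ "r * inverse t"]) (auto simp: fun_eq_iff)
  next
    fix c assume "c \<in> {c. \<exists>r. r \<noteq> 0 \<and> c = (\<lambda>i. r * b i)}"
    then obtain r where r: "r \<noteq> 0" "c = (\<lambda>i. r * b i)" by blast
    then have "c = (\<lambda>i. (r * t) * x i)" using t by (simp add: mult.assoc)
    moreover have "c \<noteq> (\<lambda>_. 0)" using r b by (auto simp: fun_eq_iff)
    ultimately show "c \<in> p" using x r t
      by (auto simp: proportional_def intro!: exI[of _ "r * t"])
  qed
qed

lemma vanishes_at_form: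
  assumes "f \<in> forms n" "p \<in> proj_plane" "b \<in> p"
  shows "vanishes_at f p \<longleftrightarrow> eval3 f b = 0"
proof
  assume "eval3 f b = 0"
  then show "vanishes_at f p"
    unfolding vanishes_at_def proj_plane_member(2)[OF assms(2,3)] using eval3_scale[OF assms(1)] by auto
qed (use assms(3) in \<open>auto simp: vanishes_at_def\<close>)

text \<open>All polynomials vanishing on the representatives form an ideal that contains the
  generators, so generating an ideal adds no new forms.\<close>

lemma vanishing_ideal_props:
  fixes Z :: "(3 \<Rightarrow> 'k::field_char_0) set set"
  shows "ideal (vanishing_ideal Z) poly3_ring"
    and "f \<in> forms n \<Longrightarrow> f \<in> vanishing_ideal Z \<longleftrightarrow> (\<forall>p\<in>Z. vanishes_at f p)"
proof -
  interpret R: cring "poly3_ring :: 'k mpoly3 ring" by (rule cring_poly3_ring)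
  let ?G = "{f :: 'k mpoly3. (\<exists>n. f \<in> forms n) \<and> (\<forall>p\<in>Z. vanishes_at f p)}"
  show "ideal (vanishing_ideal Z) poly3_ring"
    unfolding vanishing_ideal_def by (rule R.genideal_ideal) simp
  have "ideal {f. \<forall>p\<in>Z. vanishes_at f p} (poly3_ring :: 'k mpoly3 ring)"
    by (rule ideal_poly3_ringI) (auto simp: vanishes_at_def)
  then have "vanishing_ideal Z \<subseteq> {f. \<forall>p\<in>Z. vanishes_at f p}"
    unfolding vanishing_ideal_def by (rule R.genideal_minimal) blast
  moreover have "?G \<subseteq> vanishing_ideal Z"
    unfolding vanishing_ideal_def by (rule R.genideal_self) simp
  ultimately show "f \<in> forms n \<Longrightarrow> f \<in> vanishing_ideal Z \<longleftrightarrow> (\<forall>p\<in>Z. vanishes_at f p)" by blast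
qed

theorem theorem4p5:
  fixes P :: "nat \<Rightarrow> (3 \<Rightarrow> 'k::field_char_0) set"
    and Z C :: "(3 \<Rightarrow> 'k) set set"
    and a :: "nat \<Rightarrow> 3 \<Rightarrow> 'k"
    and \<alpha> :: "nat \<Rightarrow> 'k"
    and F :: "'k mpoly3"
    and s d :: nat
  assumes "Z = P ` {..<s}"
    and "Z \<subseteq> proj_plane"
    and "inj_on P {..<s}"
    and "conic C"
    and "Z \<subseteq> C"
    and "\<And>i. i < s \<Longrightarrow> a i \<in> P i"
    and "\<And>i. i < s \<Longrightarrow> \<alpha> i \<noteq> 0"
    and "F = (\<Sum>i<s. const3 (\<alpha> i) * dual_form (a i) ^ d)"
    and "F \<noteq> 0"
    and "d \<ge> 2 * tau Z"
  shows "strong_lefschetz (poly3_ring Quot (Ann_form F)) (quot_piece (Ann_form F))"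
proof -
  interpret power_sum s d \<alpha> a .
  have F: "F = gen" by (simp add: assms(8) gen_def)
  \<comment> \<open>An empty sum would make \<open>F\<close> zero.\<close>
  have s: "s > 0" using assms(8,9) by (cases s) auto
  have plane: "P p \<in> proj_plane" if "p < s" for p using assms(1,2) that by auto
  have nz: "a p \<noteq> (\<lambda>_. 0)" if "p < s" for p
    by (rule proj_plane_member(1)[OF plane[OF that] assms(6)[OF that]])
  have dist: "p = q" if "p < s" "q < s" "c \<noteq> 0" "a q = (\<lambda>i. c * a p i)" for p q c
  proof -
    note pq = plane[OF that(1)] plane[OF that(2)]
    have "a q \<in> P p" using proj_plane_member(2)[OF pq(1) assms(6)[OF that(1)]] that(3,4) by auto
    then have "P p = P q"
      using proj_plane_member(2)[OF pq(1), of "a q"] proj_plane_member(2)[OF pq(2) assms(6)[OF that(2)]] by simp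
    then show "p = q" using assms(3) that by (simp add: inj_on_eq_iff)
  qed
  have I_iff: "f \<in> vanishing_ideal Z \<longleftrightarrow> (\<forall>p<s. eval3 f (a p) = 0)" if "f \<in> forms n" for f n
    unfolding vanishing_ideal_props(2)[OF that] assms(1)
    using vanishes_at_form[OF that plane assms(6)] by auto
  have proper: "1 \<notin> vanishing_ideal Z" using I_iff[OF forms_one] s by auto
  have hilbert: "hilbert_fun (vanishing_ideal Z) n = s \<longleftrightarrow> separated n a {..<s}" for n
    by (rule hilbert_fun_eq_iff_separated[OF vanishing_ideal_props(1) proper I_iff])
  have "separated (s - 1) a {..<s}"
    by (rule separated_large_degree) (use nz in blast, rule dist)
  moreover have "card Z = s" using assms(1,3) by (simp add: card_image)
  ultimately have "\<exists>i. hilbert_fun (vanishing_ideal Z) i = card Z"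
    using hilbert by metis
  then have "hilbert_fun (vanishing_ideal Z) (tau Z) = card Z"
    unfolding tau_def by (rule LeastI_ex)
  then have sep: "separated (tau Z) a {..<s}" using hilbert \<open>card Z = s\<close> by simp

  obtain q where q: "q \<noteq> 0" "q \<in> forms 2" "C = {p \<in> proj_plane. vanishes_at q p}"
    using assms(4) unfolding conic_def by blast
  have qa: "eval3 q (a p) = 0" if "p < s" for p
    using that assms(1,5,6) q(3) by (auto simp: vanishes_at_def)
  obtain L0 L1 L2 where L: "linear_fun3 L0" "linear_fun3 L1" "linear_fun3 L2"
    "\<And>b. L0 b = 0 \<Longrightarrow> L1 b = 0 \<Longrightarrow> L2 b = 0 \<Longrightarrow> b = (\<lambda>_. 0)" "\<And>b. b \<in> a ` {..<s} \<Longrightarrow> L0 b \<noteq> 0"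
    "(\<forall>b\<in>a ` {..<s}. L0 b * L2 b = (L1 b)\<^sup>2) \<or> (\<forall>b\<in>a ` {..<s}. L1 b * L2 b = 0)"
    by (rule affine_conic_coordinates[of q "a ` {..<s}"]) (use q qa nz s in auto)
  obtain u v w where uvw: "\<And>b. L0 b = (\<Sum>i\<in>UNIV. u i * b i)" "\<And>b. L1 b = (\<Sum>i\<in>UNIV. v i * b i)"
    "\<And>b. L2 b = (\<Sum>i\<in>UNIV. w i * b i)"
    using L(1-3) unfolding linear_fun3_def by blast
  have "det3 u v w \<noteq> 0" by (rule det3_nonzero) (use L(4) uvw in auto)
  then obtain v0 v1 v2 where basis:
    "\<And>b i. b i = (\<Sum>i\<in>UNIV. u i * b i) * v0 i + (\<Sum>i\<in>UNIV. v i * b i) * v1 i + (\<Sum>i\<in>UNIV. w i * b i) * v2 i"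
    "\<And>x y. (\<Sum>i\<in>UNIV. u i * (v0 i + x * v1 i + y * v2 i)) = 1"
    "\<And>x y. (\<Sum>i\<in>UNIV. v i * (v0 i + x * v1 i + y * v2 i)) = x"
    "\<And>x y. (\<Sum>i\<in>UNIV. w i * (v0 i + x * v1 i + y * v2 i)) = y"
    using dual_basis by blast
  interpret conic_frame s d \<alpha> a v0 v1 v2 u v w "tau Z"
  proof
    show "b i = eval3 (dual_form u) b * v0 i + eval3 (dual_form v) b * v1 i + eval3 (dual_form w) b * v2 i" for b i
      unfolding eval3_dual_form by (rule basis(1))
    show "eval3 (dual_form u) (\<lambda>i. v0 i + x * v1 i + y * v2 i) = 1"
      "eval3 (dual_form v) (\<lambda>i. v0 i + x * v1 i + y * v2 i) = x"
      "eval3 (dual_form w) (\<lambda>i. v0 i + x * v1 i + y * v2 i) = y" for x y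
      unfolding eval3_dual_form by (rule basis)+
    show "eval3 (dual_form u) (a p) \<noteq> 0" if "p < s" for p
      using L(5)[of "a p"] that by (simp add: eval3_dual_form uvw)
    show "\<exists>h\<in>forms (tau Z). eval3 h (a p) \<noteq> 0 \<and> (\<forall>q<s. q \<noteq> p \<longrightarrow> eval3 h (a q) = 0)" if "p < s" for p
      using sep that unfolding separated_def Ball_def lessThan_iff by blast
  qed (use assms(7,10) dist in blast)+
  have coords: "xc p = L1 (a p) / L0 (a p)" "yc p = L2 (a p) / L0 (a p)" for p
    by (simp_all add: xc_def yc_def lam_def eval3_dual_form uvw)
  have "\<exists>l. good l"
    using L(6)
  proof
    assume *: "\<forall>b\<in>a ` {..<s}. L0 b * L2 b = (L1 b)\<^sup>2"
    show ?thesis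
    proof (rule good_parabola)
      fix p assume p: "p < s"
      then have "L0 (a p) \<noteq> 0" "L0 (a p) * L2 (a p) = (L1 (a p))\<^sup>2" using L(5) * by auto
      then show "yc p = (xc p)\<^sup>2" unfolding coords by (simp add: field_simps power2_eq_square)
    qed
  next
    assume "\<forall>b\<in>a ` {..<s}. L1 b * L2 b = 0"
    then show ?thesis by (intro good_lines) (auto simp: coords)
  qed
  then obtain l where l: "good l" ..
  then have l1: "l \<in> forms 1" and l_nz: "\<And>p. p < s \<Longrightarrow> eval3 l (a p) \<noteq> 0" by (auto simp: good_def)
  show ?thesis
    unfolding F
  proof (rule strong_lefschetz_criterion[OF l1])
    fix i g
    assume i: "2 * i \<le> d" and g: "g \<in> forms i"
      and rad: "\<And>h. h \<in> forms i \<Longrightarrow> Lam (l ^ (d - 2 * i) * g * h) = 0"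
    have zero: "eval3 g (a p) = 0" if p: "p < s" for p
    proof (cases "i < tau Z")
      case True
      then show ?thesis using l g rad p unfolding good_def by blast
    next
      case False
      obtain h where h: "h \<in> forms (tau Z)" "eval3 h (a p) \<noteq> 0" "\<And>q. q < s \<Longrightarrow> q \<noteq> p \<Longrightarrow> eval3 h (a q) = 0"
        using separate[OF p] by blast
      \<comment> \<open>For \<open>i \<ge> tau Z\<close> the separating form is raised to degree
        \<open>i\<close> by powers of \<open>l\<close>; it still isolates \<open>p\<close>, because
        \<open>l\<close> has no zero among the points.\<close>
      let ?H = "l ^ (i - tau Z) * h"
      have H: "?H \<in> forms i" using forms_mult[OF forms_power[OF l1, of "i - tau Z"] h(1)] False by simp
      have "l ^ (d - 2 * i) * g * ?H \<in> forms d"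
        using forms_mult[OF forms_mult[OF forms_power[OF l1, of "d - 2 * i"] g] H] i by simp
      then have "(\<Sum>r<s. \<alpha> r * eval3 (l ^ (d - 2 * i) * g * ?H) (a r)) = 0"
        using rad[OF H] by (simp only: Lam_form)
      moreover have "(\<Sum>r<s. \<alpha> r * eval3 (l ^ (d - 2 * i) * g * ?H) (a r)) =
          (\<Sum>r<s. if r = p then \<alpha> r * eval3 (l ^ (d - 2 * i) * g * ?H) (a r) else 0)"
        using h(3) by (intro sum.cong) auto
      ultimately show ?thesis using p h(2) l_nz[OF p] assms(7)[OF p] by simp
    qed
    have "Lam (h * g) = 0" if h: "h \<in> forms (d - i)" for h
      using Lam_form[of "h * g"] forms_mult[OF h g] i zero by simp
    then show "g \<in> Ann_form gen" using form_in_Ann_iff[OF g] by blast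
  qed
qed

end
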